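(* Let $\mathcal{E}$ be a left proper pointed model category with a functorial cone construction, and assume that $\mathcal{E}$ satisfies the following condition: for any two cofibrations $X\rightarrowtail Y$ and $X\rightarrowtail Y'$ with the same domain and any map $h:Y\to Y'$ under $X$, $h$ is a weak equivalence whenever the induced map on quotients $h/X:Y/X\to Y'/X$ is a weak equivalence. (For example, any excisive model category satisfies this condition.) Then a commutative square in $\mathcal{E}$ is a homotopy pushout if and only if the induced map on parallel homotopy cofibres is a weak equivalence; that is, for a commutative square with parallel maps $f:A\to B$, $g:C\to D$ and maps $\alpha:A\to C$, $\beta:B\to D$ with $\beta f=g\alpha$, the square is a homotopy pushout if and only if the induced map $C_f\to C_g$ is a weak equivalence.
   Context: A functorial cone construction on a pointed model category is a functorial factorisation of each map $X\to *$ into a cofibration $X\rightarrowtail CX$ followed by a weak equivalence $CX\xrightarrow{\sim}*$. The homotopy cofibre of $f:X\to Y$ is the mapping cone $C_f=Y\cup_XCX$; the suspension is $\Sigma X=CX/X$. For a cofibration $X\rightarrowtail Y$, $Y/X$ denotes the pushout $Y\cup_X*$. A model category is left proper if weak equivalences are closed under pushout along cofibrations. A model category is *excisive* if it is pointed, left proper and its derived suspension functor on the homotopy category is conservative (reflects isomorphisms). In a left proper model category a commutative square as in the claim is a homotopy pushout if, for some (equivalently any) factorisation of $f$ into a cofibration $A\rightarrowtail \tilde B$ followed by a weak equivalence $\tilde B\to B$, the induced map $C\cup_A\tilde B\to D$ is a weak equivalence. *)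

theory Defs
  imports Main
begin

section \<open>Categories, functors, limits\<close>

record ('o, 'm) cat =
  Ob :: "'o set"
  Ar :: "'m set"
  Dom :: "'m \<Rightarrow> 'o"
  Cod :: "'m \<Rightarrow> 'o"
  Id :: "'o \<Rightarrow> 'm"
  Comp :: "'m \<Rightarrow> 'm \<Rightarrow> 'm"  (infixl "\<cdot>\<index>" 70)

definition hom :: "('o, 'm, 'z) cat_scheme \<Rightarrow> 'o \<Rightarrow> 'o \<Rightarrow> 'm set" where
  "hom E x y = {f \<in> Ar E. Dom E f = x \<and> Cod E f = y}"

definition category :: "('o, 'm, 'z) cat_scheme \<Rightarrow> bool" where
  "category E \<longleftrightarrow>
     (\<forall>f\<in>Ar E. Dom E f \<in> Ob E \<and> Cod E f \<in> Ob E) \<and>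
     (\<forall>x\<in>Ob E. Id E x \<in> hom E x x) \<and>
     (\<forall>f\<in>Ar E. \<forall>g\<in>Ar E. Cod E f = Dom E g \<longrightarrow> g \<cdot>\<^bsub>E\<^esub> f \<in> hom E (Dom E f) (Cod E g)) \<and>
     (\<forall>f\<in>Ar E. f \<cdot>\<^bsub>E\<^esub> Id E (Dom E f) = f \<and> Id E (Cod E f) \<cdot>\<^bsub>E\<^esub> f = f) \<and>
     (\<forall>f\<in>Ar E. \<forall>g\<in>Ar E. \<forall>h\<in>Ar E. Cod E f = Dom E g \<longrightarrow> Cod E g = Dom E h \<longrightarrow>
        h \<cdot>\<^bsub>E\<^esub> (g \<cdot>\<^bsub>E\<^esub> f) = h \<cdot>\<^bsub>E\<^esub> g \<cdot>\<^bsub>E\<^esub> f)"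

definition is_iso :: "('o, 'm, 'z) cat_scheme \<Rightarrow> 'm \<Rightarrow> bool" where
  "is_iso E f \<longleftrightarrow> f \<in> Ar E \<and>
     (\<exists>g\<in>hom E (Cod E f) (Dom E f).
        g \<cdot>\<^bsub>E\<^esub> f = Id E (Dom E f) \<and> f \<cdot>\<^bsub>E\<^esub> g = Id E (Cod E f))"

definition is_functor ::
  "('o, 'm, 'z) cat_scheme \<Rightarrow> ('p, 'n, 'w) cat_scheme \<Rightarrow> ('o \<Rightarrow> 'p) \<Rightarrow> ('m \<Rightarrow> 'n) \<Rightarrow> bool" where
  "is_functor E D Fo Fm \<longleftrightarrow>
     (\<forall>x\<in>Ob E. Fo x \<in> Ob D) \<and>
     (\<forall>f\<in>Ar E. Fm f \<in> hom D (Fo (Dom E f)) (Fo (Cod E f))) \<and>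
     (\<forall>x\<in>Ob E. Fm (Id E x) = Id D (Fo x)) \<and>
     (\<forall>f\<in>Ar E. \<forall>g\<in>Ar E. Cod E f = Dom E g \<longrightarrow> Fm (g \<cdot>\<^bsub>E\<^esub> f) = Fm g \<cdot>\<^bsub>D\<^esub> Fm f)"

definition nat_trans ::
  "('o, 'm, 'z) cat_scheme \<Rightarrow> ('p, 'n, 'w) cat_scheme \<Rightarrow> ('o \<Rightarrow> 'p) \<Rightarrow> ('m \<Rightarrow> 'n) \<Rightarrow>
   ('o \<Rightarrow> 'p) \<Rightarrow> ('m \<Rightarrow> 'n) \<Rightarrow> ('o \<Rightarrow> 'n) \<Rightarrow> bool" where
  "nat_trans E D Fo Fm Go Gm t \<longleftrightarrow>
     (\<forall>x\<in>Ob E. t x \<in> hom D (Fo x) (Go x)) \<and>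
     (\<forall>f\<in>Ar E. Gm f \<cdot>\<^bsub>D\<^esub> t (Dom E f) = t (Cod E f) \<cdot>\<^bsub>D\<^esub> Fm f)"

definition conservative ::
  "('o, 'm, 'z) cat_scheme \<Rightarrow> ('p, 'n, 'w) cat_scheme \<Rightarrow> ('m \<Rightarrow> 'n) \<Rightarrow> bool" where
  "conservative E D Fm \<longleftrightarrow> (\<forall>f\<in>Ar E. is_iso D (Fm f) \<longrightarrow> is_iso E f)"

definition is_cone ::
  "('i, 'a, 'w) cat_scheme \<Rightarrow> ('o, 'm, 'z) cat_scheme \<Rightarrow> ('i \<Rightarrow> 'o) \<Rightarrow> ('a \<Rightarrow> 'm) \<Rightarrow>
   'o \<Rightarrow> ('i \<Rightarrow> 'm) \<Rightarrow> bool" where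
  "is_cone J E Fo Fm x p \<longleftrightarrow> x \<in> Ob E \<and>
     (\<forall>j\<in>Ob J. p j \<in> hom E x (Fo j)) \<and>
     (\<forall>a\<in>Ar J. Fm a \<cdot>\<^bsub>E\<^esub> p (Dom J a) = p (Cod J a))"

definition is_cocone ::
  "('i, 'a, 'w) cat_scheme \<Rightarrow> ('o, 'm, 'z) cat_scheme \<Rightarrow> ('i \<Rightarrow> 'o) \<Rightarrow> ('a \<Rightarrow> 'm) \<Rightarrow>
   'o \<Rightarrow> ('i \<Rightarrow> 'm) \<Rightarrow> bool" where
  "is_cocone J E Fo Fm x p \<longleftrightarrow> x \<in> Ob E \<and>
     (\<forall>j\<in>Ob J. p j \<in> hom E (Fo j) x) \<and>
     (\<forall>a\<in>Ar J. p (Cod J a) \<cdot>\<^bsub>E\<^esub> Fm a = p (Dom J a))"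

definition is_limit ::
  "('i, 'a, 'w) cat_scheme \<Rightarrow> ('o, 'm, 'z) cat_scheme \<Rightarrow> ('i \<Rightarrow> 'o) \<Rightarrow> ('a \<Rightarrow> 'm) \<Rightarrow>
   'o \<Rightarrow> ('i \<Rightarrow> 'm) \<Rightarrow> bool" where
  "is_limit J E Fo Fm x p \<longleftrightarrow> is_cone J E Fo Fm x p \<and>
     (\<forall>y q. is_cone J E Fo Fm y q \<longrightarrow>
        (\<exists>!u. u \<in> hom E y x \<and> (\<forall>j\<in>Ob J. p j \<cdot>\<^bsub>E\<^esub> u = q j)))"

definition is_colimit ::
  "('i, 'a, 'w) cat_scheme \<Rightarrow> ('o, 'm, 'z) cat_scheme \<Rightarrow> ('i \<Rightarrow> 'o) \<Rightarrow> ('a \<Rightarrow> 'm) \<Rightarrow>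
   'o \<Rightarrow> ('i \<Rightarrow> 'm) \<Rightarrow> bool" where
  "is_colimit J E Fo Fm x p \<longleftrightarrow> is_cocone J E Fo Fm x p \<and>
     (\<forall>y q. is_cocone J E Fo Fm y q \<longrightarrow>
        (\<exists>!u. u \<in> hom E x y \<and> (\<forall>j\<in>Ob J. u \<cdot>\<^bsub>E\<^esub> p j = q j)))"

text \<open>Every finite category is isomorphic to one whose objects and arrows are natural numbers.\<close>

definition finitely_bicomplete :: "('o, 'm, 'z) cat_scheme \<Rightarrow> bool" where
  "finitely_bicomplete E \<longleftrightarrow>
     (\<forall>(J :: (nat, nat) cat) Fo Fm. category J \<longrightarrow> finite (Ob J) \<longrightarrow> finite (Ar J) \<longrightarrow>
        is_functor J E Fo Fm \<longrightarrow>
        (\<exists>x p. is_limit J E Fo Fm x p) \<and> (\<exists>x p. is_colimit J E Fo Fm x p))"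

definition zero_object :: "('o, 'm, 'z) cat_scheme \<Rightarrow> 'o \<Rightarrow> bool" where
  "zero_object E z \<longleftrightarrow> z \<in> Ob E \<and>
     (\<forall>x\<in>Ob E. (\<exists>!f. f \<in> hom E x z) \<and> (\<exists>!f. f \<in> hom E z x))"

definition comm_square :: "('o, 'm, 'z) cat_scheme \<Rightarrow> 'm \<Rightarrow> 'm \<Rightarrow> 'm \<Rightarrow> 'm \<Rightarrow> bool" where
  "comm_square E f g i j \<longleftrightarrow>
     f \<in> Ar E \<and> g \<in> Ar E \<and> i \<in> Ar E \<and> j \<in> Ar E \<and>
     Dom E f = Dom E g \<and> Cod E f = Dom E i \<and> Cod E g = Dom E j \<and> Cod E i = Cod E j \<and>
     i \<cdot>\<^bsub>E\<^esub> f = j \<cdot>\<^bsub>E\<^esub> g"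

text \<open>In \<open>is_pushout E f g i j\<close> the span consists of \<open>f : A \<rightarrow> B\<close> and \<open>g : A \<rightarrow> C\<close>, and
  \<open>i : B \<rightarrow> P\<close>, \<open>j : C \<rightarrow> P\<close> are the legs of the universal cocone, \<open>P = B \<union>\<^sub>A C\<close>. Thus \<open>i\<close> is
  the cobase change of \<open>g\<close> along \<open>f\<close>.\<close>

definition is_pushout :: "('o, 'm, 'z) cat_scheme \<Rightarrow> 'm \<Rightarrow> 'm \<Rightarrow> 'm \<Rightarrow> 'm \<Rightarrow> bool" where
  "is_pushout E f g i j \<longleftrightarrow> comm_square E f g i j \<and>
     (\<forall>i' j'. comm_square E f g i' j' \<longrightarrow>
        (\<exists>!u. u \<in> hom E (Cod E i) (Cod E i') \<and> u \<cdot>\<^bsub>E\<^esub> i = i' \<and> u \<cdot>\<^bsub>E\<^esub> j = j'))"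

text \<open>\<open>q : Y \<rightarrow> Y/X\<close> exhibits the quotient \<open>Y/X = Y \<union>\<^sub>X *\<close> of \<open>i : X \<rightarrow> Y\<close>, where \<open>pt\<close> is \<open>*\<close>.\<close>

definition is_quotient :: "('o, 'm, 'z) cat_scheme \<Rightarrow> 'o \<Rightarrow> 'm \<Rightarrow> 'm \<Rightarrow> bool" where
  "is_quotient E pt i q \<longleftrightarrow> (\<exists>t z. t \<in> hom E (Dom E i) pt \<and> is_pushout E i t q z)"


section \<open>Model categories\<close>

record ('o, 'm) model_cat = "('o, 'm) cat" +
  Weq :: "'m set"
  Cofib :: "'m set"
  Fibr :: "'m set"

definition has_lifting :: "('o, 'm, 'z) cat_scheme \<Rightarrow> 'm \<Rightarrow> 'm \<Rightarrow> bool" where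
  "has_lifting E i p \<longleftrightarrow>
     (\<forall>u v. comm_square E i u v p \<longrightarrow>
        (\<exists>h\<in>hom E (Cod E i) (Dom E p). h \<cdot>\<^bsub>E\<^esub> i = u \<and> p \<cdot>\<^bsub>E\<^esub> h = v))"

definition is_retract :: "('o, 'm, 'z) cat_scheme \<Rightarrow> 'm \<Rightarrow> 'm \<Rightarrow> bool" where
  "is_retract E f g \<longleftrightarrow> f \<in> Ar E \<and> g \<in> Ar E \<and>
     (\<exists>s\<in>hom E (Dom E f) (Dom E g). \<exists>r\<in>hom E (Dom E g) (Dom E f).
      \<exists>s'\<in>hom E (Cod E f) (Cod E g). \<exists>r'\<in>hom E (Cod E g) (Cod E f).
        r \<cdot>\<^bsub>E\<^esub> s = Id E (Dom E f) \<and> r' \<cdot>\<^bsub>E\<^esub> s' = Id E (Cod E f) \<and>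
        g \<cdot>\<^bsub>E\<^esub> s = s' \<cdot>\<^bsub>E\<^esub> f \<and> f \<cdot>\<^bsub>E\<^esub> r = r' \<cdot>\<^bsub>E\<^esub> g)"

definition wide_subcategory :: "('o, 'm, 'z) cat_scheme \<Rightarrow> 'm set \<Rightarrow> bool" where
  "wide_subcategory E S \<longleftrightarrow> S \<subseteq> Ar E \<and> (\<forall>x\<in>Ob E. Id E x \<in> S) \<and>
     (\<forall>f\<in>S. \<forall>g\<in>S. Cod E f = Dom E g \<longrightarrow> g \<cdot>\<^bsub>E\<^esub> f \<in> S)"

text \<open>Quillen's (closed) model categories: only finite limits and colimits are required, and the
  factorisations need not be functorial. Categories that are model categories in a stronger
  sense (bicomplete, functorial factorisations) are in particular model categories here.\<close>

definition model_category :: "('o, 'm, 'z) model_cat_scheme \<Rightarrow> bool" where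
  "model_category E \<longleftrightarrow>
     category E \<and> finitely_bicomplete E \<and>
     wide_subcategory E (Weq E) \<and> wide_subcategory E (Cofib E) \<and> wide_subcategory E (Fibr E) \<and>
     (\<forall>f\<in>Ar E. \<forall>g\<in>Ar E. Cod E f = Dom E g \<longrightarrow>
        (f \<in> Weq E \<and> g \<cdot>\<^bsub>E\<^esub> f \<in> Weq E \<longrightarrow> g \<in> Weq E) \<and>
        (g \<in> Weq E \<and> g \<cdot>\<^bsub>E\<^esub> f \<in> Weq E \<longrightarrow> f \<in> Weq E)) \<and>
     (\<forall>f g. is_retract E f g \<longrightarrow>
        (g \<in> Weq E \<longrightarrow> f \<in> Weq E) \<and> (g \<in> Cofib E \<longrightarrow> f \<in> Cofib E) \<and>
        (g \<in> Fibr E \<longrightarrow> f \<in> Fibr E)) \<and>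
     (\<forall>i\<in>Cofib E. \<forall>p\<in>Fibr E. i \<in> Weq E \<or> p \<in> Weq E \<longrightarrow> has_lifting E i p) \<and>
     (\<forall>f\<in>Ar E. \<exists>i p. i \<in> Cofib E \<and> p \<in> Fibr E \<and> p \<in> Weq E \<and>
        Cod E i = Dom E p \<and> p \<cdot>\<^bsub>E\<^esub> i = f) \<and>
     (\<forall>f\<in>Ar E. \<exists>i p. i \<in> Cofib E \<and> i \<in> Weq E \<and> p \<in> Fibr E \<and>
        Cod E i = Dom E p \<and> p \<cdot>\<^bsub>E\<^esub> i = f)"

definition left_proper :: "('o, 'm, 'z) model_cat_scheme \<Rightarrow> bool" where
  "left_proper E \<longleftrightarrow>
     (\<forall>f w w' f'. is_pushout E f w w' f' \<longrightarrow> f \<in> Cofib E \<longrightarrow> w \<in> Weq E \<longrightarrow> w' \<in> Weq E)"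

text \<open>A functorial factorisation \<open>X \<rightarrow> CX \<rightarrow> *\<close> amounts to a functor \<open>C\<close> (with parts \<open>Co\<close>, \<open>Cm\<close>)
  and a natural map \<open>c : X \<rightarrow> CX\<close>, as compatibility over the terminal object is automatic.\<close>

definition functorial_cone ::
  "('o, 'm, 'z) model_cat_scheme \<Rightarrow> 'o \<Rightarrow> ('o \<Rightarrow> 'o) \<Rightarrow> ('m \<Rightarrow> 'm) \<Rightarrow> ('o \<Rightarrow> 'm) \<Rightarrow> bool" where
  "functorial_cone E pt Co Cm c \<longleftrightarrow>
     is_functor E E Co Cm \<and> nat_trans E E (\<lambda>x. x) (\<lambda>f. f) Co Cm c \<and>
     (\<forall>x\<in>Ob E. c x \<in> Cofib E \<and> (\<exists>e\<in>hom E (Co x) pt. e \<in> Weq E))"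

text \<open>The mapping cone \<open>C\<^sub>f = B \<union>\<^sub>A CA\<close> of \<open>f : A \<rightarrow> B\<close>, with legs \<open>b : B \<rightarrow> C\<^sub>f\<close> and
  \<open>k : CA \<rightarrow> C\<^sub>f\<close>.\<close>

definition mapping_cone ::
  "('o, 'm, 'z) cat_scheme \<Rightarrow> ('o \<Rightarrow> 'm) \<Rightarrow> 'm \<Rightarrow> 'm \<Rightarrow> 'm \<Rightarrow> bool" where
  "mapping_cone E c f b k \<longleftrightarrow> is_pushout E f (c (Dom E f)) b k"

text \<open>The square has top \<open>f : A \<rightarrow> B\<close>, bottom \<open>g : C \<rightarrow> D\<close> and sides \<open>\<alpha> : A \<rightarrow> C\<close>, \<open>\<beta> : B \<rightarrow> D\<close>;
  \<open>f = w \<cdot> i\<close> is the factorisation through \<open>B'\<close>, and \<open>u\<close> is the map \<open>C \<union>\<^sub>A B' \<rightarrow> D\<close>.\<close>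

definition homotopy_pushout ::
  "('o, 'm, 'z) model_cat_scheme \<Rightarrow> 'm \<Rightarrow> 'm \<Rightarrow> 'm \<Rightarrow> 'm \<Rightarrow> bool" where
  "homotopy_pushout E f g \<alpha> \<beta> \<longleftrightarrow> comm_square E f \<alpha> \<beta> g \<and>
     (\<exists>i w j k u. i \<in> Cofib E \<and> w \<in> Weq E \<and> Cod E i = Dom E w \<and> w \<cdot>\<^bsub>E\<^esub> i = f \<and>
        is_pushout E \<alpha> i j k \<and>
        u \<in> hom E (Cod E j) (Cod E g) \<and> u \<cdot>\<^bsub>E\<^esub> j = g \<and> u \<cdot>\<^bsub>E\<^esub> k = \<beta> \<cdot>\<^bsub>E\<^esub> w \<and>
        u \<in> Weq E)"

definition quotients_detect_weq :: "('o, 'm, 'z) model_cat_scheme \<Rightarrow> 'o \<Rightarrow> bool" where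
  "quotients_detect_weq E pt \<longleftrightarrow>
     (\<forall>i i' h q q' k.
        i \<in> Cofib E \<longrightarrow> i' \<in> Cofib E \<longrightarrow> Dom E i = Dom E i' \<longrightarrow>
        h \<in> hom E (Cod E i) (Cod E i') \<longrightarrow> h \<cdot>\<^bsub>E\<^esub> i = i' \<longrightarrow>
        is_quotient E pt i q \<longrightarrow> is_quotient E pt i' q' \<longrightarrow>
        k \<in> hom E (Cod E q) (Cod E q') \<longrightarrow> k \<cdot>\<^bsub>E\<^esub> q = q' \<cdot>\<^bsub>E\<^esub> h \<longrightarrow>
        k \<in> Weq E \<longrightarrow> h \<in> Weq E)"


section \<open>The homotopy category and excisive model categories\<close>

text \<open>The homotopy category is the localisation at the weak equivalences. Its arrows are zigzags,
  i.e. words (read in diagrammatic order) in arrows and formal inverses of weak equivalences,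
  modulo the relations that make the evident map from the given category a functor and the
  formal inverses inverse to the weak equivalences.\<close>

datatype 'm letter = Fwd 'm | Bwd 'm

inductive zigzag :: "('o, 'm, 'z) model_cat_scheme \<Rightarrow> 'o \<Rightarrow> 'm letter list \<Rightarrow> 'o \<Rightarrow> bool"
  for E where
  nil: "x \<in> Ob E \<Longrightarrow> zigzag E x [] x"
| fwd: "f \<in> Ar E \<Longrightarrow> zigzag E (Cod E f) us y \<Longrightarrow> zigzag E (Dom E f) (Fwd f # us) y"
| bwd: "w \<in> Weq E \<Longrightarrow> zigzag E (Dom E w) us y \<Longrightarrow> zigzag E (Cod E w) (Bwd w # us) y"

inductive zigzag_eq ::
  "('o, 'm, 'z) model_cat_scheme \<Rightarrow> 'o \<Rightarrow> 'o \<Rightarrow> 'm letter list \<Rightarrow> 'm letter list \<Rightarrow> bool"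
  for E x y where
  refl: "zigzag E x us y \<Longrightarrow> zigzag_eq E x y us us"
| sym: "zigzag_eq E x y us vs \<Longrightarrow> zigzag_eq E x y vs us"
| trans: "zigzag_eq E x y us vs \<Longrightarrow> zigzag_eq E x y vs ws \<Longrightarrow> zigzag_eq E x y us ws"
| ident: "a \<in> Ob E \<Longrightarrow> zigzag E x (us @ Fwd (Id E a) # vs) y \<Longrightarrow>
    zigzag_eq E x y (us @ Fwd (Id E a) # vs) (us @ vs)"
| comp: "zigzag E x (us @ Fwd f # Fwd g # vs) y \<Longrightarrow>
    zigzag_eq E x y (us @ Fwd f # Fwd g # vs) (us @ Fwd (g \<cdot>\<^bsub>E\<^esub> f) # vs)"
| fwd_bwd: "zigzag E x (us @ Fwd w # Bwd w # vs) y \<Longrightarrow>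
    zigzag_eq E x y (us @ Fwd w # Bwd w # vs) (us @ vs)"
| bwd_fwd: "zigzag E x (us @ Bwd w # Fwd w # vs) y \<Longrightarrow>
    zigzag_eq E x y (us @ Bwd w # Fwd w # vs) (us @ vs)"

type_synonym ('o, 'm) ho_arrow = "'o \<times> 'm letter list set \<times> 'o"

definition zz_class ::
  "('o, 'm, 'z) model_cat_scheme \<Rightarrow> 'o \<Rightarrow> 'm letter list \<Rightarrow> 'o \<Rightarrow> ('o, 'm) ho_arrow" where
  "zz_class E x us y = (x, {vs. zigzag_eq E x y us vs}, y)"

definition Ho :: "('o, 'm, 'z) model_cat_scheme \<Rightarrow> ('o, ('o, 'm) ho_arrow) cat" where
  "Ho E = \<lparr>
     Ob = Ob E,
     Ar = {zz_class E x us y | x us y. zigzag E x us y},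
     Dom = (\<lambda>(x, U, y). x),
     Cod = (\<lambda>(x, U, y). y),
     Id = (\<lambda>x. zz_class E x [] x),
     Comp = (\<lambda>(y', V, z) (x, U, y).
       (x, {ws. \<exists>us\<in>U. \<exists>vs\<in>V. zigzag_eq E x z (us @ vs) ws}, z)) \<rparr>"

definition loc :: "('o, 'm, 'z) model_cat_scheme \<Rightarrow> 'm \<Rightarrow> ('o, 'm) ho_arrow" where
  "loc E f = zz_class E (Dom E f) [Fwd f] (Cod E f)"

text \<open>\<open>(L, t)\<close> is a total left derived functor of the endofunctor \<open>F\<close>: it is terminal among
  functors \<open>G : Ho E \<rightarrow> Ho E\<close> equipped with a natural transformation \<open>G \<circ> loc \<rightarrow> loc \<circ> F\<close>.
  (The localisation functor is the identity on objects.)\<close>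

definition total_left_derived ::
  "('o, 'm, 'z) model_cat_scheme \<Rightarrow> ('o \<Rightarrow> 'o) \<Rightarrow> ('m \<Rightarrow> 'm) \<Rightarrow>
   ('o \<Rightarrow> 'o) \<Rightarrow> (('o, 'm) ho_arrow \<Rightarrow> ('o, 'm) ho_arrow) \<Rightarrow>
   ('o \<Rightarrow> ('o, 'm) ho_arrow) \<Rightarrow> bool" where
  "total_left_derived E Fo Fm Lo Lm t \<longleftrightarrow>
     is_functor (Ho E) (Ho E) Lo Lm \<and>
     nat_trans E (Ho E) Lo (\<lambda>f. Lm (loc E f)) Fo (\<lambda>f. loc E (Fm f)) t \<and>
     (\<forall>Go Gm s. is_functor (Ho E) (Ho E) Go Gm \<longrightarrow>
        nat_trans E (Ho E) Go (\<lambda>f. Gm (loc E f)) Fo (\<lambda>f. loc E (Fm f)) s \<longrightarrow>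
        (\<exists>r. nat_trans (Ho E) (Ho E) Go Gm Lo Lm r \<and> (\<forall>x\<in>Ob E. t x \<cdot>\<^bsub>Ho E\<^esub> r x = s x) \<and>
           (\<forall>r'. nat_trans (Ho E) (Ho E) Go Gm Lo Lm r' \<longrightarrow>
              (\<forall>x\<in>Ob E. t x \<cdot>\<^bsub>Ho E\<^esub> r' x = s x) \<longrightarrow> (\<forall>x\<in>Ob E. r' x = r x))))"

definition suspension_functor ::
  "('o, 'm, 'z) cat_scheme \<Rightarrow> 'o \<Rightarrow> ('m \<Rightarrow> 'm) \<Rightarrow> ('o \<Rightarrow> 'm) \<Rightarrow>
   ('o \<Rightarrow> 'o) \<Rightarrow> ('m \<Rightarrow> 'm) \<Rightarrow> bool" where
  "suspension_functor E pt Cm c So Sm \<longleftrightarrow>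
     is_functor E E So Sm \<and>
     (\<exists>q. (\<forall>x\<in>Ob E. Cod E (q x) = So x \<and> is_quotient E pt (c x) (q x)) \<and>
          (\<forall>f\<in>Ar E. Sm f \<cdot>\<^bsub>E\<^esub> q (Dom E f) = q (Cod E f) \<cdot>\<^bsub>E\<^esub> Cm f))"

text \<open>Suspension functors and their total left derived functors are unique up to natural
  isomorphism, so it does not matter which are used.\<close>

definition excisive ::
  "('o, 'm, 'z) model_cat_scheme \<Rightarrow> 'o \<Rightarrow> ('m \<Rightarrow> 'm) \<Rightarrow> ('o \<Rightarrow> 'm) \<Rightarrow> bool" where
  "excisive E pt Cm c \<longleftrightarrow>
     model_category E \<and> zero_object E pt \<and> left_proper E \<and>
     (\<exists>So Sm Lo Lm t. suspension_functor E pt Cm c So Sm \<and>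
        total_left_derived E So Sm Lo Lm t \<and> conservative (Ho E) (Ho E) Lm)"

end

theory Submission
  imports Defs
begin

text \<open>The mapping cone \<open>Y \<union>\<^sub>X CX\<close> of a cofibration \<open>X \<rightarrow> Y\<close> is weakly equivalent to the quotient \<open>Y/X\<close>:
  collapsing the cone is a cobase change of the weak equivalence \<open>CX \<rightarrow> *\<close> along a cofibration
  (\<open>collapse_cone\<close>). For a commutative square, write \<open>f\<close> as a cofibration \<open>i : A \<rightarrow> B'\<close> followed by a
  weak equivalence, and let \<open>j : C \<rightarrow> D'\<close> be the cobase change of \<open>i\<close> along \<open>\<alpha>\<close>. By left properness
  the cones of \<open>f\<close> and \<open>i\<close> are equivalent, and those of \<open>i\<close> and \<open>j\<close> are so because \<open>B'/A = D'/C\<close>.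
  Hence \<open>C\<^sub>f \<rightarrow> C\<^sub>g\<close> is a weak equivalence if and only if \<open>C\<^sub>j \<rightarrow> C\<^sub>g\<close> is. On the other hand, the square
  is a homotopy pushout if and only if \<open>D' \<rightarrow> D\<close> is a weak equivalence. The two conditions agree: one
  direction is left properness, the other the detection of weak equivalences on quotients
  (\<open>mapping_cone_detects_weq\<close>).

  Now let \<open>h : Y \<rightarrow> Y'\<close> be a map under \<open>X\<close> that induces a weak equivalence \<open>Y/X \<rightarrow> Y'/X\<close>, in an excisive
  model category. The suspension of \<open>Y\<close> is the quotient of \<open>CX \<union>\<^sub>X CY\<close> by the mapping cone of
  \<open>X \<rightarrow> Y\<close>. The map \<open>h\<close> induces weak equivalences of the former, as \<open>CY\<close> and \<open>CY'\<close> are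
  contractible, and of the latter, as it collapses to \<open>Y/X\<close>. By the gluing lemma the suspension of \<open>h\<close>
  is a weak equivalence (\<open>quotient_weq_imp_suspension_weq\<close>). As the derived suspension is conservative, \<open>h\<close> becomes
  invertible in the homotopy category.

  It remains to see that the localisation reflects weak equivalences (\<open>weq_of_loc_iso\<close>). For cofibrant
  \<open>A\<close>, homotopy classes of maps from \<open>A\<close> into fibrant replacements form a functor that inverts weak
  equivalences and thus factors through the localisation. A fibration between fibrant and cofibrant
  objects which is bijective on all these homotopy classes is a retract of a map homotopic to the
  identity, hence a weak equivalence.\<close>

section \<open>Pushouts\<close>

locale cat_locale =
  fixes E :: "('o, 'm, 'z) cat_scheme" (structure)
  assumes category: "category E"
begin

lemma homD:
  assumes "f \<in> hom E x y"
  shows "f \<in> Ar E" and "Dom E f = x" and "Cod E f = y" and "x \<in> Ob E" and "y \<in> Ob E"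
  using assms category by (auto simp: hom_def category_def)

lemma arr_hom: "f \<in> Ar E \<Longrightarrow> f \<in> hom E (Dom E f) (Cod E f)"
  by (simp add: hom_def)

lemma Dom_Ob [simp]: "f \<in> Ar E \<Longrightarrow> Dom E f \<in> Ob E"
  and Cod_Ob [simp]: "f \<in> Ar E \<Longrightarrow> Cod E f \<in> Ob E"
  using category by (auto simp: category_def)

lemma id_hom [simp, intro]: "x \<in> Ob E \<Longrightarrow> Id E x \<in> hom E x x"
  using category by (auto simp: category_def)

lemma id_arr [simp]: "x \<in> Ob E \<Longrightarrow> Id E x \<in> Ar E"
  and Dom_id [simp]: "x \<in> Ob E \<Longrightarrow> Dom E (Id E x) = x"
  and Cod_id [simp]: "x \<in> Ob E \<Longrightarrow> Cod E (Id E x) = x"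
  using id_hom by (auto simp: hom_def)

lemma comp_hom [intro]: "f \<in> hom E x y \<Longrightarrow> g \<in> hom E y z \<Longrightarrow> g \<cdot> f \<in> hom E x z"
  using category by (auto simp: hom_def category_def)

lemma comp_arr [simp]:
  assumes "f \<in> Ar E" "g \<in> Ar E" "Cod E f = Dom E g"
  shows "g \<cdot> f \<in> Ar E" and "Dom E (g \<cdot> f) = Dom E f" and "Cod E (g \<cdot> f) = Cod E g"
  using comp_hom[of f _ _ g] assms by (auto simp: hom_def)

lemma comp_id [simp]: "f \<in> hom E x y \<Longrightarrow> f \<cdot> Id E x = f"
  and id_comp [simp]: "f \<in> hom E x y \<Longrightarrow> Id E y \<cdot> f = f"
  using category by (auto simp: hom_def category_def)

lemma assoc:
  "f \<in> hom E w x \<Longrightarrow> g \<in> hom E x y \<Longrightarrow> h \<in> hom E y z \<Longrightarrow> h \<cdot> g \<cdot> f = h \<cdot> (g \<cdot> f)"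
  using category by (auto simp: hom_def category_def)

lemma comp_assoc:
  "f \<in> Ar E \<Longrightarrow> g \<in> Ar E \<Longrightarrow> h \<in> Ar E \<Longrightarrow> Cod E f = Dom E g \<Longrightarrow> Cod E g = Dom E h \<Longrightarrow>
    h \<cdot> g \<cdot> f = h \<cdot> (g \<cdot> f)"
  using category by (auto simp: category_def)

text \<open>As associativity holds for composable arrows only, an equation \<open>a \<cdot> b = d\<close> does not apply by
  itself inside the right-nested composite \<open>a \<cdot> (b \<cdot> f)\<close>; this is the form in which it does.\<close>

lemma comp_reassoc:
  "a \<cdot> b = d \<Longrightarrow> f \<in> Ar E \<Longrightarrow> b \<in> Ar E \<Longrightarrow> a \<in> Ar E \<Longrightarrow> Cod E f = Dom E b \<Longrightarrow> Cod E b = Dom E a \<Longrightarrow>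
    a \<cdot> (b \<cdot> f) = d \<cdot> f"
  using comp_assoc by metis

lemma comm_square_iff:
  "comm_square E f g i j \<longleftrightarrow>
    (\<exists>A B C P. f \<in> hom E A B \<and> g \<in> hom E A C \<and> i \<in> hom E B P \<and> j \<in> hom E C P \<and> i \<cdot> f = j \<cdot> g)"
  by (auto simp: comm_square_def hom_def)

lemma comm_squareI:
  "f \<in> hom E A B \<Longrightarrow> g \<in> hom E A C \<Longrightarrow> i \<in> hom E B P \<Longrightarrow> j \<in> hom E C P \<Longrightarrow> i \<cdot> f = j \<cdot> g \<Longrightarrow>
    comm_square E f g i j"
  by (auto simp: comm_square_iff)

lemma pushout_homs:
  assumes "is_pushout E f g i j"
  obtains A B C P where "f \<in> hom E A B" "g \<in> hom E A C" "i \<in> hom E B P" "j \<in> hom E C P"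
    "i \<cdot> f = j \<cdot> g"
  using assms by (auto simp: is_pushout_def comm_square_iff)

lemma pushout_comm: "is_pushout E f g i j \<Longrightarrow> i \<cdot> f = j \<cdot> g"
  by (auto simp: is_pushout_def comm_square_def)

lemma pushout_legs:
  assumes "is_pushout E f g i j" "f \<in> hom E A B" "g \<in> hom E A C"
  shows "i \<in> hom E B (Cod E i)" and "j \<in> hom E C (Cod E i)"
  using assms by (simp_all add: is_pushout_def comm_square_def hom_def)

lemma pushout_induce:
  assumes po: "is_pushout E f g i j" and i: "i \<in> hom E B P" and j: "j \<in> hom E C P"
    and x: "x \<in> hom E B Z" and y: "y \<in> hom E C Z" and xy: "x \<cdot> f = y \<cdot> g"
  obtains u where "u \<in> hom E P Z" "u \<cdot> i = x" "u \<cdot> j = y"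
proof -
  have "comm_square E f g x y"
    using assms by (auto simp: is_pushout_def comm_square_def hom_def)
  then have "\<exists>!u. u \<in> hom E (Cod E i) (Cod E x) \<and> u \<cdot> i = x \<and> u \<cdot> j = y"
    using po by (auto simp: is_pushout_def)
  then show thesis using that homD[OF i] homD[OF x] by auto
qed

lemma pushout_eqI:
  assumes po: "is_pushout E f g i j" and i: "i \<in> hom E B P" and j: "j \<in> hom E C P"
    and u: "u \<in> hom E P Z" and v: "v \<in> hom E P Z"
    and e: "u \<cdot> i = v \<cdot> i" "u \<cdot> j = v \<cdot> j"
  shows "u = v"
proof -
  obtain A where fg: "f \<in> hom E A B" "g \<in> hom E A C" "i \<cdot> f = j \<cdot> g"
    using po i j by (auto simp: is_pushout_def comm_square_def hom_def)
  have vi: "v \<cdot> i \<in> hom E B Z" "v \<cdot> j \<in> hom E C Z" using i j v by auto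
  have "v \<cdot> i \<cdot> f = v \<cdot> j \<cdot> g"
    using assoc[OF fg(1) i v] assoc[OF fg(2) j v] fg(3) by simp
  then have "comm_square E f g (v \<cdot> i) (v \<cdot> j)"
    using comm_squareI[OF fg(1,2) vi] by simp
  then have "\<exists>!u. u \<in> hom E (Cod E i) (Cod E (v \<cdot> i)) \<and> u \<cdot> i = v \<cdot> i \<and> u \<cdot> j = v \<cdot> j"
    using po unfolding is_pushout_def by blast
  then show ?thesis using u v e homD[OF i] homD[OF vi(1)] by auto
qed

lemma pushoutI:
  assumes "f \<in> hom E A B" "g \<in> hom E A C" "i \<in> hom E B P" "j \<in> hom E C P" "i \<cdot> f = j \<cdot> g"
    and ex: "\<And>Z x y. x \<in> hom E B Z \<Longrightarrow> y \<in> hom E C Z \<Longrightarrow> x \<cdot> f = y \<cdot> g \<Longrightarrow>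
      \<exists>u\<in>hom E P Z. u \<cdot> i = x \<and> u \<cdot> j = y"
    and uniq: "\<And>Z u v. u \<in> hom E P Z \<Longrightarrow> v \<in> hom E P Z \<Longrightarrow> u \<cdot> i = v \<cdot> i \<Longrightarrow> u \<cdot> j = v \<cdot> j \<Longrightarrow> u = v"
  shows "is_pushout E f g i j"
  unfolding is_pushout_def
proof (intro conjI allI impI)
  show "comm_square E f g i j" using assms by (auto intro: comm_squareI)
  fix x y assume sq: "comm_square E f g x y"
  then have xy: "x \<in> hom E B (Cod E x)" "y \<in> hom E C (Cod E x)" "x \<cdot> f = y \<cdot> g"
    using assms(1,2) by (auto simp: comm_square_def hom_def)
  have "Cod E i = P" using assms(3) by (rule homD)
  with ex[OF xy] uniq
  show "\<exists>!u. u \<in> hom E (Cod E i) (Cod E x) \<and> u \<cdot> i = x \<and> u \<cdot> j = y"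
    by (metis (no_types, lifting))
qed

lemma pushout_sym: "is_pushout E f g i j \<Longrightarrow> is_pushout E g f j i"
proof -
  assume po: "is_pushout E f g i j"
  then obtain A B C P where h: "f \<in> hom E A B" "g \<in> hom E A C" "i \<in> hom E B P" "j \<in> hom E C P"
    "i \<cdot> f = j \<cdot> g" by (rule pushout_homs)
  show ?thesis
  proof (rule pushoutI[OF h(2,1,4,3) h(5)[symmetric]])
    fix Z x y assume "x \<in> hom E C Z" "y \<in> hom E B Z" "x \<cdot> g = y \<cdot> f"
    then show "\<exists>u\<in>hom E P Z. u \<cdot> j = x \<and> u \<cdot> i = y"
      by (metis pushout_induce[OF po h(3,4)])
  next
    fix Z u v assume "u \<in> hom E P Z" "v \<in> hom E P Z" "u \<cdot> j = v \<cdot> j" "u \<cdot> i = v \<cdot> i"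
    then show "u = v" by (metis pushout_eqI[OF po h(3,4)])
  qed
qed

lemma pushout_paste:
  assumes po: "is_pushout E f g i j" and po': "is_pushout E j h m j'"
  shows "is_pushout E f (h \<cdot> g) (m \<cdot> i) j'"
proof -
  obtain A B C P where h: "f \<in> hom E A B" "g \<in> hom E A C" "i \<in> hom E B P" "j \<in> hom E C P"
    "i \<cdot> f = j \<cdot> g" using po by (rule pushout_homs)
  obtain D Q where h': "h \<in> hom E C D" "m \<in> hom E P Q" "j' \<in> hom E D Q" "m \<cdot> j = j' \<cdot> h"
    using po' h(4) by (auto simp: is_pushout_def comm_square_def hom_def)
  show ?thesis
  proof (rule pushoutI[of _ A B _ D _ Q])
    show "f \<in> hom E A B" "h \<cdot> g \<in> hom E A D" "m \<cdot> i \<in> hom E B Q" "j' \<in> hom E D Q"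
      using h h' by auto
    show "m \<cdot> i \<cdot> f = j' \<cdot> (h \<cdot> g)"
      using h h' by (simp add: hom_def comp_assoc comp_reassoc[OF h'(4)])
  next
    fix Z x y assume x: "x \<in> hom E B Z" "y \<in> hom E D Z" "x \<cdot> f = y \<cdot> (h \<cdot> g)"
    have yh: "y \<cdot> h \<in> hom E C Z" using x h' by auto
    have "x \<cdot> f = y \<cdot> h \<cdot> g" using x h h' by (simp add: hom_def comp_assoc)
    then obtain u where u: "u \<in> hom E P Z" "u \<cdot> i = x" "u \<cdot> j = y \<cdot> h"
      by (rule pushout_induce[OF po h(3,4) x(1) yh])
    obtain v where v: "v \<in> hom E Q Z" "v \<cdot> m = u" "v \<cdot> j' = y"
      by (rule pushout_induce[OF po' h'(2,3) u(1) x(2) u(3)])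
    have "v \<cdot> (m \<cdot> i) = x" using u v h h' by (simp add: hom_def comp_assoc comp_reassoc[OF v(2)])
    with v show "\<exists>u\<in>hom E Q Z. u \<cdot> (m \<cdot> i) = x \<and> u \<cdot> j' = y" by auto
  next
    fix Z u v assume u: "u \<in> hom E Q Z" "v \<in> hom E Q Z" "u \<cdot> (m \<cdot> i) = v \<cdot> (m \<cdot> i)" "u \<cdot> j' = v \<cdot> j'"
    have um: "u \<cdot> m \<in> hom E P Z" "v \<cdot> m \<in> hom E P Z" using u h' by auto
    have "u \<cdot> m \<cdot> i = v \<cdot> m \<cdot> i" using u h h' by (simp add: hom_def comp_assoc)
    moreover have "u \<cdot> m \<cdot> j = v \<cdot> m \<cdot> j" using u h h' by (simp add: hom_def comp_assoc comp_reassoc[OF u(4)])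
    ultimately have "u \<cdot> m = v \<cdot> m" by (rule pushout_eqI[OF po h(3,4) um])
    then show "u = v" by (rule pushout_eqI[OF po' h'(2,3) u(1,2) _ u(4)])
  qed
qed

text \<open>The map between the pushouts of \<open>g\<close> and \<open>h \<cdot> g\<close> along \<open>f\<close> is itself a cobase change, namely of
  \<open>h\<close>. This is how left properness comes to apply to maps between pushouts.\<close>

lemma pushout_cancel:
  assumes po: "is_pushout E f g i j" and po': "is_pushout E f (h \<cdot> g) i' j'"
    and i: "i \<in> hom E B P" and j: "j \<in> hom E C P" and h: "h \<in> hom E C D" and i': "i' \<in> hom E B Q"
  obtains m where "m \<in> hom E P Q" "m \<cdot> i = i'" "m \<cdot> j = j' \<cdot> h" "is_pushout E j h m j'"
proof -
  obtain A where fg: "f \<in> hom E A B" "g \<in> hom E A C" "i \<cdot> f = j \<cdot> g"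
    using po i j by (auto simp: is_pushout_def comm_square_def hom_def)
  have hg: "h \<cdot> g \<in> hom E A D" using fg h by auto
  have j': "j' \<in> hom E D Q" "i' \<cdot> f = j' \<cdot> (h \<cdot> g)"
    using po' hg i' by (auto simp: is_pushout_def comm_square_def hom_def)
  have j'h: "j' \<cdot> h \<in> hom E C Q" using h j' by auto
  have "i' \<cdot> f = j' \<cdot> h \<cdot> g" using fg j' h by (simp add: hom_def comp_assoc)
  then obtain m where m: "m \<in> hom E P Q" "m \<cdot> i = i'" "m \<cdot> j = j' \<cdot> h"
    by (rule pushout_induce[OF po i j i' j'h])
  have "is_pushout E j h m j'"
  proof (rule pushoutI[OF j h m(1) j'(1) m(3)])
    fix Z x y assume x: "x \<in> hom E P Z" "y \<in> hom E D Z" "x \<cdot> j = y \<cdot> h"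
    have xi: "x \<cdot> i \<in> hom E B Z" using x i by auto
    have "x \<cdot> i \<cdot> f = y \<cdot> (h \<cdot> g)" using x fg i j h by (simp add: hom_def comp_assoc comp_reassoc[OF x(3)])
    then obtain u where u: "u \<in> hom E Q Z" "u \<cdot> i' = x \<cdot> i" "u \<cdot> j' = y"
      by (rule pushout_induce[OF po' i' j'(1) xi x(2)])
    have "u \<cdot> m \<in> hom E P Z" using u m by auto
    moreover have "u \<cdot> m \<cdot> i = x \<cdot> i" using u m i by (simp add: hom_def comp_assoc)
    moreover have "u \<cdot> m \<cdot> j = x \<cdot> j" using u m j h j' x by (simp add: hom_def comp_assoc comp_reassoc[OF u(3)])
    ultimately have "u \<cdot> m = x" by (rule pushout_eqI[OF po i j _ x(1)])
    with u show "\<exists>u\<in>hom E Q Z. u \<cdot> m = x \<and> u \<cdot> j' = y" by auto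
  next
    fix Z u v assume u: "u \<in> hom E Q Z" "v \<in> hom E Q Z" "u \<cdot> m = v \<cdot> m" "u \<cdot> j' = v \<cdot> j'"
    have "u \<cdot> i' = v \<cdot> i'" using u m i assoc[OF i m(1) u(1)] assoc[OF i m(1) u(2)] by simp
    then show "u = v" by (rule pushout_eqI[OF po' i' j'(1) u(1,2) _ u(4)])
  qed
  with m show thesis by (rule that)
qed

lemma pushouts_exist:
  assumes fb: "finitely_bicomplete E" and f: "f \<in> hom E A B" and g: "g \<in> hom E A C"
  obtains i j P where "is_pushout E f g i j" "i \<in> hom E B P" "j \<in> hom E C P"
proof -
  \<comment> \<open>The span \<open>1 \<leftarrow> 0 \<rightarrow> 2\<close>: the arrows \<open>0, 1, 2\<close> are the identities, and the others are \<open>3 : 0 \<rightarrow> 1\<close>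
    and \<open>4 : 0 \<rightarrow> 2\<close>.\<close>
  define J :: "(nat, nat) cat" where "J = \<lparr>Ob = {0,1,2}, Ar = {0,1,2,3,4},
    Dom = (\<lambda>a. if a \<le> 2 then a else 0), Cod = (\<lambda>a. if a \<le> 2 then a else a - 2),
    Id = (\<lambda>x. x), Comp = (\<lambda>b a. if b \<le> 2 then a else b)\<rparr>"
  define Fo where "Fo = (\<lambda>x::nat. if x = 0 then A else if x = 1 then B else C)"
  define Fm where "Fm = (\<lambda>a::nat. if a = 3 then f else if a = 4 then g else Id E (Fo a))"
  have Ob: "A \<in> Ob E" "B \<in> Ob E" "C \<in> Ob E" using homD[OF f] homD[OF g] by auto
  have "category J" by (auto simp: category_def hom_def J_def)
  moreover have "finite (Ob J)" "finite (Ar J)" by (auto simp: J_def)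
  moreover have "is_functor J E Fo Fm"
    using Ob f g comp_id[OF id_hom] by (auto simp: is_functor_def J_def Fo_def Fm_def)
  ultimately obtain P p where col: "is_colimit J E Fo Fm P p"
    using fb unfolding finitely_bicomplete_def by blast
  then have co: "is_cocone J E Fo Fm P p" by (simp add: is_colimit_def)
  have p: "p 0 \<in> hom E A P" "p 1 \<in> hom E B P" "p 2 \<in> hom E C P"
    "p 1 \<cdot> f = p 0" "p 2 \<cdot> g = p 0"
    using co by (auto simp: is_cocone_def J_def Fo_def Fm_def)
  have ex: "\<exists>!u. u \<in> hom E P Z \<and> u \<cdot> p 0 = x \<cdot> f \<and> u \<cdot> p 1 = x \<and> u \<cdot> p 2 = y"
    if x: "x \<in> hom E B Z" "y \<in> hom E C Z" "x \<cdot> f = y \<cdot> g" for x y Z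
  proof -
    define q where "q = (\<lambda>n::nat. if n = 0 then x \<cdot> f else if n = 1 then x else y)"
    have "is_cocone J E Fo Fm Z q"
      using x f g homD[OF x(1)] comp_hom[OF f x(1)]
      by (auto simp: is_cocone_def J_def Fo_def Fm_def q_def)
    then have "\<exists>!u. u \<in> hom E P Z \<and> (\<forall>j\<in>Ob J. u \<cdot> p j = q j)"
      using col by (auto simp: is_colimit_def)
    then show ?thesis by (simp add: J_def q_def)
  qed
  have "is_pushout E f g (p 1) (p 2)"
  proof (rule pushoutI[OF f g p(2,3)])
    show "p 1 \<cdot> f = p 2 \<cdot> g" using p by simp
  next
    fix Z x y assume "x \<in> hom E B Z" "y \<in> hom E C Z" "x \<cdot> f = y \<cdot> g"
    then show "\<exists>u\<in>hom E P Z. u \<cdot> p 1 = x \<and> u \<cdot> p 2 = y" using ex by blast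
  next
    fix Z u v assume u: "u \<in> hom E P Z" "v \<in> hom E P Z" "u \<cdot> p 1 = v \<cdot> p 1" "u \<cdot> p 2 = v \<cdot> p 2"
    have c: "w \<cdot> p 1 \<in> hom E B Z" "w \<cdot> p 2 \<in> hom E C Z"
      "w \<cdot> p 0 = w \<cdot> p 1 \<cdot> f" "w \<cdot> p 0 = w \<cdot> p 2 \<cdot> g" if "w \<in> hom E P Z" for w
      using p f g that assoc[OF f p(2) that] assoc[OF g p(3) that] by auto
    show "u = v"
      using ex[OF c(1,2)[OF u(2)]] c[OF u(1)] c[OF u(2)] u by metis
  qed
  then show thesis using p by (intro that)
qed

end

section \<open>Cofibrations and lifting\<close>

locale pointed_model =
  fixes E :: "('o, 'm, 'z) model_cat_scheme" (structure) and pt :: 'o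
  assumes model: "model_category E" and zero: "zero_object E pt"
begin

sublocale cat_locale E
  using model by unfold_locales (simp add: model_category_def)

lemma pushout_exists:
  assumes "f \<in> hom E A B" and "g \<in> hom E A C"
  obtains i j P where "is_pushout E f g i j" "i \<in> hom E B P" "j \<in> hom E C P"
  using pushouts_exist[OF _ assms] model by (auto simp: model_category_def)

lemma pt_Ob [simp, intro]: "pt \<in> Ob E"
  using zero by (simp add: zero_object_def)

lemma to_pt: "x \<in> Ob E \<Longrightarrow> \<exists>t. t \<in> hom E x pt"
  and from_pt: "x \<in> Ob E \<Longrightarrow> \<exists>t. t \<in> hom E pt x"
  using zero by (auto simp: zero_object_def)

lemma to_pt_eq: "f \<in> hom E x pt \<Longrightarrow> g \<in> hom E x pt \<Longrightarrow> f = g"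
  and from_pt_eq: "f \<in> hom E pt x \<Longrightarrow> g \<in> hom E pt x \<Longrightarrow> f = g"
  using zero homD(4)[of f x pt] homD(5)[of f pt x] by (auto simp: zero_object_def)

lemma weq_arr: "f \<in> Weq E \<Longrightarrow> f \<in> Ar E"
  and cofib_arr: "f \<in> Cofib E \<Longrightarrow> f \<in> Ar E"
  and fibr_arr: "f \<in> Fibr E \<Longrightarrow> f \<in> Ar E"
  using model by (auto simp: model_category_def wide_subcategory_def)

lemma id_weq [simp, intro]: "x \<in> Ob E \<Longrightarrow> Id E x \<in> Weq E"
  and id_fibr [simp, intro]: "x \<in> Ob E \<Longrightarrow> Id E x \<in> Fibr E"
  using model by (auto simp: model_category_def wide_subcategory_def)

lemma weq_comp: "f \<in> hom E x y \<Longrightarrow> g \<in> hom E y z \<Longrightarrow> f \<in> Weq E \<Longrightarrow> g \<in> Weq E \<Longrightarrow> g \<cdot> f \<in> Weq E"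
  and cofib_comp: "f \<in> hom E x y \<Longrightarrow> g \<in> hom E y z \<Longrightarrow> f \<in> Cofib E \<Longrightarrow> g \<in> Cofib E \<Longrightarrow> g \<cdot> f \<in> Cofib E"
  and fibr_comp: "f \<in> hom E x y \<Longrightarrow> g \<in> hom E y z \<Longrightarrow> f \<in> Fibr E \<Longrightarrow> g \<in> Fibr E \<Longrightarrow> g \<cdot> f \<in> Fibr E"
  using model by (auto simp: model_category_def wide_subcategory_def hom_def)

lemma weq_cancel_right:
  "f \<in> hom E x y \<Longrightarrow> g \<in> hom E y z \<Longrightarrow> f \<in> Weq E \<Longrightarrow> g \<cdot> f \<in> Weq E \<Longrightarrow> g \<in> Weq E"
  and weq_cancel_left:
  "f \<in> hom E x y \<Longrightarrow> g \<in> hom E y z \<Longrightarrow> g \<in> Weq E \<Longrightarrow> g \<cdot> f \<in> Weq E \<Longrightarrow> f \<in> Weq E"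
  using model by (auto simp: model_category_def hom_def)

lemma weq_comp_iff_left: "f \<in> hom E x y \<Longrightarrow> g \<in> hom E y z \<Longrightarrow> f \<in> Weq E \<Longrightarrow> g \<cdot> f \<in> Weq E \<longleftrightarrow> g \<in> Weq E"
  and weq_comp_iff_right: "f \<in> hom E x y \<Longrightarrow> g \<in> hom E y z \<Longrightarrow> g \<in> Weq E \<Longrightarrow> g \<cdot> f \<in> Weq E \<longleftrightarrow> f \<in> Weq E"
  by (blast intro: weq_comp dest: weq_cancel_right weq_cancel_left)+

lemma lift:
  assumes "i \<in> Cofib E" "p \<in> Fibr E" "i \<in> Weq E \<or> p \<in> Weq E"
    and "i \<in> hom E A B" "p \<in> hom E X Y" "u \<in> hom E A X" "v \<in> hom E B Y" "p \<cdot> u = v \<cdot> i"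
  obtains h where "h \<in> hom E B X" "h \<cdot> i = u" "p \<cdot> h = v"
proof -
  have "has_lifting E i p" using model assms(1-3) by (auto simp: model_category_def)
  moreover have "comm_square E i u v p"
    using assms(4-8) by (auto simp: comm_square_def hom_def)
  ultimately show thesis using that homD[OF assms(4)] homD[OF assms(5)]
    by (auto simp: has_lifting_def)
qed

lemma factor_acyclic_fibration:
  assumes "f \<in> hom E X Y"
  obtains W i p where "i \<in> hom E X W" "p \<in> hom E W Y" "i \<in> Cofib E" "p \<in> Fibr E" "p \<in> Weq E" "p \<cdot> i = f"
proof -
  obtain i p where ip: "i \<in> Cofib E" "p \<in> Fibr E" "p \<in> Weq E" "Cod E i = Dom E p" "p \<cdot> i = f"
    using model homD(1)[OF assms] by (auto simp: model_category_def)
  moreover from ip have "i \<in> hom E X (Cod E i)" "p \<in> hom E (Cod E i) Y"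
    using homD[OF assms] cofib_arr[OF ip(1)] fibr_arr[OF ip(2)] comp_arr[of i p]
    by (auto simp: hom_def)
  ultimately show thesis using that by blast
qed

lemma factor_acyclic_cofibration:
  assumes "f \<in> hom E X Y"
  obtains W i p where "i \<in> hom E X W" "p \<in> hom E W Y" "i \<in> Cofib E" "i \<in> Weq E" "p \<in> Fibr E" "p \<cdot> i = f"
proof -
  obtain i p where ip: "i \<in> Cofib E" "i \<in> Weq E" "p \<in> Fibr E" "Cod E i = Dom E p" "p \<cdot> i = f"
    using model homD(1)[OF assms] by (auto simp: model_category_def)
  moreover from ip have "i \<in> hom E X (Cod E i)" "p \<in> hom E (Cod E i) Y"
    using homD[OF assms] cofib_arr[OF ip(1)] fibr_arr[OF ip(3)] comp_arr[of i p]
    by (auto simp: hom_def)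
  ultimately show thesis using that by blast
qed

lemma retract_closed:
  assumes "is_retract E f g"
  shows "g \<in> Weq E \<Longrightarrow> f \<in> Weq E" and "g \<in> Cofib E \<Longrightarrow> f \<in> Cofib E"
  using model assms by (auto simp: model_category_def)

text \<open>The retract argument, by which a lifting property puts a map into a class of the model
  structure.\<close>

lemma retract_of_first_factor:
  assumes "i \<in> hom E A B" "j \<in> hom E A W" "p \<in> hom E W B" "p \<cdot> j = i"
    and "h \<in> hom E B W" "h \<cdot> i = j" "p \<cdot> h = Id E B"
  shows "is_retract E i j"
proof -
  have "j \<cdot> Id E A = h \<cdot> i" "i \<cdot> Id E A = p \<cdot> j" "Id E A \<cdot> Id E A = Id E A"
    using assms homD[OF assms(1)] comp_id[OF id_hom] by auto
  moreover have "Id E A \<in> hom E A A" using homD[OF assms(1)] by simp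
  moreover have "\<exists>s\<in>hom E A A. \<exists>r\<in>hom E A A. \<exists>s'\<in>hom E B W. \<exists>r'\<in>hom E W B.
      r \<cdot> s = Id E A \<and> r' \<cdot> s' = Id E B \<and> j \<cdot> s = s' \<cdot> i \<and> i \<cdot> r = r' \<cdot> j"
    using calculation assms(3,5,7) by blast
  ultimately show ?thesis
    using homD[OF assms(1)] homD[OF assms(2)] unfolding is_retract_def by simp
qed

lemma cofib_by_lifting:
  assumes i: "i \<in> hom E A B"
    and l: "\<And>X Y p u v. p \<in> Fibr E \<Longrightarrow> p \<in> Weq E \<Longrightarrow> p \<in> hom E X Y \<Longrightarrow> u \<in> hom E A X \<Longrightarrow>
      v \<in> hom E B Y \<Longrightarrow> p \<cdot> u = v \<cdot> i \<Longrightarrow> \<exists>h\<in>hom E B X. h \<cdot> i = u \<and> p \<cdot> h = v"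
  shows "i \<in> Cofib E"
proof -
  obtain W j p where f: "j \<in> hom E A W" "p \<in> hom E W B" "j \<in> Cofib E" "p \<in> Fibr E" "p \<in> Weq E" "p \<cdot> j = i"
    by (rule factor_acyclic_fibration[OF i])
  have "\<exists>h\<in>hom E B W. h \<cdot> i = j \<and> p \<cdot> h = Id E B"
    using l[OF f(4,5,2,1) id_hom] homD[OF i] f i by simp
  then show ?thesis using retract_of_first_factor[OF i f(1,2,6)] retract_closed(2) f(3) by blast
qed

lemma acyclic_cofib_by_lifting:
  assumes i: "i \<in> hom E A B"
    and l: "\<And>X Y p u v. p \<in> Fibr E \<Longrightarrow> p \<in> hom E X Y \<Longrightarrow> u \<in> hom E A X \<Longrightarrow>
      v \<in> hom E B Y \<Longrightarrow> p \<cdot> u = v \<cdot> i \<Longrightarrow> \<exists>h\<in>hom E B X. h \<cdot> i = u \<and> p \<cdot> h = v"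
  shows "i \<in> Cofib E" and "i \<in> Weq E"
proof -
  obtain W j p where f: "j \<in> hom E A W" "p \<in> hom E W B" "j \<in> Cofib E" "j \<in> Weq E" "p \<in> Fibr E" "p \<cdot> j = i"
    by (rule factor_acyclic_cofibration[OF i])
  have "\<exists>h\<in>hom E B W. h \<cdot> i = j \<and> p \<cdot> h = Id E B"
    using l[OF f(5,2,1) id_hom] homD[OF i] f i by simp
  then show "i \<in> Cofib E" "i \<in> Weq E"
    using retract_of_first_factor[OF i f(1,2,6)] retract_closed f(3,4) by blast+
qed

text \<open>Solving a lifting problem for the cobase change \<open>j\<close> amounts to solving the induced one
  for \<open>f\<close>.\<close>

lemma pushout_lift:
  assumes po: "is_pushout E f g i j" and f: "f \<in> Cofib E" and p: "p \<in> Fibr E" "f \<in> Weq E \<or> p \<in> Weq E"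
    and h: "j \<in> hom E C P" "p \<in> hom E X Y" "u \<in> hom E C X" "v \<in> hom E P Y" "p \<cdot> u = v \<cdot> j"
  shows "\<exists>h\<in>hom E P X. h \<cdot> j = u \<and> p \<cdot> h = v"
proof -
  obtain A B where g: "f \<in> hom E A B" "g \<in> hom E A C" "i \<in> hom E B P" "i \<cdot> f = j \<cdot> g"
    using po h(1) by (auto simp: is_pushout_def comm_square_def hom_def)
  have "u \<cdot> g \<in> hom E A X" "v \<cdot> i \<in> hom E B Y" using g h by auto
  moreover have "p \<cdot> (u \<cdot> g) = v \<cdot> i \<cdot> f"
    using g h by (simp add: hom_def comp_assoc comp_reassoc[OF h(5)])
  ultimately obtain k where k: "k \<in> hom E B X" "k \<cdot> f = u \<cdot> g" "p \<cdot> k = v \<cdot> i"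
    by (rule lift[OF f p g(1) h(2)])
  obtain l where l: "l \<in> hom E P X" "l \<cdot> i = k" "l \<cdot> j = u"
    by (rule pushout_induce[OF po g(3) h(1) k(1) h(3) k(2)])
  have "p \<cdot> l = v"
  proof (rule pushout_eqI[OF po g(3) h(1) _ h(4)])
    show "p \<cdot> l \<in> hom E P Y" using l h by auto
    show "p \<cdot> l \<cdot> i = v \<cdot> i" "p \<cdot> l \<cdot> j = v \<cdot> j"
      using l g h k by (simp_all add: hom_def comp_assoc)
  qed
  with l show ?thesis by auto
qed

lemma pushout_cofib:
  assumes po: "is_pushout E f g i j" and f: "f \<in> Cofib E"
  shows "j \<in> Cofib E"
proof -
  obtain C P where j: "j \<in> hom E C P" using po by (auto elim: pushout_homs)
  show ?thesis by (rule cofib_by_lifting[OF j]) (rule pushout_lift[OF po f _ _ j], auto)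
qed

lemma pushout_acyclic_cofib:
  assumes po: "is_pushout E f g i j" and f: "f \<in> Cofib E" "f \<in> Weq E"
  shows "j \<in> Cofib E" and "j \<in> Weq E"
proof -
  obtain C P where j: "j \<in> hom E C P" using po by (auto elim: pushout_homs)
  show "j \<in> Cofib E" "j \<in> Weq E"
    by (rule acyclic_cofib_by_lifting[OF j]; rule pushout_lift[OF po f(1) _ _ j], use f in auto)+
qed

end

section \<open>Gluing weak equivalences\<close>

locale left_proper_model = pointed_model +
  assumes left_proper: "left_proper E"
begin

lemma pushout_weq: "is_pushout E f w w' f' \<Longrightarrow> f \<in> Cofib E \<Longrightarrow> w \<in> Weq E \<Longrightarrow> w' \<in> Weq E"
  using left_proper by (auto simp: left_proper_def)

text \<open>By cancellation of pushouts, \<open>u\<close> is the cobase change of \<open>\<beta>\<close> along the cofibration \<open>p\<close>.\<close>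

lemma glue_along_base:
  assumes po: "is_pushout E f i p q" and po': "is_pushout E (\<beta> \<cdot> f) i p' q'"
    and i: "i \<in> Cofib E" and \<beta>: "\<beta> \<in> Weq E" "\<beta> \<in> hom E B B'"
    and p: "p \<in> hom E B P" "p' \<in> hom E B' P'" and u: "u \<in> hom E P P'" "u \<cdot> p = p' \<cdot> \<beta>" "u \<cdot> q = q'"
  shows "u \<in> Weq E"
proof -
  obtain C where q: "q \<in> hom E C P"
    using po p by (auto simp: is_pushout_def comm_square_def hom_def)
  have q': "q' \<in> hom E C P'" using u q by auto
  obtain m where m: "m \<in> hom E P P'" "m \<cdot> q = q'" "m \<cdot> p = p' \<cdot> \<beta>" "is_pushout E p \<beta> m p'"
    by (rule pushout_cancel[OF pushout_sym[OF po] pushout_sym[OF po'] q p(1) \<beta>(2) q'])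
  have "m \<in> Weq E"
    using pushout_weq[OF m(4) pushout_cofib[OF pushout_sym[OF po] i] \<beta>(1)] .
  moreover have "u = m"
    using pushout_eqI[OF po p(1) q u(1) m(1)] u m by simp
  ultimately show ?thesis by simp
qed

text \<open>If \<open>f\<close> were a cofibration, \<open>u\<close> would be the cobase change of \<open>\<gamma>\<close> along \<open>C \<rightarrow> C \<union>\<^sub>A B\<close>.
  Replacing \<open>f\<close> by a cofibration changes the pushouts only up to weak equivalence.\<close>

lemma glue_under:
  assumes po: "is_pushout E f i p q" and po': "is_pushout E f (\<gamma> \<cdot> i) p' q'"
    and i: "i \<in> Cofib E" "\<gamma> \<cdot> i \<in> Cofib E" and \<gamma>: "\<gamma> \<in> Weq E" "\<gamma> \<in> hom E C C'"
    and q: "q \<in> hom E C P" "q' \<in> hom E C' P'"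
    and u: "u \<in> hom E P P'" "u \<cdot> p = p'" "u \<cdot> q = q' \<cdot> \<gamma>"
  shows "u \<in> Weq E"
proof -
  obtain A B where h: "f \<in> hom E A B" "i \<in> hom E A C" "p \<in> hom E B P"
    using po q by (auto simp: is_pushout_def comm_square_def hom_def)
  obtain B1 f1 v where f1: "f1 \<in> hom E A B1" "v \<in> hom E B1 B" "f1 \<in> Cofib E" "v \<in> Weq E" "v \<cdot> f1 = f"
    by (rule factor_acyclic_fibration[OF h(1)])
  have \<gamma>i: "\<gamma> \<cdot> i \<in> hom E A C'" using h \<gamma> by auto
  have p': "p' \<in> hom E B P'" using u h by auto
  obtain p1 q1 P1 where P1: "is_pushout E f1 i p1 q1" "p1 \<in> hom E B1 P1" "q1 \<in> hom E C P1"
    by (rule pushout_exists[OF f1(1) h(2)])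
  obtain p2 q2 P2 where P2: "is_pushout E f1 (\<gamma> \<cdot> i) p2 q2" "p2 \<in> hom E B1 P2" "q2 \<in> hom E C' P2"
    by (rule pushout_exists[OF f1(1) \<gamma>i])
  obtain m where m: "m \<in> hom E P1 P2" "m \<cdot> p1 = p2" "m \<cdot> q1 = q2 \<cdot> \<gamma>" "is_pushout E q1 \<gamma> m q2"
    by (rule pushout_cancel[OF P1(1) P2(1) P1(2,3) \<gamma>(2) P2(2)])
  have mw: "m \<in> Weq E"
    using pushout_weq[OF m(4) pushout_cofib[OF P1(1) f1(3)] \<gamma>(1)] .
  have pv: "p \<cdot> v \<in> hom E B1 P" "p' \<cdot> v \<in> hom E B1 P'" using h p' f1 by auto
  have "p \<cdot> v \<cdot> f1 = q \<cdot> i" "p' \<cdot> v \<cdot> f1 = q' \<cdot> (\<gamma> \<cdot> i)"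
    using pushout_comm[OF po] pushout_comm[OF po'] h p' f1 by (simp_all add: hom_def comp_assoc)
  then obtain a b where a: "a \<in> hom E P1 P" "a \<cdot> p1 = p \<cdot> v" "a \<cdot> q1 = q"
    and b: "b \<in> hom E P2 P'" "b \<cdot> p2 = p' \<cdot> v" "b \<cdot> q2 = q'"
    using pushout_induce[OF P1 pv(1) q(1)] pushout_induce[OF P2 pv(2) q(2)] by metis
  have aw: "a \<in> Weq E" "b \<in> Weq E"
    using glue_along_base[OF P1(1) _ i(1) f1(4,2) P1(2) h(3) a]
      glue_along_base[OF P2(1) _ i(2) f1(4,2) P2(2) p' b] po po' f1(5) by auto
  have "u \<cdot> a = b \<cdot> m"
  proof (rule pushout_eqI[OF P1])
    show "u \<cdot> a \<in> hom E P1 P'" "b \<cdot> m \<in> hom E P1 P'" using a b u m by auto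
    show "u \<cdot> a \<cdot> p1 = b \<cdot> m \<cdot> p1"
      using a(1,2) b(1,2) u(1,2) m(1,2) f1(2) h(3) P1(2) P2(2)
      by (simp add: hom_def comp_assoc comp_reassoc[OF u(2)])
    show "u \<cdot> a \<cdot> q1 = b \<cdot> m \<cdot> q1"
      using a(1,3) b(1,3) u(1,3) m(1,3) P1(3) P2(3) \<gamma>(2)
      by (simp add: hom_def comp_assoc comp_reassoc[OF b(3)])
  qed
  then show ?thesis
    using weq_cancel_right[OF a(1) u(1) aw(1)] weq_comp[OF m(1) b(1) mw aw(2)] by simp
qed

text \<open>The map of spans factors through the span \<open>B' \<leftarrow> A' \<rightarrow> A' \<union>\<^sub>A C\<close>. Its pushout is also the pushout of
  \<open>\<beta> \<cdot> f\<close> and \<open>i\<close>, so the first half is a case of \<open>glue_along_base\<close>; the second half fixes \<open>A'\<close> and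
  \<open>B'\<close> and is a case of \<open>glue_under\<close>.\<close>

lemma gluing:
  assumes po: "is_pushout E f i p q" and po': "is_pushout E f' i' p' q'"
    and i: "i \<in> Cofib E" "i' \<in> Cofib E"
    and \<alpha>: "\<alpha> \<in> Weq E" "\<alpha> \<in> hom E A A'" and \<beta>: "\<beta> \<in> Weq E" "\<beta> \<in> hom E B B'"
    and \<gamma>: "\<gamma> \<in> Weq E" "\<gamma> \<in> hom E C C'" and eq: "\<beta> \<cdot> f = f' \<cdot> \<alpha>" "\<gamma> \<cdot> i = i' \<cdot> \<alpha>"
    and h: "f \<in> hom E A B" "i \<in> hom E A C" "p \<in> hom E B P" "q \<in> hom E C P"
      "f' \<in> hom E A' B'" "i' \<in> hom E A' C'" "p' \<in> hom E B' P'" "q' \<in> hom E C' P'"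
    and u: "u \<in> hom E P P'" "u \<cdot> p = p' \<cdot> \<beta>" "u \<cdot> q = q' \<cdot> \<gamma>"
  shows "u \<in> Weq E"
proof -
  obtain a j C1 where C1: "is_pushout E i \<alpha> a j" "a \<in> hom E C C1" "j \<in> hom E A' C1"
    by (rule pushout_exists[OF h(2) \<alpha>(2)])
  have aw: "a \<in> Weq E" and jc: "j \<in> Cofib E"
    using pushout_weq[OF C1(1) i(1) \<alpha>(1)] pushout_cofib[OF C1(1) i(1)] .
  obtain \<gamma>1 where \<gamma>1: "\<gamma>1 \<in> hom E C1 C'" "\<gamma>1 \<cdot> a = \<gamma>" "\<gamma>1 \<cdot> j = i'"
    by (rule pushout_induce[OF C1 \<gamma>(2) h(6) eq(2)])
  have \<gamma>1w: "\<gamma>1 \<in> Weq E" using weq_cancel_right[OF C1(2) \<gamma>1(1) aw] \<gamma>1(2) \<gamma>(1) by simp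
  obtain p1 q1 P1 where P1: "is_pushout E f' j p1 q1" "p1 \<in> hom E B' P1" "q1 \<in> hom E C1 P1"
    by (rule pushout_exists[OF h(5) C1(3)])
  have q'\<gamma>1: "q' \<cdot> \<gamma>1 \<in> hom E C1 P'" using \<gamma>1 h by auto
  have "p' \<cdot> f' = q' \<cdot> \<gamma>1 \<cdot> j"
    using pushout_comm[OF po'] \<gamma>1 h(8) C1(3) by (simp add: hom_def comp_assoc)
  then obtain u1 where u1: "u1 \<in> hom E P1 P'" "u1 \<cdot> p1 = p'" "u1 \<cdot> q1 = q' \<cdot> \<gamma>1"
    by (rule pushout_induce[OF P1 h(7) q'\<gamma>1])
  have u1w: "u1 \<in> Weq E"
    using glue_under[OF P1(1) _ jc _ \<gamma>1w \<gamma>1(1) P1(3) h(8) u1] po' i(2) \<gamma>1(3) by simp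
  have "is_pushout E i (f' \<cdot> \<alpha>) (q1 \<cdot> a) p1"
    by (rule pushout_paste[OF C1(1) pushout_sym[OF P1(1)]])
  then have P1': "is_pushout E (\<beta> \<cdot> f) i p1 (q1 \<cdot> a)"
    using pushout_sym eq(1) by simp
  have "p1 \<cdot> \<beta> \<in> hom E B P1" "q1 \<cdot> a \<in> hom E C P1" "p1 \<cdot> \<beta> \<cdot> f = q1 \<cdot> a \<cdot> i"
    using pushout_comm[OF P1'] P1 C1 \<beta> h by (auto simp: hom_def comp_assoc)
  then obtain m where m: "m \<in> hom E P P1" "m \<cdot> p = p1 \<cdot> \<beta>" "m \<cdot> q = q1 \<cdot> a"
    by (rule pushout_induce[OF po h(3,4)])
  have mw: "m \<in> Weq E"
    by (rule glue_along_base[OF po P1' i(1) \<beta> h(3) P1(2) m])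
  have "u = u1 \<cdot> m"
  proof (rule pushout_eqI[OF po h(3,4) u(1)])
    show "u1 \<cdot> m \<in> hom E P P'" using u1 m by auto
    show "u \<cdot> p = u1 \<cdot> m \<cdot> p"
      using u(2) u1(1,2) m(1,2) h(3) P1(2) \<beta>(2)
      by (simp add: hom_def comp_assoc comp_reassoc[OF u1(2)])
    show "u \<cdot> q = u1 \<cdot> m \<cdot> q"
      using u(3) u1(1,3) m(1,3) h(4,8) P1(3) C1(2) \<gamma>1(1,2)
      by (simp add: hom_def comp_assoc comp_reassoc[OF u1(3)])
  qed
  then show ?thesis using weq_comp[OF m(1) u1(1) mw u1w] by simp
qed

end

section \<open>Mapping cones and quotients\<close>

locale cone_model = left_proper_model +
  fixes Co Cm c
  assumes cone: "functorial_cone E pt Co Cm c"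
begin

lemma Co_Ob [simp]: "x \<in> Ob E \<Longrightarrow> Co x \<in> Ob E"
  and c_hom: "x \<in> Ob E \<Longrightarrow> c x \<in> hom E x (Co x)"
  and c_cofib: "x \<in> Ob E \<Longrightarrow> c x \<in> Cofib E"
  and Cm_hom: "f \<in> hom E x y \<Longrightarrow> Cm f \<in> hom E (Co x) (Co y)"
  and Cm_id: "x \<in> Ob E \<Longrightarrow> Cm (Id E x) = Id E (Co x)"
  and Cm_natural: "f \<in> hom E x y \<Longrightarrow> Cm f \<cdot> c x = c y \<cdot> f"
  using cone by (auto simp: functorial_cone_def is_functor_def nat_trans_def hom_def)

lemma cone_contractible: "x \<in> Ob E \<Longrightarrow> e \<in> hom E (Co x) pt \<Longrightarrow> e \<in> Weq E"
  using cone to_pt_eq unfolding functorial_cone_def by metis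

text \<open>Cones are contractible, hence any map between them is a weak equivalence.\<close>

lemma Cm_weq:
  assumes "f \<in> hom E x y"
  shows "Cm f \<in> Weq E"
proof -
  have xy: "x \<in> Ob E" "y \<in> Ob E" using homD[OF assms] by auto
  obtain e where e: "e \<in> hom E (Co y) pt" using to_pt xy by (meson Co_Ob)
  have "e \<cdot> Cm f \<in> hom E (Co x) pt" using e Cm_hom[OF assms] by auto
  then show ?thesis
    using weq_cancel_left[OF Cm_hom[OF assms] e] cone_contractible xy e by blast
qed

lemma quotientE:
  assumes "is_quotient E pt i q" "i \<in> hom E X Y"
  obtains t z where "t \<in> hom E X pt" "is_pushout E i t q z" "q \<in> hom E Y (Cod E q)" "z \<in> hom E pt (Cod E q)"
proof -
  obtain t z where t: "t \<in> hom E X pt" "is_pushout E i t q z"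
    using assms by (auto simp: is_quotient_def hom_def)
  then show thesis using that pushout_legs[OF t(2) assms(2) t(1)] by blast
qed

lemma quotient_exists:
  assumes "i \<in> hom E X Y"
  obtains q where "is_quotient E pt i q"
proof -
  obtain t where t: "t \<in> hom E X pt" using to_pt homD[OF assms] by auto
  obtain q z P where "is_pushout E i t q z" by (rule pushout_exists[OF assms t])
  then show thesis using that t homD[OF assms] by (auto simp: is_quotient_def)
qed

lemma quotient_map_exists:
  assumes q: "is_quotient E pt i q" "is_quotient E pt i' q'"
    and h: "i \<in> hom E X Y" "i' \<in> hom E X' Y'" "\<alpha> \<in> hom E X X'" "h \<in> hom E Y Y'" "h \<cdot> i = i' \<cdot> \<alpha>"
  obtains k where "k \<in> hom E (Cod E q) (Cod E q')" "k \<cdot> q = q' \<cdot> h"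
proof -
  obtain t z where t: "t \<in> hom E X pt" "is_pushout E i t q z" "q \<in> hom E Y (Cod E q)" "z \<in> hom E pt (Cod E q)"
    by (rule quotientE[OF q(1) h(1)])
  obtain t' z' where t': "t' \<in> hom E X' pt" "is_pushout E i' t' q' z'" "q' \<in> hom E Y' (Cod E q')"
    "z' \<in> hom E pt (Cod E q')"
    by (rule quotientE[OF q(2) h(2)])
  have q'h: "q' \<cdot> h \<in> hom E Y (Cod E q')" using t' h by auto
  have "t' \<cdot> \<alpha> = t" using t t' h by (intro to_pt_eq[of _ X]) auto
  then have "q' \<cdot> h \<cdot> i = z' \<cdot> t"
    using pushout_comm[OF t'(2)] h t'(1,3,4) t(1)
    by (auto simp: hom_def comp_assoc comp_reassoc[OF pushout_comm[OF t'(2)]])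
  then obtain k where "k \<in> hom E (Cod E q) (Cod E q')" "k \<cdot> q = q' \<cdot> h"
    by (rule pushout_induce[OF t(2,3,4) q'h t'(4)])
  then show thesis by (rule that)
qed

lemma cone_map_exists:
  assumes po: "is_pushout E f (c X) b \<kappa>" "is_pushout E f' (c X') b' \<kappa>'"
    and h: "f \<in> hom E X Y" "f' \<in> hom E X' Y'" "\<alpha> \<in> hom E X X'" "h \<in> hom E Y Y'" "h \<cdot> f = f' \<cdot> \<alpha>"
    and b: "b \<in> hom E Y K" "\<kappa> \<in> hom E (Co X) K" "b' \<in> hom E Y' K'" "\<kappa>' \<in> hom E (Co X') K'"
  obtains H where "H \<in> hom E K K'" "H \<cdot> b = b' \<cdot> h" "H \<cdot> \<kappa> = \<kappa>' \<cdot> Cm \<alpha>"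
proof -
  have X: "X \<in> Ob E" "X' \<in> Ob E" using homD[OF h(3)] by auto
  have x: "b' \<cdot> h \<in> hom E Y K'" "\<kappa>' \<cdot> Cm \<alpha> \<in> hom E (Co X) K'"
    using h b Cm_hom[OF h(3)] by auto
  have "b' \<cdot> h \<cdot> f = \<kappa>' \<cdot> Cm \<alpha> \<cdot> c X"
    using h b Cm_hom[OF h(3)] c_hom[OF X(1)] c_hom[OF X(2)] Cm_natural[OF h(3)]
    by (simp add: hom_def comp_assoc comp_reassoc[OF pushout_comm[OF po(2)]])
  then show thesis using that by (rule pushout_induce[OF po(1) b(1,2) x])
qed

lemma mapping_cone_exists:
  assumes "f \<in> hom E X Y"
  obtains b \<kappa> K where "is_pushout E f (c X) b \<kappa>" "b \<in> hom E Y K" "\<kappa> \<in> hom E (Co X) K"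
  using pushout_exists[OF assms c_hom] homD[OF assms] that by blast

text \<open>Collapsing the cone in \<open>Y \<union>\<^sub>X CX\<close> is the cobase change of the weak equivalence
  \<open>CX \<rightarrow> *\<close> along the cofibration \<open>CX \<rightarrow> Y \<union>\<^sub>X CX\<close>.\<close>

lemma collapse_cone:
  assumes po: "is_pushout E i (c X) b \<kappa>" and q: "is_quotient E pt i q" and i: "i \<in> Cofib E" "i \<in> hom E X Y"
    and b: "b \<in> hom E Y K" "\<kappa> \<in> hom E (Co X) K"
  obtains m where "m \<in> hom E K (Cod E q)" "m \<cdot> b = q" "m \<in> Weq E"
    "\<forall>z\<in>hom E pt (Cod E q). \<forall>e\<in>hom E (Co X) pt. m \<cdot> \<kappa> = z \<cdot> e"
proof -
  have X: "X \<in> Ob E" using homD[OF i(2)] by auto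
  obtain t z where t: "t \<in> hom E X pt" "is_pushout E i t q z" "q \<in> hom E Y (Cod E q)" "z \<in> hom E pt (Cod E q)"
    by (rule quotientE[OF q i(2)])
  obtain e where e: "e \<in> hom E (Co X) pt" using to_pt X by (meson Co_Ob)
  have "t = e \<cdot> c X" using t e c_hom[OF X] by (intro to_pt_eq[of _ X]) auto
  with t(2) have po': "is_pushout E i (e \<cdot> c X) q z" by simp
  obtain m where m: "m \<in> hom E K (Cod E q)" "m \<cdot> b = q" "m \<cdot> \<kappa> = z \<cdot> e" "is_pushout E \<kappa> e m z"
    by (rule pushout_cancel[OF po po' b e t(3)])
  have "m \<in> Weq E"
    using pushout_weq[OF m(4) pushout_cofib[OF po i(1)] cone_contractible[OF X e]] .
  moreover have "m \<cdot> \<kappa> = z' \<cdot> e'" if "z' \<in> hom E pt (Cod E q)" "e' \<in> hom E (Co X) pt" for z' e'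
    using m(3) from_pt_eq[OF that(1) t(4)] to_pt_eq[OF that(2) e] by simp
  ultimately show thesis using that m by blast
qed

text \<open>The two maps are conjugate by the weak equivalences that collapse the cones.\<close>

lemma quotient_weq_iff_cone_weq:
  assumes po: "is_pushout E i (c X) b \<kappa>" "is_pushout E i' (c X') b' \<kappa>'"
    and q: "is_quotient E pt i q" "is_quotient E pt i' q'"
    and i: "i \<in> Cofib E" "i \<in> hom E X Y" "i' \<in> Cofib E" "i' \<in> hom E X' Y'"
    and b: "b \<in> hom E Y K" "\<kappa> \<in> hom E (Co X) K" "b' \<in> hom E Y' K'" "\<kappa>' \<in> hom E (Co X') K'"
    and h: "\<alpha> \<in> hom E X X'" "h \<in> hom E Y Y'"
    and H: "H \<in> hom E K K'" "H \<cdot> b = b' \<cdot> h" "H \<cdot> \<kappa> = \<kappa>' \<cdot> Cm \<alpha>"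
    and k: "k \<in> hom E (Cod E q) (Cod E q')" "k \<cdot> q = q' \<cdot> h"
  shows "k \<in> Weq E \<longleftrightarrow> H \<in> Weq E"
proof -
  obtain m where m: "m \<in> hom E K (Cod E q)" "m \<cdot> b = q" "m \<in> Weq E"
    "\<forall>z\<in>hom E pt (Cod E q). \<forall>e\<in>hom E (Co X) pt. m \<cdot> \<kappa> = z \<cdot> e"
    by (rule collapse_cone[OF po(1) q(1) i(1,2) b(1,2)])
  obtain m' where m': "m' \<in> hom E K' (Cod E q')" "m' \<cdot> b' = q'" "m' \<in> Weq E"
    "\<forall>z\<in>hom E pt (Cod E q'). \<forall>e\<in>hom E (Co X') pt. m' \<cdot> \<kappa>' = z \<cdot> e"
    by (rule collapse_cone[OF po(2) q(2) i(3,4) b(3,4)])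
  have "k \<cdot> m = m' \<cdot> H"
  proof (rule pushout_eqI[OF po(1) b(1,2)])
    show "k \<cdot> m \<in> hom E K (Cod E q')" "m' \<cdot> H \<in> hom E K (Cod E q')"
      using m m' k H by auto
    show "k \<cdot> m \<cdot> b = m' \<cdot> H \<cdot> b"
      using m(1,2) m'(1,2) k H(1,2) h b by (simp add: hom_def comp_assoc comp_reassoc[OF m'(2)])
    have X: "Co X' \<in> Ob E" using homD[OF h(1)] by simp
    obtain z e where z: "z \<in> hom E pt (Cod E q)" and e: "e \<in> hom E (Co X') pt"
      using from_pt[OF homD(5)[OF m(1)]] to_pt[OF X] by auto
    have C: "Cm \<alpha> \<in> hom E (Co X) (Co X')" by (rule Cm_hom[OF h(1)])
    have "k \<cdot> m \<cdot> \<kappa> = k \<cdot> (z \<cdot> (e \<cdot> Cm \<alpha>))"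
      using assoc[OF b(2) m(1) k(1)] bspec[OF bspec[OF m(4) z] comp_hom[OF C e]] by simp
    also have "\<dots> = k \<cdot> z \<cdot> e \<cdot> Cm \<alpha>" using k(1) z e C by (simp add: hom_def comp_assoc)
    also have "\<dots> = m' \<cdot> \<kappa>' \<cdot> Cm \<alpha>"
      using assoc[OF C b(4) m'(1)] assoc[OF C e comp_hom[OF z k(1)]] bspec[OF bspec[OF m'(4) comp_hom[OF z k(1)]] e] by simp
    also have "\<dots> = m' \<cdot> H \<cdot> \<kappa>" using m'(1) H b C by (simp add: hom_def comp_assoc)
    finally show "k \<cdot> m \<cdot> \<kappa> = m' \<cdot> H \<cdot> \<kappa>" .
  qed
  then show ?thesis
    using weq_comp_iff_left[OF m(1) k(1) m(3)] weq_comp_iff_right[OF H(1) m'(1) m'(3)] by simp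
qed

text \<open>A cobase change does not affect the quotient, so both mapping cones collapse onto the same object.\<close>

lemma pushout_cone_weq:
  assumes po: "is_pushout E \<alpha> i j l" and i: "i \<in> Cofib E"
    and h: "\<alpha> \<in> hom E A C" "i \<in> hom E A B" "j \<in> hom E C D" "l \<in> hom E B D"
    and pc: "is_pushout E i (c A) b \<kappa>" "is_pushout E j (c C) b' \<kappa>'"
    and b: "b \<in> hom E B K" "\<kappa> \<in> hom E (Co A) K" "b' \<in> hom E D K'" "\<kappa>' \<in> hom E (Co C) K'"
    and H: "H \<in> hom E K K'" "H \<cdot> b = b' \<cdot> l" "H \<cdot> \<kappa> = \<kappa>' \<cdot> Cm \<alpha>"
  shows "H \<in> Weq E"
proof -
  obtain q where q: "is_quotient E pt j q" by (rule quotient_exists[OF h(3)])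
  obtain t z where t: "t \<in> hom E C pt" "is_pushout E j t q z" "q \<in> hom E D (Cod E q)" "z \<in> hom E pt (Cod E q)"
    by (rule quotientE[OF q h(3)])
  have ql: "q \<cdot> l \<in> hom E B (Cod E q)" using t h by auto
  \<comment> \<open>The cobase change \<open>j\<close> of \<open>i\<close> has the same quotient as \<open>i\<close>.\<close>
  have "is_pushout E i (t \<cdot> \<alpha>) (q \<cdot> l) z"
    using pushout_paste[OF pushout_sym[OF po] t(2)] .
  moreover have "t \<cdot> \<alpha> \<in> hom E A pt" using t h by auto
  ultimately have q': "is_quotient E pt i (q \<cdot> l)"
    using homD[OF h(2)] unfolding is_quotient_def by auto
  have Q: "Cod E (q \<cdot> l) = Cod E q" using homD[OF ql] by simp
  have k: "Id E (Cod E q) \<in> hom E (Cod E (q \<cdot> l)) (Cod E q)" "Id E (Cod E q) \<cdot> (q \<cdot> l) = q \<cdot> l"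
    using Q homD[OF ql] id_comp[OF ql] by auto
  show ?thesis
    using quotient_weq_iff_cone_weq[OF pc q' q i h(2) pushout_cofib[OF pushout_sym[OF po] i] h(3) b h(1,4) H k]
      homD[OF ql] by auto
qed

text \<open>The hypothesis on quotients concerns two cofibrations, whereas \<open>v \<cdot> j\<close> is arbitrary. Factor it as a
  cofibration \<open>g1\<close> followed by an acyclic fibration; the mapping cone changes only up to weak
  equivalence, and \<open>v\<close> lifts to a map \<open>v'\<close> from the target of \<open>j\<close> to that of \<open>g1\<close>, to which the hypothesis applies.\<close>

lemma mapping_cone_detects_weq:
  assumes det: "quotients_detect_weq E pt"
    and j: "j \<in> Cofib E" "j \<in> hom E C D'" and v: "v \<in> hom E D' D"
    and pc: "is_pushout E j (c C) b \<kappa>" "is_pushout E (v \<cdot> j) (c C) b' \<kappa>'"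
    and b: "b \<in> hom E D' K" "\<kappa> \<in> hom E (Co C) K" "b' \<in> hom E D K'" "\<kappa>' \<in> hom E (Co C) K'"
    and m: "m \<in> hom E K K'" "m \<cdot> b = b' \<cdot> v" "m \<cdot> \<kappa> = \<kappa>'"
  shows "m \<in> Weq E \<longleftrightarrow> v \<in> Weq E"
proof
  have C: "C \<in> Ob E" using homD[OF j(2)] by simp
  show "m \<in> Weq E" if "v \<in> Weq E"
    by (rule glue_along_base[OF pc c_cofib[OF C] that v b(1,3) m])
  assume mw: "m \<in> Weq E"
  have g: "v \<cdot> j \<in> hom E C D" using j v by auto
  obtain D1 g1 v1 where g1: "g1 \<in> hom E C D1" "v1 \<in> hom E D1 D" "g1 \<in> Cofib E" "v1 \<in> Fibr E"
    "v1 \<in> Weq E" "v1 \<cdot> g1 = v \<cdot> j"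
    by (rule factor_acyclic_fibration[OF g])
  obtain v' where v': "v' \<in> hom E D' D1" "v' \<cdot> j = g1" "v1 \<cdot> v' = v"
    using lift[OF j(1) g1(4) _ j(2) g1(2,1) v] g1(5,6) by blast
  obtain b1 \<kappa>1 K1 where pc1: "is_pushout E g1 (c C) b1 \<kappa>1" "b1 \<in> hom E D1 K1" "\<kappa>1 \<in> hom E (Co C) K1"
    by (rule mapping_cone_exists[OF g1(1)])
  have idc: "x \<cdot> Cm (Id E C) = x" if "x \<in> hom E (Co C) Z" for x Z
    using that by (simp add: Cm_id[OF C])
  have I: "Id E C \<in> hom E C C" using C by simp
  have e1: "v1 \<cdot> g1 = v \<cdot> j \<cdot> Id E C" "v' \<cdot> j = g1 \<cdot> Id E C" using g1(1,6) g v' by simp_all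
  obtain m1 where m1: "m1 \<in> hom E K1 K'" "m1 \<cdot> b1 = b' \<cdot> v1" "m1 \<cdot> \<kappa>1 = \<kappa>'"
    using cone_map_exists[OF pc1(1) pc(2) g1(1) g I g1(2) e1(1) pc1(2,3) b(3,4)] idc[OF b(4)] by metis
  have m1w: "m1 \<in> Weq E"
    using glue_along_base[OF pc1(1) _ c_cofib[OF C] g1(5,2) pc1(2) b(3) m1] pc(2) g1(6) by simp
  obtain H where H: "H \<in> hom E K K1" "H \<cdot> b = b1 \<cdot> v'" "H \<cdot> \<kappa> = \<kappa>1 \<cdot> Cm (Id E C)"
    by (rule cone_map_exists[OF pc(1) pc1(1) j(2) g1(1) I v'(1) e1(2) b(1,2) pc1(2,3)])
  have "m1 \<cdot> H = m"
  proof (rule pushout_eqI[OF pc(1) b(1,2) _ m(1)])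
    show "m1 \<cdot> H \<in> hom E K K'" using m1 H by auto
    show "m1 \<cdot> H \<cdot> b = m \<cdot> b"
      using m1(1,2) H(1,2) m(2) b(1,3) v' g1(2) pc1(2)
      by (simp add: hom_def comp_assoc comp_reassoc[OF m1(2)])
    show "m1 \<cdot> H \<cdot> \<kappa> = m \<cdot> \<kappa>"
      using assoc[OF b(2) H(1) m1(1)] H(3) idc[OF pc1(3)] m1(3) m(3) by simp
  qed
  then have Hw: "H \<in> Weq E" using weq_cancel_left[OF H(1) m1(1) m1w] mw by simp
  obtain q q' where q: "is_quotient E pt j q" "is_quotient E pt g1 q'"
    using quotient_exists[OF j(2)] quotient_exists[OF g1(1)] by metis
  obtain k where k: "k \<in> hom E (Cod E q) (Cod E q')" "k \<cdot> q = q' \<cdot> v'"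
    by (rule quotient_map_exists[OF q j(2) g1(1) I v'(1) e1(2)])
  have "k \<in> Weq E"
    using quotient_weq_iff_cone_weq[OF pc(1) pc1(1) q j g1(3,1) b(1,2) pc1(2,3) I v'(1) H k] Hw by simp
  then have "v' \<in> Weq E"
    using det j g1(1,3) q k v' homD[OF j(2)] homD[OF g1(1)] unfolding quotients_detect_weq_def by metis
  then show "v \<in> Weq E" using weq_comp[OF v'(1) g1(2) _ g1(5)] v'(3) by simp
qed

text \<open>Up to weak equivalence, replacing \<open>f\<close> by the cofibration \<open>i\<close> does not change its mapping cone,
  nor does replacing \<open>i\<close> by its cobase change \<open>j\<close>. So \<open>u\<close> is a weak equivalence if and only if the
  map from the cone of \<open>j\<close> to that of \<open>g = v \<cdot> j\<close> is, and \<open>mapping_cone_detects_weq\<close> applies.\<close>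

lemma cone_weq_iff_comparison_weq:
  assumes det: "quotients_detect_weq E pt"
    and sq: "f \<in> hom E A B" "g \<in> hom E C D" "\<alpha> \<in> hom E A C" "\<beta> \<in> hom E B D"
    and pc: "is_pushout E f (c A) b \<kappa>" "is_pushout E g (c C) b' \<kappa>'"
    and b: "b \<in> hom E B K" "\<kappa> \<in> hom E (Co A) K" "b' \<in> hom E D K'" "\<kappa>' \<in> hom E (Co C) K'"
    and u: "u \<in> hom E K K'" "u \<cdot> b = b' \<cdot> \<beta>" "u \<cdot> \<kappa> = \<kappa>' \<cdot> Cm \<alpha>"
    and fac: "i \<in> Cofib E" "w \<in> Weq E" "i \<in> hom E A B1" "w \<in> hom E B1 B" "w \<cdot> i = f"
    and po: "is_pushout E \<alpha> i j l" "j \<in> hom E C D'" "l \<in> hom E B1 D'"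
    and v: "v \<in> hom E D' D" "v \<cdot> j = g" "v \<cdot> l = \<beta> \<cdot> w"
  shows "u \<in> Weq E \<longleftrightarrow> v \<in> Weq E"
proof -
  have Ob: "A \<in> Ob E" "C \<in> Ob E" using homD[OF sq(3)] by auto
  have jc: "j \<in> Cofib E" by (rule pushout_cofib[OF pushout_sym[OF po(1)] fac(1)])
  obtain b1 \<kappa>1 K1 where pc1: "is_pushout E i (c A) b1 \<kappa>1" "b1 \<in> hom E B1 K1" "\<kappa>1 \<in> hom E (Co A) K1"
    by (rule mapping_cone_exists[OF fac(3)])
  obtain b2 \<kappa>2 K2 where pc2: "is_pushout E j (c C) b2 \<kappa>2" "b2 \<in> hom E D' K2" "\<kappa>2 \<in> hom E (Co C) K2"
    by (rule mapping_cone_exists[OF po(2)])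
  obtain H where H: "H \<in> hom E K1 K2" "H \<cdot> b1 = b2 \<cdot> l" "H \<cdot> \<kappa>1 = \<kappa>2 \<cdot> Cm \<alpha>"
    by (rule cone_map_exists[OF pc1(1) pc2(1) fac(3) po(2) sq(3) po(3) pushout_comm[OF po(1), symmetric]
      pc1(2,3) pc2(2,3)])
  have Hw: "H \<in> Weq E"
    by (rule pushout_cone_weq[OF po(1) fac(1) sq(3) fac(3) po(2,3) pc1(1) pc2(1) pc1(2,3) pc2(2,3) H])
  have e: "w \<cdot> i = f \<cdot> Id E A" "v \<cdot> j = g \<cdot> Id E C" using fac v sq by simp_all
  obtain m1 where m1: "m1 \<in> hom E K1 K" "m1 \<cdot> b1 = b \<cdot> w" "m1 \<cdot> \<kappa>1 = \<kappa>"
    using cone_map_exists[OF pc1(1) pc(1) fac(3) sq(1) id_hom[OF Ob(1)] fac(4) e(1) pc1(2,3) b(1,2)]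
      comp_id[OF b(2)] Cm_id[OF Ob(1)] by metis
  obtain m2 where m2: "m2 \<in> hom E K2 K'" "m2 \<cdot> b2 = b' \<cdot> v" "m2 \<cdot> \<kappa>2 = \<kappa>'"
    using cone_map_exists[OF pc2(1) pc(2) po(2) sq(2) id_hom[OF Ob(2)] v(1) e(2) pc2(2,3) b(3,4)]
      comp_id[OF b(4)] Cm_id[OF Ob(2)] by metis
  have m1w: "m1 \<in> Weq E"
    using glue_along_base[OF pc1(1) _ c_cofib[OF Ob(1)] fac(2,4) pc1(2) b(1) m1] pc(1) fac(5) by simp
  have "u \<cdot> m1 = m2 \<cdot> H"
  proof (rule pushout_eqI[OF pc1])
    show "u \<cdot> m1 \<in> hom E K1 K'" "m2 \<cdot> H \<in> hom E K1 K'" using u m1 m2 H by auto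
    show "u \<cdot> m1 \<cdot> b1 = m2 \<cdot> H \<cdot> b1"
      using u(1,2) m1(1,2) m2(1,2) H(1,2) pc1(2) pc2(2) b(1,3) v po(3) fac(4) sq(4)
      by (simp add: hom_def comp_assoc comp_reassoc[OF u(2)] comp_reassoc[OF m2(2)])
    show "u \<cdot> m1 \<cdot> \<kappa>1 = m2 \<cdot> H \<cdot> \<kappa>1"
      using u(1,3) m1(1,3) m2(1,3) H(1,3) pc1(3) pc2(3) b(2,4) Cm_hom[OF sq(3)]
      by (simp add: hom_def comp_assoc comp_reassoc[OF m2(3)])
  qed
  then have "u \<in> Weq E \<longleftrightarrow> m2 \<in> Weq E"
    using weq_comp_iff_left[OF m1(1) u(1) m1w] weq_comp_iff_left[OF H(1) m2(1) Hw] by simp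
  also have "\<dots> \<longleftrightarrow> v \<in> Weq E"
    using mapping_cone_detects_weq[OF det jc po(2) v(1) pc2(1) _ pc2(2,3) b(3,4) m2] pc(2) v(2) by simp
  finally show ?thesis .
qed

theorem homotopy_pushout_iff_cone_weq:
  assumes det: "quotients_detect_weq E pt" and sq: "comm_square E f \<alpha> \<beta> g"
    and mc: "mapping_cone E c f b \<kappa>" "mapping_cone E c g b' \<kappa>'"
    and u: "u \<in> hom E (Cod E b) (Cod E b')" "u \<cdot> b = b' \<cdot> \<beta>" "u \<cdot> \<kappa> = \<kappa>' \<cdot> Cm \<alpha>"
  shows "homotopy_pushout E f g \<alpha> \<beta> \<longleftrightarrow> u \<in> Weq E"
proof -
  obtain A B C D where h: "f \<in> hom E A B" "\<alpha> \<in> hom E A C" "\<beta> \<in> hom E B D" "g \<in> hom E C D"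
    "\<beta> \<cdot> f = g \<cdot> \<alpha>"
    using sq by (auto simp: comm_square_iff)
  have Ob: "A \<in> Ob E" "C \<in> Ob E" using homD[OF h(2)] by auto
  have pc: "is_pushout E f (c A) b \<kappa>" "is_pushout E g (c C) b' \<kappa>'"
    using mc homD[OF h(1)] homD[OF h(4)] by (simp_all add: mapping_cone_def)
  have b: "b \<in> hom E B (Cod E b)" "\<kappa> \<in> hom E (Co A) (Cod E b)"
    "b' \<in> hom E D (Cod E b')" "\<kappa>' \<in> hom E (Co C) (Cod E b')"
    using pushout_legs[OF pc(1) h(1) c_hom[OF Ob(1)]] pushout_legs[OF pc(2) h(4) c_hom[OF Ob(2)]] by auto
  note iff = cone_weq_iff_comparison_weq[OF det h(1,4,2,3) pc b u]
  show ?thesis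
  proof
    assume "homotopy_pushout E f g \<alpha> \<beta>"
    then obtain i w j l v where fac: "i \<in> Cofib E" "w \<in> Weq E" "Cod E i = Dom E w" "w \<cdot> i = f"
      and po: "is_pushout E \<alpha> i j l" and v: "v \<in> hom E (Cod E j) (Cod E g)" "v \<cdot> j = g" "v \<cdot> l = \<beta> \<cdot> w"
      and vw: "v \<in> Weq E" by (auto simp: homotopy_pushout_def)
    have "i \<in> hom E A (Cod E i)" "w \<in> hom E (Cod E i) B"
      using fac h(1) comp_arr[of i w] cofib_arr[OF fac(1)] weq_arr[OF fac(2)] by (auto simp: hom_def)
    moreover have "j \<in> hom E C (Cod E j)" "l \<in> hom E (Cod E i) (Cod E j)"
      using pushout_legs[OF po h(2) calculation(1)] by auto
    moreover have "v \<in> hom E (Cod E j) D" using v homD[OF h(4)] by simp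
    ultimately show "u \<in> Weq E" using iff[OF fac(1,2) _ _ fac(4) po _ _ _ v(2,3)] vw by blast
  next
    assume uw: "u \<in> Weq E"
    obtain B1 i w where fac: "i \<in> hom E A B1" "w \<in> hom E B1 B" "i \<in> Cofib E" "w \<in> Weq E" "w \<cdot> i = f"
      by (rule factor_acyclic_fibration[OF h(1)])
    obtain j l D' where po: "is_pushout E \<alpha> i j l" "j \<in> hom E C D'" "l \<in> hom E B1 D'"
      by (rule pushout_exists[OF h(2) fac(1)])
    have bw: "\<beta> \<cdot> w \<in> hom E B1 D" using h fac by auto
    have "g \<cdot> \<alpha> = \<beta> \<cdot> w \<cdot> i" using h fac by (simp add: hom_def comp_assoc)
    then obtain v where v: "v \<in> hom E D' D" "v \<cdot> j = g" "v \<cdot> l = \<beta> \<cdot> w"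
      by (rule pushout_induce[OF po h(4) bw])
    have "v \<in> Weq E" using iff[OF fac(3,4,1,2,5) po v] uw by simp
    then show "homotopy_pushout E f g \<alpha> \<beta>"
      unfolding homotopy_pushout_def
      using sq fac v po homD[OF fac(1)] homD[OF fac(2)] homD[OF po(2)] homD[OF h(4)] by metis
  qed
qed

section \<open>Suspensions\<close>

lemma suspension_weq:
  assumes f: "f \<in> hom E X Y" "f \<in> Weq E" and s: "is_quotient E pt (c X) s" "is_quotient E pt (c Y) s'"
    and S: "S \<in> hom E (Cod E s) (Cod E s')" "S \<cdot> s = s' \<cdot> Cm f"
  shows "S \<in> Weq E"
proof -
  have Ob: "X \<in> Ob E" "Y \<in> Ob E" using homD[OF f(1)] by auto
  obtain t z where t: "t \<in> hom E X pt" "is_pushout E (c X) t s z" "s \<in> hom E (Co X) (Cod E s)" "z \<in> hom E pt (Cod E s)"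
    by (rule quotientE[OF s(1) c_hom[OF Ob(1)]])
  obtain t' z' where t': "t' \<in> hom E Y pt" "is_pushout E (c Y) t' s' z'" "s' \<in> hom E (Co Y) (Cod E s')" "z' \<in> hom E pt (Cod E s')"
    by (rule quotientE[OF s(2) c_hom[OF Ob(2)]])
  show ?thesis
  proof (rule gluing[OF pushout_sym[OF t(2)] pushout_sym[OF t'(2)] c_cofib[OF Ob(1)] c_cofib[OF Ob(2)] f(2,1)
      id_weq[OF pt_Ob] id_hom[OF pt_Ob] Cm_weq[OF f(1)] Cm_hom[OF f(1)] _ Cm_natural[OF f(1)]
      t(1) c_hom[OF Ob(1)] t(4,3) t'(1) c_hom[OF Ob(2)] t'(4,3) S(1) _ S(2)])
    show "Id E pt \<cdot> t = t' \<cdot> f" using t t' f by (intro to_pt_eq[of _ X]) auto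
    show "S \<cdot> z = z' \<cdot> Id E pt" using S(1) t(4) t'(4) by (intro from_pt_eq) auto
  qed
qed

text \<open>Let \<open>K = Y \<union>\<^sub>X CX\<close> be the mapping cone of \<open>i\<close> and \<open>P = K \<union>\<^sub>Y CY\<close>. Then \<open>P/K = CY/Y\<close> is the
  suspension of \<open>Y\<close>. Since also \<open>P = CX \<union>\<^sub>X CY\<close>, the map \<open>P \<rightarrow> P'\<close> induced by \<open>h\<close> is a cobase change
  of the weak equivalence \<open>CY \<rightarrow> CY'\<close>, while \<open>K \<rightarrow> K'\<close> is a weak equivalence because it collapses to
  \<open>k\<close>. Gluing then yields the claim for \<open>P/K \<rightarrow> P'/K'\<close>.\<close>

lemma quotient_weq_imp_suspension_weq:
  assumes i: "i \<in> Cofib E" "i \<in> hom E X Y" "i' \<in> Cofib E" "i' \<in> hom E X Y'"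
    and h: "h \<in> hom E Y Y'" "h \<cdot> i = i'"
    and q: "is_quotient E pt i q" "is_quotient E pt i' q'"
    and k: "k \<in> hom E (Cod E q) (Cod E q')" "k \<cdot> q = q' \<cdot> h" "k \<in> Weq E"
    and s: "is_quotient E pt (c Y) s" "is_quotient E pt (c Y') s'"
    and S: "S \<in> hom E (Cod E s) (Cod E s')" "S \<cdot> s = s' \<cdot> Cm h"
  shows "S \<in> Weq E"
proof -
  have Ob: "X \<in> Ob E" "Y \<in> Ob E" "Y' \<in> Ob E" using homD[OF i(2)] homD[OF i(4)] by auto
  note cX = c_hom[OF Ob(1)] and cY = c_hom[OF Ob(2)] and cY' = c_hom[OF Ob(3)]
  note Ch = Cm_hom[OF h(1)]
  obtain b \<kappa> K where K: "is_pushout E i (c X) b \<kappa>" "b \<in> hom E Y K" "\<kappa> \<in> hom E (Co X) K"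
    by (rule mapping_cone_exists[OF i(2)])
  obtain b' \<kappa>' K' where K': "is_pushout E i' (c X) b' \<kappa>'" "b' \<in> hom E Y' K'" "\<kappa>' \<in> hom E (Co X) K'"
    by (rule mapping_cone_exists[OF i(4)])
  have I: "Id E X \<in> hom E X X" "h \<cdot> i = i' \<cdot> Id E X" using Ob h i by simp_all
  obtain H where H: "H \<in> hom E K K'" "H \<cdot> b = b' \<cdot> h" "H \<cdot> \<kappa> = \<kappa>' \<cdot> Cm (Id E X)"
    by (rule cone_map_exists[OF K(1) K'(1) i(2,4) I(1) h(1) I(2) K(2,3) K'(2,3)])
  have Hw: "H \<in> Weq E"
    using quotient_weq_iff_cone_weq[OF K(1) K'(1) q i K(2,3) K'(2,3) I(1) h(1) H k(1,2)] k(3) by simp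
  have H\<kappa>: "H \<cdot> \<kappa> = \<kappa>'" using H(3) K'(3) by (simp add: Cm_id Ob)
  obtain p r P where P: "is_pushout E b (c Y) p r" "p \<in> hom E K P" "r \<in> hom E (Co Y) P"
    by (rule mapping_cone_exists[OF K(2)])
  obtain p' r' P' where P': "is_pushout E b' (c Y') p' r'" "p' \<in> hom E K' P'" "r' \<in> hom E (Co Y') P'"
    by (rule mapping_cone_exists[OF K'(2)])
  obtain N where N: "N \<in> hom E P P'" "N \<cdot> p = p' \<cdot> H" "N \<cdot> r = r' \<cdot> Cm h"
    by (rule cone_map_exists[OF P(1) P'(1) K(2) K'(2) h(1) H(1) H(2) P(2,3) P'(2,3)])
  \<comment> \<open>Here \<open>P\<close> and \<open>P'\<close> are regarded as \<open>CX \<union>\<^sub>X CY\<close> and \<open>CX \<union>\<^sub>X CY'\<close>.\<close>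
  have Nw: "N \<in> Weq E"
  proof (rule glue_along_base)
    show "is_pushout E (c Y \<cdot> i) (c X) r (p \<cdot> \<kappa>)"
      using pushout_paste[OF pushout_sym[OF K(1)] P(1)] by (rule pushout_sym)
    have "is_pushout E (c Y' \<cdot> i') (c X) r' (p' \<cdot> \<kappa>')"
      using pushout_paste[OF pushout_sym[OF K'(1)] P'(1)] by (rule pushout_sym)
    moreover have "c Y' \<cdot> i' = Cm h \<cdot> (c Y \<cdot> i)"
      using h i(2) cY cY' Ch by (simp add: hom_def comp_assoc comp_reassoc[OF Cm_natural[OF h(1)]])
    ultimately show "is_pushout E (Cm h \<cdot> (c Y \<cdot> i)) (c X) r' (p' \<cdot> \<kappa>')" by simp
    show "N \<cdot> (p \<cdot> \<kappa>) = p' \<cdot> \<kappa>'"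
      using N(1,2) P(2) P'(2) K(3) H(1) H\<kappa> by (simp add: hom_def comp_assoc comp_reassoc[OF N(2)])
  qed (use c_cofib[OF Ob(1)] Cm_weq[OF h(1)] Ch P(3) P'(3) N in auto)
  obtain t z where t: "t \<in> hom E Y pt" "is_pushout E (c Y) t s z" "s \<in> hom E (Co Y) (Cod E s)" "z \<in> hom E pt (Cod E s)"
    by (rule quotientE[OF s(1) cY])
  obtain t' z' where t': "t' \<in> hom E Y' pt" "is_pushout E (c Y') t' s' z'" "s' \<in> hom E (Co Y') (Cod E s')" "z' \<in> hom E pt (Cod E s')"
    by (rule quotientE[OF s(2) cY'])
  obtain a a' where a: "a \<in> hom E K pt" "a' \<in> hom E K' pt"
    using to_pt[OF homD(4)[OF H(1)]] to_pt[OF homD(5)[OF H(1)]] by metis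
  have "t = a \<cdot> b" "t' = a' \<cdot> b'"
    using to_pt_eq[OF t(1) comp_hom[OF K(2) a(1)]] to_pt_eq[OF t'(1) comp_hom[OF K'(2) a(2)]] .
  then have sab: "is_pushout E (c Y) (a \<cdot> b) s z" "is_pushout E (c Y') (a' \<cdot> b') s' z'"
    using t(2) t'(2) by simp_all
  obtain m where m: "m \<in> hom E P (Cod E s)" "m \<cdot> r = s" "m \<cdot> p = z \<cdot> a" "is_pushout E p a m z"
    by (rule pushout_cancel[OF pushout_sym[OF P(1)] sab(1) P(3,2) a(1) t(3)])
  obtain m' where m': "m' \<in> hom E P' (Cod E s')" "m' \<cdot> r' = s'" "m' \<cdot> p' = z' \<cdot> a'" "is_pushout E p' a' m' z'"
    by (rule pushout_cancel[OF pushout_sym[OF P'(1)] sab(2) P'(3,2) a(2) t'(3)])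
  have pc: "p \<in> Cofib E" "p' \<in> Cofib E"
    using pushout_cofib[OF pushout_sym[OF P(1)]] pushout_cofib[OF pushout_sym[OF P'(1)]] c_cofib Ob by auto
  have e1: "Id E pt \<cdot> a = a' \<cdot> H" using a H by (intro to_pt_eq[of _ K]) auto
  have e2: "S \<cdot> z = z' \<cdot> Id E pt" using S(1) t(4) t'(4) by (intro from_pt_eq) auto
  have e3: "S \<cdot> m = m' \<cdot> N"
  proof (rule pushout_eqI[OF P])
    show "S \<cdot> m \<in> hom E P (Cod E s')" "m' \<cdot> N \<in> hom E P (Cod E s')" using S m m' N by auto
    have "S \<cdot> m \<cdot> p = S \<cdot> z \<cdot> a"
      using S(1) m P(2) t(4) a(1) by (simp add: hom_def comp_assoc)
    also have "\<dots> = z' \<cdot> (a' \<cdot> H)" using e1 e2 t'(4) a by simp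
    also have "\<dots> = m' \<cdot> N \<cdot> p"
      using m' N t'(4) a H(1) P(2) P'(2) by (simp add: hom_def comp_assoc comp_reassoc[OF m'(3)])
    finally show "S \<cdot> m \<cdot> p = m' \<cdot> N \<cdot> p" .
    show "S \<cdot> m \<cdot> r = m' \<cdot> N \<cdot> r"
      using S m(1,2) m'(1,2) N P(3) P'(3) Ch by (simp add: hom_def comp_assoc comp_reassoc[OF m'(2)])
  qed
  show ?thesis
    by (rule gluing[OF pushout_sym[OF m(4)] pushout_sym[OF m'(4)] pc Hw H(1)
      id_weq[OF pt_Ob] id_hom[OF pt_Ob] Nw N(1) e1 N(2) a(1) P(2) t(4) m(1) a(2) P'(2) t'(4) m'(1) S(1) e2 e3])
qed

end

section \<open>The localisation and its universal property\<close>

text \<open>Any two choices of an inverse agree, so that \<open>SOME\<close> makes no arbitrary choice.\<close>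

definition inverse_arrow :: "('o, 'm, 'z) cat_scheme \<Rightarrow> 'm \<Rightarrow> 'm" where
  "inverse_arrow D f = (SOME g. g \<in> hom D (Cod D f) (Dom D f) \<and>
     g \<cdot>\<^bsub>D\<^esub> f = Id D (Dom D f) \<and> f \<cdot>\<^bsub>D\<^esub> g = Id D (Cod D f))"

lemma inverse_arrow:
  assumes "is_iso D f" "f \<in> hom D x y"
  shows "inverse_arrow D f \<in> hom D y x" and "inverse_arrow D f \<cdot>\<^bsub>D\<^esub> f = Id D x"
    and "f \<cdot>\<^bsub>D\<^esub> inverse_arrow D f = Id D y"
proof -
  have d: "Dom D f = x" "Cod D f = y" using assms(2) by (auto simp: hom_def)
  have "\<exists>g. g \<in> hom D y x \<and> g \<cdot>\<^bsub>D\<^esub> f = Id D x \<and> f \<cdot>\<^bsub>D\<^esub> g = Id D y"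
    using assms(1) d unfolding is_iso_def by auto
  from someI_ex[OF this]
  show "inverse_arrow D f \<in> hom D y x" "inverse_arrow D f \<cdot>\<^bsub>D\<^esub> f = Id D x"
    "f \<cdot>\<^bsub>D\<^esub> inverse_arrow D f = Id D y"
    unfolding inverse_arrow_def d by blast+
qed

lemma is_isoI:
  assumes "f \<in> hom D x y" "g \<in> hom D y x" "g \<cdot>\<^bsub>D\<^esub> f = Id D x" "f \<cdot>\<^bsub>D\<^esub> g = Id D y"
  shows "is_iso D f"
proof -
  have "f \<in> Ar D" "Dom D f = x" "Cod D f = y" using assms(1) by (auto simp: hom_def)
  then show ?thesis using assms(2-4) unfolding is_iso_def by auto
qed

lemma functor_hom: "is_functor E D Fo Fm \<Longrightarrow> f \<in> hom E x y \<Longrightarrow> Fm f \<in> hom D (Fo x) (Fo y)"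
  by (auto simp: is_functor_def hom_def)

lemma functor_comp:
  "is_functor E D Fo Fm \<Longrightarrow> f \<in> hom E x y \<Longrightarrow> g \<in> hom E y z \<Longrightarrow>
    Fm (g \<cdot>\<^bsub>E\<^esub> f) = Fm g \<cdot>\<^bsub>D\<^esub> Fm f"
  by (auto simp: is_functor_def hom_def)

lemma functor_id: "is_functor E D Fo Fm \<Longrightarrow> x \<in> Ob E \<Longrightarrow> Fm (Id E x) = Id D (Fo x)"
  by (auto simp: is_functor_def)

lemma functor_iso:
  assumes F: "is_functor E D Fo Fm" and f: "is_iso E f" "f \<in> hom E x y" and ob: "x \<in> Ob E" "y \<in> Ob E"
  shows "is_iso D (Fm f)"
proof -
  note i = inverse_arrow[OF f]
  show ?thesis
    using functor_comp[OF F f(2) i(1)] functor_comp[OF F i(1) f(2)] i functor_id[OF F] ob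
    by (intro is_isoI[OF functor_hom[OF F f(2)] functor_hom[OF F i(1)]]) auto
qed

lemma functor_compose:
  assumes F: "is_functor A B Fo Fm" and G: "is_functor B D Go Gm"
  shows "is_functor A D (\<lambda>x. Go (Fo x)) (\<lambda>f. Gm (Fm f))"
  using assms unfolding is_functor_def hom_def by auto

context cat_locale
begin

lemma iso_comp:
  assumes f: "is_iso E f" "f \<in> hom E x y" and g: "is_iso E g" "g \<in> hom E y z"
  shows "is_iso E (g \<cdot> f)"
proof -
  note i = inverse_arrow[OF f] and j = inverse_arrow[OF g]
  show ?thesis
  proof (rule is_isoI[OF comp_hom[OF f(2) g(2)] comp_hom[OF j(1) i(1)]])
    have "inverse_arrow E f \<cdot> inverse_arrow E g \<cdot> (g \<cdot> f) =
        inverse_arrow E f \<cdot> (inverse_arrow E g \<cdot> g \<cdot> f)"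
      using assoc[OF comp_hom[OF f(2) g(2)] j(1) i(1)] assoc[OF f(2) g(2) j(1)] by simp
    then show "inverse_arrow E f \<cdot> inverse_arrow E g \<cdot> (g \<cdot> f) = Id E x"
      using i j id_comp[OF f(2)] by simp
    have "g \<cdot> f \<cdot> (inverse_arrow E f \<cdot> inverse_arrow E g) =
        g \<cdot> (f \<cdot> inverse_arrow E f \<cdot> inverse_arrow E g)"
      using assoc[OF comp_hom[OF j(1) i(1)] f(2) g(2)] assoc[OF j(1) i(1) f(2)] by simp
    then show "g \<cdot> f \<cdot> (inverse_arrow E f \<cdot> inverse_arrow E g) = Id E z"
      using i j id_comp[OF j(1)] by simp
  qed
qed

lemma iso_inverse:
  assumes "is_iso E f" "f \<in> hom E x y"
  shows "is_iso E (inverse_arrow E f)"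
  using inverse_arrow[OF assms] assms(2) by (auto intro: is_isoI)

lemma iso_cancel:
  assumes f: "f \<in> hom E x y" and g: "g \<in> hom E y z" and gf: "is_iso E (g \<cdot> f)"
  shows "is_iso E f \<Longrightarrow> is_iso E g" and "is_iso E g \<Longrightarrow> is_iso E f"
proof -
  assume i: "is_iso E f"
  have "g \<cdot> f \<cdot> inverse_arrow E f = g"
    using assoc[OF inverse_arrow(1)[OF i f] f g] inverse_arrow(3)[OF i f] comp_id[OF g] by simp
  then show "is_iso E g"
    using iso_comp[OF iso_inverse[OF i f] inverse_arrow(1)[OF i f] gf comp_hom[OF f g]] by simp
next
  assume i: "is_iso E g"
  have "inverse_arrow E g \<cdot> (g \<cdot> f) = f"
    using assoc[OF f g inverse_arrow(1)[OF i g]] inverse_arrow(2)[OF i g] id_comp[OF f] by simp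
  then show "is_iso E f"
    using iso_comp[OF gf comp_hom[OF f g] iso_inverse[OF i g] inverse_arrow(1)[OF i g]] by simp
qed

lemma square_comp:
  assumes "a \<in> hom E x y" "b \<in> hom E y z" "a' \<in> hom E x' y'" "b' \<in> hom E y' z'"
    and "s \<in> hom E x x'" "t \<in> hom E y y'" "u \<in> hom E z z'"
    and "a' \<cdot> s = t \<cdot> a" "b' \<cdot> t = u \<cdot> b"
  shows "b' \<cdot> a' \<cdot> s = u \<cdot> (b \<cdot> a)"
proof -
  have "b' \<cdot> a' \<cdot> s = b' \<cdot> t \<cdot> a" using assoc[OF assms(5,3,4)] assoc[OF assms(1,6,4)] assms(8) by simp
  also have "\<dots> = u \<cdot> (b \<cdot> a)" using assoc[OF assms(1,2,7)] assms(9) by simp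
  finally show ?thesis .
qed

lemma square_inverse:
  assumes "a \<in> hom E x y" "b \<in> hom E y x" "a' \<in> hom E x' y'" "b' \<in> hom E y' x'"
    and "s \<in> hom E x x'" "t \<in> hom E y y'" "a' \<cdot> s = t \<cdot> a"
    and "a \<cdot> b = Id E y" "b' \<cdot> a' = Id E x'"
  shows "b' \<cdot> t = s \<cdot> b"
proof -
  have "b' \<cdot> t = b' \<cdot> (t \<cdot> a \<cdot> b)" using assoc[OF assms(2,1,6)] assms(8) comp_id[OF assms(6)] by simp
  also have "\<dots> = b' \<cdot> (a' \<cdot> (s \<cdot> b))" using assms(7) assoc[OF assms(2,5,3)] by simp
  also have "\<dots> = s \<cdot> b"
    using assoc[OF comp_hom[OF assms(2,5)] assms(3,4)] assms(9) id_comp[OF comp_hom[OF assms(2,5)]] by simp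
  finally show ?thesis .
qed

end

lemma nat_trans_vcomp:
  assumes D: "category D" and B: "category B"
    and F: "is_functor B D Fo Fm" "is_functor B D Go Gm" "is_functor B D Ko Km"
    and s: "nat_trans B D Fo Fm Go Gm s" and t: "nat_trans B D Go Gm Ko Km t"
  shows "nat_trans B D Fo Fm Ko Km (\<lambda>x. t x \<cdot>\<^bsub>D\<^esub> s x)"
proof -
  interpret D: cat_locale D using D by unfold_locales
  have h: "s x \<in> hom D (Fo x) (Go x)" "t x \<in> hom D (Go x) (Ko x)" if "x \<in> Ob B" for x
    using s t that by (auto simp: nat_trans_def)
  show ?thesis
    unfolding nat_trans_def
  proof (intro conjI ballI)
    show "t x \<cdot>\<^bsub>D\<^esub> s x \<in> hom D (Fo x) (Ko x)" if "x \<in> Ob B" for x using h[OF that] by auto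
    fix f assume f: "f \<in> Ar B"
    have x: "Dom B f \<in> Ob B" "Cod B f \<in> Ob B" using B f by (auto simp: category_def)
    have m: "Fm f \<in> hom D (Fo (Dom B f)) (Fo (Cod B f))" "Gm f \<in> hom D (Go (Dom B f)) (Go (Cod B f))"
      "Km f \<in> hom D (Ko (Dom B f)) (Ko (Cod B f))" using F f by (auto simp: is_functor_def)
    have sq: "Gm f \<cdot>\<^bsub>D\<^esub> s (Dom B f) = s (Cod B f) \<cdot>\<^bsub>D\<^esub> Fm f" "Km f \<cdot>\<^bsub>D\<^esub> t (Dom B f) = t (Cod B f) \<cdot>\<^bsub>D\<^esub> Gm f"
      using s t f by (auto simp: nat_trans_def)
    show "Km f \<cdot>\<^bsub>D\<^esub> (t (Dom B f) \<cdot>\<^bsub>D\<^esub> s (Dom B f)) = t (Cod B f) \<cdot>\<^bsub>D\<^esub> s (Cod B f) \<cdot>\<^bsub>D\<^esub> Fm f"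
      using D.square_comp[OF h(1)[OF x(1)] h(2)[OF x(1)] h(1)[OF x(2)] h(2)[OF x(2)] m
        sq(1)[symmetric] sq(2)[symmetric]] by simp
  qed
qed

context pointed_model
begin

lemma zigzag_Nil [simp]: "zigzag E x [] y \<longleftrightarrow> x = y \<and> x \<in> Ob E"
  by (auto intro: zigzag.intros elim: zigzag.cases)

lemma zigzag_Fwd [simp]:
  "zigzag E x (Fwd f # us) y \<longleftrightarrow> f \<in> Ar E \<and> x = Dom E f \<and> zigzag E (Cod E f) us y"
  by (auto intro: zigzag.intros elim: zigzag.cases)

lemma zigzag_Bwd [simp]:
  "zigzag E x (Bwd w # us) y \<longleftrightarrow> w \<in> Weq E \<and> x = Cod E w \<and> zigzag E (Dom E w) us y"
  by (auto intro: zigzag.intros elim: zigzag.cases)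

lemma zigzag_Ob: "zigzag E x us y \<Longrightarrow> x \<in> Ob E \<and> y \<in> Ob E"
  by (induction rule: zigzag.induct) (auto dest: weq_arr)

lemma zigzag_append: "zigzag E x (us @ vs) z \<longleftrightarrow> (\<exists>y. zigzag E x us y \<and> zigzag E y vs z)"
proof (induction us arbitrary: x)
  case Nil
  then show ?case using zigzag_Ob by auto
next
  case (Cons l us)
  then show ?case by (cases l) auto
qed

lemma zigzag_eq_zigzag: "zigzag_eq E x y us vs \<Longrightarrow> zigzag E x us y \<and> zigzag E x vs y"
  by (induction rule: zigzag_eq.induct) (auto simp: zigzag_append dest: weq_arr)

lemma zigzag_eq_append:
  assumes "zigzag_eq E x y us vs" "zigzag E w as x" "zigzag E y bs z"
  shows "zigzag_eq E w z (as @ us @ bs) (as @ vs @ bs)"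
  using assms
proof (induction rule: zigzag_eq.induct)
  case (refl us)
  then show ?case unfolding zigzag_append by (intro zigzag_eq.refl) (auto simp: zigzag_append)
next
  case (sym us vs)
  then show ?case by (auto intro: zigzag_eq.sym)
next
  case (trans us vs ws)
  then show ?case by (auto intro: zigzag_eq.trans)
next
  case (ident a us vs)
  have "zigzag E w ((as @ us) @ Fwd (Id E a) # vs @ bs) z"
    using ident by (fastforce simp: zigzag_append)
  from zigzag_eq.ident[OF ident(1) this] show ?case by simp
next
  case (comp us f g vs)
  have "zigzag E w ((as @ us) @ Fwd f # Fwd g # vs @ bs) z"
    using comp by (fastforce simp: zigzag_append)
  from zigzag_eq.comp[OF this] show ?case by simp
next
  case (fwd_bwd us w' vs)
  have "zigzag E w ((as @ us) @ Fwd w' # Bwd w' # vs @ bs) z"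
    using fwd_bwd by (fastforce simp: zigzag_append)
  from zigzag_eq.fwd_bwd[OF this] show ?case by simp
next
  case (bwd_fwd us w' vs)
  have "zigzag E w ((as @ us) @ Bwd w' # Fwd w' # vs @ bs) z"
    using bwd_fwd by (fastforce simp: zigzag_append)
  from zigzag_eq.bwd_fwd[OF this] show ?case by simp
qed

lemma zz_class_eqI: "zigzag_eq E x y us vs \<Longrightarrow> zz_class E x us y = zz_class E x vs y"
  unfolding zz_class_def by (auto intro: zigzag_eq.trans zigzag_eq.sym)

lemma zz_class_Ho: "zigzag E x us y \<Longrightarrow> zz_class E x us y \<in> hom (Ho E) x y"
  unfolding hom_def Ho_def by (auto simp: zz_class_def)

lemma Ho_homE:
  assumes "a \<in> hom (Ho E) x y"
  obtains us where "zigzag E x us y" "a = zz_class E x us y"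
  using assms unfolding hom_def Ho_def by (auto simp: zz_class_def)

lemma Ob_Ho [simp]: "Ob (Ho E) = Ob E"
  and Id_Ho: "Id (Ho E) x = zz_class E x [] x"
  by (simp_all add: Ho_def)

lemma comp_Ho:
  assumes us: "zigzag E x us y" and vs: "zigzag E y vs z"
  shows "zz_class E y vs z \<cdot>\<^bsub>Ho E\<^esub> zz_class E x us y = zz_class E x (us @ vs) z"
proof -
  have "zigzag_eq E x z (us' @ vs') ws \<Longrightarrow> zigzag_eq E x z (us @ vs) ws"
    if "zigzag_eq E x y us us'" "zigzag_eq E y z vs vs'" for us' vs' ws
    using zigzag_eq_append[OF that(1) _ vs, of x "[]"] zigzag_eq_append[OF that(2) _ _, of x us' "[]" z]
      zigzag_eq_zigzag[OF that(1)] zigzag_eq_zigzag[OF that(2)] zigzag_Ob[OF us] zigzag_Ob[OF vs]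
    by (auto intro: zigzag_eq.trans)
  moreover have "zigzag_eq E x y us us" "zigzag_eq E y z vs vs" using us vs by (auto intro: zigzag_eq.refl)
  ultimately show ?thesis by (auto simp: Ho_def zz_class_def)
qed

lemma category_Ho: "category (Ho E)"
  unfolding category_def
proof (intro conjI ballI impI)
  have arr: "a \<in> hom (Ho E) (Dom (Ho E) a) (Cod (Ho E) a)" if "a \<in> Ar (Ho E)" for a
    using that by (simp add: hom_def)
  fix a assume a: "a \<in> Ar (Ho E)"
  obtain us where us: "zigzag E (Dom (Ho E) a) us (Cod (Ho E) a)"
    "a = zz_class E (Dom (Ho E) a) us (Cod (Ho E) a)" by (rule Ho_homE[OF arr[OF a]])
  note ob = zigzag_Ob[OF us(1)]
  show "Dom (Ho E) a \<in> Ob (Ho E)" "Cod (Ho E) a \<in> Ob (Ho E)" using ob by simp_all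
  show "a \<cdot>\<^bsub>Ho E\<^esub> Id (Ho E) (Dom (Ho E) a) = a"
    using comp_Ho[OF _ us(1), of "Dom (Ho E) a" "[]"] ob us(2) by (simp add: Id_Ho)
  show "Id (Ho E) (Cod (Ho E) a) \<cdot>\<^bsub>Ho E\<^esub> a = a"
    using comp_Ho[OF us(1), of "[]" "Cod (Ho E) a"] ob us(2) by (simp add: Id_Ho)
  fix b assume b: "b \<in> Ar (Ho E)" "Cod (Ho E) a = Dom (Ho E) b"
  obtain vs where vs: "zigzag E (Cod (Ho E) a) vs (Cod (Ho E) b)"
    "b = zz_class E (Cod (Ho E) a) vs (Cod (Ho E) b)" using Ho_homE[OF arr[OF b(1)]] b(2) by metis
  have ab: "b \<cdot>\<^bsub>Ho E\<^esub> a = zz_class E (Dom (Ho E) a) (us @ vs) (Cod (Ho E) b)"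
    using comp_Ho[OF us(1) vs(1)] us(2) vs(2) by simp
  have z: "zigzag E (Dom (Ho E) a) (us @ vs) (Cod (Ho E) b)" using us vs by (auto simp: zigzag_append)
  show "b \<cdot>\<^bsub>Ho E\<^esub> a \<in> hom (Ho E) (Dom (Ho E) a) (Cod (Ho E) b)"
    using zz_class_Ho[OF z] ab by simp
  fix d assume d: "d \<in> Ar (Ho E)" "Cod (Ho E) b = Dom (Ho E) d"
  obtain ws where ws: "zigzag E (Cod (Ho E) b) ws (Cod (Ho E) d)"
    "d = zz_class E (Cod (Ho E) b) ws (Cod (Ho E) d)" using Ho_homE[OF arr[OF d(1)]] d(2) by metis
  have z': "zigzag E (Cod (Ho E) a) (vs @ ws) (Cod (Ho E) d)" using vs ws by (auto simp: zigzag_append)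
  show "d \<cdot>\<^bsub>Ho E\<^esub> (b \<cdot>\<^bsub>Ho E\<^esub> a) = d \<cdot>\<^bsub>Ho E\<^esub> b \<cdot>\<^bsub>Ho E\<^esub> a"
    using ab comp_Ho[OF z ws(1)] comp_Ho[OF us(1) z'] comp_Ho[OF vs(1) ws(1)] us(2) vs(2) ws(2) by simp
next
  fix x assume "x \<in> Ob (Ho E)"
  then show "Id (Ho E) x \<in> hom (Ho E) x x" using zz_class_Ho[of x "[]" x] by (simp add: Id_Ho)
qed

sublocale Ho: cat_locale "Ho E"
  by unfold_locales (rule category_Ho)

lemma loc_hom: "f \<in> hom E x y \<Longrightarrow> loc E f \<in> hom (Ho E) x y"
  unfolding loc_def using zz_class_Ho[of "Dom E f" "[Fwd f]" "Cod E f"] homD[of f x y] by auto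

lemma loc_functor: "is_functor E (Ho E) (\<lambda>x. x) (loc E)"
  unfolding is_functor_def
proof (intro conjI ballI impI)
  fix f assume f: "f \<in> Ar E"
  then show "loc E f \<in> hom (Ho E) (Dom E f) (Cod E f)" by (rule loc_hom[OF arr_hom])
  fix g assume g: "g \<in> Ar E" "Cod E f = Dom E g"
  have "zigzag_eq E (Dom E f) (Cod E g) ([] @ Fwd f # Fwd g # []) ([] @ Fwd (g \<cdot> f) # [])"
    using f g by (intro zigzag_eq.comp) auto
  then show "loc E (g \<cdot> f) = loc E g \<cdot>\<^bsub>Ho E\<^esub> loc E f"
    using f g comp_Ho[of "Dom E f" "[Fwd f]" "Cod E f" "[Fwd g]" "Cod E g"] zz_class_eqI
    unfolding loc_def by auto
next
  fix x assume x: "x \<in> Ob E"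
  then show "x \<in> Ob (Ho E)" by simp
  have "zigzag_eq E x x ([] @ Fwd (Id E x) # []) ([] @ [])"
    using x by (intro zigzag_eq.ident) auto
  then show "loc E (Id E x) = Id (Ho E) x"
    using x zz_class_eqI unfolding loc_def Id_Ho by auto
qed

definition loc_inverse where "loc_inverse w = zz_class E (Cod E w) [Bwd w] (Dom E w)"

lemma loc_inverse:
  assumes w: "w \<in> Weq E" "w \<in> hom E x y"
  shows "loc_inverse w \<in> hom (Ho E) y x"
    and "loc_inverse w \<cdot>\<^bsub>Ho E\<^esub> loc E w = Id (Ho E) x"
    and "loc E w \<cdot>\<^bsub>Ho E\<^esub> loc_inverse w = Id (Ho E) y"
proof -
  note h = homD[OF w(2)]
  show "loc_inverse w \<in> hom (Ho E) y x"
    unfolding loc_inverse_def using w h zz_class_Ho[of y "[Bwd w]" x] by simp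
  have "zigzag_eq E x x ([] @ Fwd w # Bwd w # []) ([] @ [])" "zigzag_eq E y y ([] @ Bwd w # Fwd w # []) ([] @ [])"
    using w h by (intro zigzag_eq.fwd_bwd zigzag_eq.bwd_fwd; simp)+
  then show "loc_inverse w \<cdot>\<^bsub>Ho E\<^esub> loc E w = Id (Ho E) x" "loc E w \<cdot>\<^bsub>Ho E\<^esub> loc_inverse w = Id (Ho E) y"
    using comp_Ho[of x "[Fwd w]" y "[Bwd w]" x] comp_Ho[of y "[Bwd w]" x "[Fwd w]" y] w h zz_class_eqI
    unfolding loc_def loc_inverse_def Id_Ho by auto
qed

lemma loc_weq_iso: "w \<in> Weq E \<Longrightarrow> is_iso (Ho E) (loc E w)"
  using loc_inverse[of w "Dom E w" "Cod E w"] loc_hom[of w "Dom E w" "Cod E w"] arr_hom weq_arr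
  by (metis is_isoI)

lemma zz_class_Fwd:
  "f \<in> Ar E \<Longrightarrow> zigzag E (Cod E f) us y \<Longrightarrow>
    zz_class E (Dom E f) (Fwd f # us) y = zz_class E (Cod E f) us y \<cdot>\<^bsub>Ho E\<^esub> loc E f"
  using comp_Ho[of "Dom E f" "[Fwd f]" "Cod E f" us y] by (simp add: loc_def)

lemma zz_class_Bwd:
  "w \<in> Weq E \<Longrightarrow> zigzag E (Dom E w) us y \<Longrightarrow>
    zz_class E (Cod E w) (Bwd w # us) y = zz_class E (Dom E w) us y \<cdot>\<^bsub>Ho E\<^esub> loc_inverse w"
  using comp_Ho[of "Cod E w" "[Bwd w]" "Dom E w" us y] weq_arr[of w] by (simp add: loc_inverse_def)

text \<open>The arrows of the homotopy category are composites of images of arrows and of inverses of such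
  images, and naturality passes to composites and inverses.\<close>

lemma natural_on_Ho:
  assumes D: "category D" and F: "is_functor (Ho E) D Fo Fm" and G: "is_functor (Ho E) D Go Gm"
    and t: "nat_trans E D Fo (\<lambda>f. Fm (loc E f)) Go (\<lambda>f. Gm (loc E f)) t"
  shows "nat_trans (Ho E) D Fo Fm Go Gm t"
  unfolding nat_trans_def
proof (intro conjI ballI)
  interpret D: cat_locale D using D by unfold_locales
  have th: "t x \<in> hom D (Fo x) (Go x)" if "x \<in> Ob E" for x using t that by (simp add: nat_trans_def)
  then show "t x \<in> hom D (Fo x) (Go x)" if "x \<in> Ob (Ho E)" for x using that by simp
  have sq: "Gm (loc E f) \<cdot>\<^bsub>D\<^esub> t x = t y \<cdot>\<^bsub>D\<^esub> Fm (loc E f)" if "f \<in> hom E x y" for f x y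
    using t that by (auto simp: nat_trans_def hom_def)
  have "Gm (zz_class E x us y) \<cdot>\<^bsub>D\<^esub> t x = t y \<cdot>\<^bsub>D\<^esub> Fm (zz_class E x us y)" if "zigzag E x us y" for x us y
    using that
  proof (induction rule: zigzag.induct)
    case (nil x)
    then show ?case using functor_id[OF F] functor_id[OF G] D.id_comp[OF th] D.comp_id[OF th] by (simp flip: Id_Ho)
  next
    case (fwd f us y)
    note l = loc_hom[OF arr_hom[OF fwd(1)]] and z = zz_class_Ho[OF fwd(2)]
    show ?case
      using D.square_comp[OF functor_hom[OF F l] functor_hom[OF F z] functor_hom[OF G l] functor_hom[OF G z]
          th th th sq[OF arr_hom[OF fwd(1)]] fwd(3)] fwd zigzag_Ob[OF fwd(2)]
      by (simp add: zz_class_Fwd functor_comp[OF F l z] functor_comp[OF G l z])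
  next
    case (bwd w us y)
    note w = arr_hom[OF weq_arr[OF bwd(1)]]
    note l = loc_hom[OF w] and z = zz_class_Ho[OF bwd(2)] and i = loc_inverse[OF bwd(1) w]
    note ob = homD(4,5)[OF w] and ob' = zigzag_Ob[OF bwd(2)]
    have id: "Fm (loc E w) \<cdot>\<^bsub>D\<^esub> Fm (loc_inverse w) = Id D (Fo (Cod E w))"
      "Gm (loc_inverse w) \<cdot>\<^bsub>D\<^esub> Gm (loc E w) = Id D (Go (Dom E w))"
      using functor_comp[OF F i(1) l] functor_comp[OF G l i(1)] i functor_id[OF F] functor_id[OF G] ob by simp_all
    have "Gm (loc_inverse w) \<cdot>\<^bsub>D\<^esub> t (Cod E w) = t (Dom E w) \<cdot>\<^bsub>D\<^esub> Fm (loc_inverse w)"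
      using D.square_inverse[OF functor_hom[OF F l] functor_hom[OF F i(1)] functor_hom[OF G l]
          functor_hom[OF G i(1)] th[OF ob(1)] th[OF ob(2)] sq[OF w] id] .
    from D.square_comp[OF functor_hom[OF F i(1)] functor_hom[OF F z] functor_hom[OF G i(1)] functor_hom[OF G z]
          th[OF ob(2)] th[OF ob(1)] th this bwd(3)]
    show ?case
      using bwd ob' by (simp add: zz_class_Bwd functor_comp[OF F i(1) z] functor_comp[OF G i(1) z])
  qed
  moreover fix a assume "a \<in> Ar (Ho E)"
  moreover obtain us where "zigzag E (Dom (Ho E) a) us (Cod (Ho E) a)"
    "a = zz_class E (Dom (Ho E) a) us (Cod (Ho E) a)"
    using Ho_homE[OF Ho.arr_hom] calculation(2) by blast
  ultimately show "Gm a \<cdot>\<^bsub>D\<^esub> t (Dom (Ho E) a) = t (Cod (Ho E) a) \<cdot>\<^bsub>D\<^esub> Fm a" by metis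
qed

end

text \<open>The arrow that a zigzag becomes under a functor inverting the weak equivalences; the last argument
  is the source of the zigzag, which the empty word does not record.\<close>

primrec zigzag_value ::
  "('o, 'm, 'z) cat_scheme \<Rightarrow> ('p, 'n, 'w) cat_scheme \<Rightarrow> ('o \<Rightarrow> 'p) \<Rightarrow> ('m \<Rightarrow> 'n) \<Rightarrow> 'm letter list \<Rightarrow> 'o \<Rightarrow> 'n"
where
  "zigzag_value E D Fo Fm [] x = Id D (Fo x)"
| "zigzag_value E D Fo Fm (l # us) x = (case l of
     Fwd f \<Rightarrow> zigzag_value E D Fo Fm us (Cod E f) \<cdot>\<^bsub>D\<^esub> Fm f
   | Bwd w \<Rightarrow> zigzag_value E D Fo Fm us (Dom E w) \<cdot>\<^bsub>D\<^esub> inverse_arrow D (Fm w))"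

locale inverting_functor = pointed_model + D: cat_locale D
  for D +
  fixes Fo Fm
  assumes F_functor: "is_functor E D Fo Fm"
    and inverts: "w \<in> Weq E \<Longrightarrow> is_iso D (Fm w)"
begin

abbreviation "val \<equiv> zigzag_value E D Fo Fm"

lemma inv_hom:
  assumes "w \<in> Weq E"
  shows "inverse_arrow D (Fm w) \<in> hom D (Fo (Cod E w)) (Fo (Dom E w))"
    and "inverse_arrow D (Fm w) \<cdot>\<^bsub>D\<^esub> Fm w = Id D (Fo (Dom E w))"
    and "Fm w \<cdot>\<^bsub>D\<^esub> inverse_arrow D (Fm w) = Id D (Fo (Cod E w))"
  using inverse_arrow[OF inverts[OF assms] functor_hom[OF F_functor arr_hom[OF weq_arr[OF assms]]]] .

lemma Fo_Ob: "x \<in> Ob E \<Longrightarrow> Fo x \<in> Ob D"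
  using F_functor by (simp add: is_functor_def)

lemma val_hom: "zigzag E x us y \<Longrightarrow> val us x \<in> hom D (Fo x) (Fo y)"
proof (induction rule: zigzag.induct)
  case (nil x)
  then show ?case using Fo_Ob by simp
next
  case (fwd f us y)
  then show ?case using D.comp_hom[OF functor_hom[OF F_functor arr_hom[OF fwd(1)]] fwd(3)] by simp
next
  case (bwd w us y)
  then show ?case using D.comp_hom[OF inv_hom(1)[OF bwd(1)] bwd(3)] by simp
qed

lemma val_append:
  "zigzag E x us y \<Longrightarrow> zigzag E y vs z \<Longrightarrow> val (us @ vs) x = val vs y \<cdot>\<^bsub>D\<^esub> val us x"
proof (induction rule: zigzag.induct)
  case (nil x)
  then show ?case using D.comp_id[OF val_hom[OF nil(2)]] by simp
next
  case (fwd f us y)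
  then show ?case
    using D.assoc[OF functor_hom[OF F_functor arr_hom[OF fwd(1)]] val_hom[OF fwd(2)] val_hom[OF fwd(4)]] by simp
next
  case (bwd w us y)
  then show ?case
    using D.assoc[OF inv_hom(1)[OF bwd(1)] val_hom[OF bwd(2)] val_hom[OF bwd(4)]] by simp
qed

text \<open>Each relation between zigzags rewrites a short word \<open>ms\<close> in the middle of a longer one, so it is
  enough to compare values of these short words.\<close>

lemma val_replace:
  assumes "zigzag E x (us @ ms @ vs) y"
    and r: "\<And>a b. zigzag E a ms b \<Longrightarrow> zigzag E a ns b \<and> val ms a = val ns a"
  shows "val (us @ ms @ vs) x = val (us @ ns @ vs) x"
proof -
  obtain a b where a: "zigzag E x us a" "zigzag E a ms b" "zigzag E b vs y"
    using assms(1) by (auto simp: zigzag_append)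
  note n = conjunct1[OF r[OF a(2)]]
  have "zigzag E a (ms @ vs) y" "zigzag E a (ns @ vs) y" using a n by (auto simp: zigzag_append)
  then show ?thesis
    using val_append[OF a(1)] val_append[OF a(2,3)] val_append[OF n a(3)] r[OF a(2)] by metis
qed

lemma val_zigzag_eq: "zigzag_eq E x y us vs \<Longrightarrow> val us x = val vs x"
proof (induction rule: zigzag_eq.induct)
  case (ident a us vs)
  have "val (us @ [Fwd (Id E a)] @ vs) x = val (us @ [] @ vs) x"
    using ident functor_id[OF F_functor ident(1)] D.comp_id[OF D.id_hom[OF Fo_Ob]]
    by (intro val_replace[of _ _ _ _ y]) auto
  then show ?case by simp
next
  case (comp us f g vs)
  have "val (us @ [Fwd f, Fwd g] @ vs) x = val (us @ [Fwd (g \<cdot>\<^bsub>E\<^esub> f)] @ vs) x"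
  proof (rule val_replace[of _ _ _ _ y])
    fix a b assume "zigzag E a [Fwd f, Fwd g] b"
    then have fg: "f \<in> hom E a (Cod E f)" "g \<in> hom E (Cod E f) b" by (auto simp: hom_def)
    have h: "g \<cdot>\<^bsub>E\<^esub> f \<in> hom E a b" using fg by (rule comp_hom)
    have Fg: "Fm g \<in> hom D (Fo (Cod E f)) (Fo b)" "Fm f \<in> hom D (Fo a) (Fo (Cod E f))"
      using functor_hom[OF F_functor] fg by auto
    show "zigzag E a [Fwd (g \<cdot>\<^bsub>E\<^esub> f)] b \<and> val [Fwd f, Fwd g] a = val [Fwd (g \<cdot>\<^bsub>E\<^esub> f)] a"
      using homD[OF h] homD[OF fg(2)] functor_comp[OF F_functor fg] D.id_comp[OF Fg(1)] D.id_comp[OF D.comp_hom[OF Fg(2,1)]]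
      by simp
  qed (use comp in simp)
  then show ?case by simp
next
  case (fwd_bwd us w vs)
  have "val (us @ [Fwd w, Bwd w] @ vs) x = val (us @ [] @ vs) x"
    using fwd_bwd inv_hom[of w] D.id_comp weq_arr by (intro val_replace[of _ _ _ _ y]) auto
  then show ?case by simp
next
  case (bwd_fwd us w vs)
  have "val (us @ [Bwd w, Fwd w] @ vs) x = val (us @ [] @ vs) x"
    using bwd_fwd inv_hom[of w] D.id_comp[OF functor_hom[OF F_functor arr_hom[OF weq_arr]]] weq_arr
    by (intro val_replace[of _ _ _ _ y]) auto
  then show ?case by simp
qed auto

lemma extends_to_Ho:
  obtains Gm where "is_functor (Ho E) D Fo Gm" "\<forall>f\<in>Ar E. Gm (loc E f) = Fm f"
proof -
  define Gm where "Gm = (\<lambda>(x, U, y::'a). val (SOME us. us \<in> U) x)"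
  have G: "Gm (zz_class E x us y) = val us x" if "zigzag E x us y" for x us y
  proof -
    have "zigzag_eq E x y us us" using that by (rule zigzag_eq.refl)
    then have "zigzag_eq E x y us (SOME vs. zigzag_eq E x y us vs)" by (rule someI)
    then show ?thesis using val_zigzag_eq by (simp add: Gm_def zz_class_def)
  qed
  have "is_functor (Ho E) D Fo Gm"
    unfolding is_functor_def
  proof (intro conjI ballI impI)
    fix x assume "x \<in> Ob (Ho E)"
    then show "Fo x \<in> Ob D" "Gm (Id (Ho E) x) = Id D (Fo x)"
      using Fo_Ob G[of x "[]" x] by (simp_all add: Id_Ho)
  next
    fix a assume a: "a \<in> Ar (Ho E)"
    obtain us where us: "zigzag E (Dom (Ho E) a) us (Cod (Ho E) a)"
      "a = zz_class E (Dom (Ho E) a) us (Cod (Ho E) a)" by (rule Ho_homE[OF Ho.arr_hom[OF a]])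
    show "Gm a \<in> hom D (Fo (Dom (Ho E) a)) (Fo (Cod (Ho E) a))"
      using G[OF us(1)] us(2) val_hom[OF us(1)] by simp
    fix b assume b: "b \<in> Ar (Ho E)" "Cod (Ho E) a = Dom (Ho E) b"
    obtain vs where vs: "zigzag E (Cod (Ho E) a) vs (Cod (Ho E) b)"
      "b = zz_class E (Cod (Ho E) a) vs (Cod (Ho E) b)" using Ho_homE[OF Ho.arr_hom[OF b(1)]] b(2) by metis
    have z: "zigzag E (Dom (Ho E) a) (us @ vs) (Cod (Ho E) b)" using us vs by (auto simp: zigzag_append)
    show "Gm (b \<cdot>\<^bsub>Ho E\<^esub> a) = Gm b \<cdot>\<^bsub>D\<^esub> Gm a"
      using comp_Ho[OF us(1) vs(1)] us(2) vs(2) G[OF us(1)] G[OF vs(1)] G[OF z] val_append[OF us(1) vs(1)] by simp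
  qed
  moreover have "Gm (loc E f) = Fm f" if f: "f \<in> Ar E" for f
    using G[of "Dom E f" "[Fwd f]" "Cod E f"] f D.id_comp[OF functor_hom[OF F_functor arr_hom[OF f]]]
    by (simp add: loc_def)
  ultimately show thesis using that by blast
qed

lemma iso_of_loc_iso:
  assumes "f \<in> Ar E" "is_iso (Ho E) (loc E f)"
  shows "is_iso D (Fm f)"
proof -
  obtain Gm where G: "is_functor (Ho E) D Fo Gm" "\<forall>f\<in>Ar E. Gm (loc E f) = Fm f"
    by (rule extends_to_Ho)
  show ?thesis
    using functor_iso[OF G(1) assms(2) loc_hom[OF arr_hom[OF assms(1)]]] G(2) assms(1) by simp
qed

end

section \<open>Saturated relations\<close>

text \<open>A partial equivalence relation stands for the set of its classes, and a relation saturated on both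
  sides for a relation between classes. A category with these as arrows is as good a target for a
  functor as the category of sets: isomorphisms are bijections between classes, no representatives
  need to be chosen, and composition is relational composition, which is strictly associative.\<close>

definition per_category :: "('a rel, 'a rel \<times> 'a rel \<times> 'a rel) cat" where
  "per_category = \<lparr>
     Ob = {r. sym r \<and> trans r},
     Ar = {(r, \<phi>, s). sym r \<and> trans r \<and> sym s \<and> trans s \<and> r O \<phi> = \<phi> \<and> \<phi> O s = \<phi>},
     Dom = (\<lambda>(r, \<phi>, s). r),
     Cod = (\<lambda>(r, \<phi>, s). s),
     Id = (\<lambda>r. (r, r, r)),
     Comp = (\<lambda>(s', \<psi>, t) (r, \<phi>, s). (r, \<phi> O \<psi>, t)) \<rparr>"

lemma per_idem: "sym r \<Longrightarrow> trans r \<Longrightarrow> r O r = r"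
  by (auto elim: symE transE)

lemma per_category: "category per_category"
proof -
  have "r O (\<phi> O \<psi>) = \<phi> O \<psi>" "(\<phi> O \<psi>) O t = \<phi> O \<psi>" if "r O \<phi> = \<phi>" "\<psi> O t = \<psi>" for r \<phi> \<psi> t :: "'a rel"
    using that by (metis O_assoc)+
  then show ?thesis
    by (auto simp: category_def per_category_def hom_def per_idem O_assoc)
qed

lemma per_isoI:
  assumes a: "(r, \<phi>, s) \<in> Ar per_category"
    and "\<And>x. (x, x) \<in> r \<Longrightarrow> \<exists>y. (x, y) \<in> \<phi>" "\<And>y. (y, y) \<in> s \<Longrightarrow> \<exists>x. (x, y) \<in> \<phi>"
    and "\<And>x y y'. (x, y) \<in> \<phi> \<Longrightarrow> (x, y') \<in> \<phi> \<Longrightarrow> (y, y') \<in> s"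
    and "\<And>x x' y. (x, y) \<in> \<phi> \<Longrightarrow> (x', y) \<in> \<phi> \<Longrightarrow> (x, x') \<in> r"
  shows "is_iso per_category (r, \<phi>, s)"
proof (rule is_isoI[of _ _ r s "(s, \<phi>\<inverse>, r)"])
  have p: "sym r" "trans r" "sym s" "trans s" "r O \<phi> = \<phi>" "\<phi> O s = \<phi>"
    using a by (auto simp: per_category_def)
  show "(r, \<phi>, s) \<in> hom per_category r s" using p by (auto simp: hom_def per_category_def)
  have "s O \<phi>\<inverse> = \<phi>\<inverse>" "\<phi>\<inverse> O r = \<phi>\<inverse>"
    using p by (metis converse_relcomp sym_conv_converse_eq)+
  then show "(s, \<phi>\<inverse>, r) \<in> hom per_category s r" using p by (auto simp: hom_def per_category_def)
  have "(x, x') \<in> \<phi> O \<phi>\<inverse>" if "(x, x') \<in> r" for x x'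
  proof -
    have "(x, x) \<in> r" "(x', x) \<in> r" using that p by (auto dest: symD transD)
    then obtain y where y: "(x, y) \<in> \<phi>" using assms(2) by blast
    with \<open>(x', x) \<in> r\<close> have "(x', y) \<in> \<phi>" using p(5) by blast
    with y show ?thesis by blast
  qed
  then show "(s, \<phi>\<inverse>, r) \<cdot>\<^bsub>per_category\<^esub> (r, \<phi>, s) = Id per_category r"
    using assms(5) by (auto simp: per_category_def)
  have "(y, y') \<in> \<phi>\<inverse> O \<phi>" if "(y, y') \<in> s" for y y'
  proof -
    have "(y, y) \<in> s" using that p by (auto dest: symD transD)
    then obtain x where x: "(x, y) \<in> \<phi>" using assms(3) by blast
    with that have "(x, y') \<in> \<phi>" using p(6) by blast
    with x show ?thesis by blast
  qed
  then show "(r, \<phi>, s) \<cdot>\<^bsub>per_category\<^esub> (s, \<phi>\<inverse>, r) = Id per_category s"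
    using assms(4) by (auto simp: per_category_def)
qed

lemma per_isoD:
  assumes "is_iso per_category (r, \<phi>, s)"
  shows "(y, y) \<in> s \<Longrightarrow> \<exists>x. (x, y) \<in> \<phi>" and "(x, y) \<in> \<phi> \<Longrightarrow> (x', y) \<in> \<phi> \<Longrightarrow> (x, x') \<in> r"
proof -
  obtain \<psi> where p: "sym r" "trans r" "sym s" "trans s" "r O \<phi> = \<phi>" "\<phi> O s = \<phi>" "s O \<psi> = \<psi>" "\<psi> O r = \<psi>"
    and inv: "\<phi> O \<psi> = r" "\<psi> O \<phi> = s"
    using assms by (auto simp: is_iso_def per_category_def hom_def)
  show "(y, y) \<in> s \<Longrightarrow> \<exists>x. (x, y) \<in> \<phi>" using inv(2) by blast
  assume xy: "(x, y) \<in> \<phi>" "(x', y) \<in> \<phi>"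
  obtain z where "(x, z) \<in> r" using xy(1) p(5) by blast
  then have "(x, x) \<in> r" using p(1,2) by (meson symD transD)
  then obtain y' where y': "(x, y') \<in> \<phi>" "(y', x) \<in> \<psi>" using inv(1) by blast
  have "(y', y) \<in> s" using y'(2) xy(1) inv(2) by blast
  then have "(y, x) \<in> s O \<psi>" using y'(2) symD[OF p(3)] by blast
  then have "(y, x) \<in> \<psi>" using p(7) by simp
  then have "(x', x) \<in> r" using xy(2) inv(1) by blast
  then show "(x, x') \<in> r" using p(1) by (rule symD[rotated])
qed

section \<open>Homotopy classes of maps\<close>

context pointed_model
begin

definition cofibrant :: "'o \<Rightarrow> bool" where
  "cofibrant A \<longleftrightarrow> (\<exists>z\<in>hom E pt A. z \<in> Cofib E)"

definition fibrant :: "'o \<Rightarrow> bool" where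
  "fibrant X \<longleftrightarrow> (\<exists>e\<in>hom E X pt. e \<in> Fibr E)"

text \<open>The last clause is all that is needed of the fact that \<open>A \<squnion> A \<rightarrow> C\<close> is a cofibration over
  a weak equivalence \<open>C \<rightarrow> A\<close>. In this form it mentions neither the coproduct nor the projection.\<close>

definition cylinder :: "'o \<Rightarrow> 'o \<Rightarrow> 'm \<Rightarrow> 'm \<Rightarrow> bool" where
  "cylinder A C i j \<longleftrightarrow> i \<in> hom E A C \<and> j \<in> hom E A C \<and>
     i \<in> Cofib E \<and> i \<in> Weq E \<and> j \<in> Cofib E \<and> j \<in> Weq E \<and>
     (\<forall>p X Y a b. p \<in> Fibr E \<longrightarrow> p \<in> Weq E \<longrightarrow> p \<in> hom E X Y \<longrightarrow> a \<in> hom E A X \<longrightarrow> b \<in> hom E A X \<longrightarrow>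
        p \<cdot> a = p \<cdot> b \<longrightarrow> (\<exists>H\<in>hom E C X. H \<cdot> i = a \<and> H \<cdot> j = b))"

lemma cylinder_sym: "cylinder A C i j \<Longrightarrow> cylinder A C j i"
  unfolding cylinder_def by (metis (no_types, lifting))

text \<open>Factor the fold map \<open>A \<squnion> A \<rightarrow> A\<close> into a cofibration and an acyclic fibration \<open>s\<close>. If \<open>p\<close> identifies
  \<open>a\<close> and \<open>b\<close>, a homotopy from \<open>a\<close> to \<open>b\<close> is found by lifting \<open>p \<cdot> a \<cdot> s\<close> through \<open>p\<close>.\<close>

lemma cylinder_exists:
  assumes "cofibrant A"
  obtains C i j where "cylinder A C i j"
proof -
  obtain z where z: "z \<in> hom E pt A" "z \<in> Cofib E" using assms by (auto simp: cofibrant_def)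
  have A: "A \<in> Ob E" using homD[OF z(1)] by simp
  obtain i0 i1 P where P: "is_pushout E z z i0 i1" "i0 \<in> hom E A P" "i1 \<in> hom E A P"
    by (rule pushout_exists[OF z(1) z(1)])
  have c: "i0 \<in> Cofib E" "i1 \<in> Cofib E"
    using pushout_cofib[OF P(1) z(2)] pushout_cofib[OF pushout_sym[OF P(1)] z(2)] by auto
  obtain d where d: "d \<in> hom E P A" "d \<cdot> i0 = Id E A" "d \<cdot> i1 = Id E A"
    by (rule pushout_induce[OF P id_hom[OF A] id_hom[OF A] HOL.refl])
  obtain C k s where f: "k \<in> hom E P C" "s \<in> hom E C A" "k \<in> Cofib E" "s \<in> Fibr E" "s \<in> Weq E" "s \<cdot> k = d"
    by (rule factor_acyclic_fibration[OF d(1)])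
  have h: "k \<cdot> i0 \<in> hom E A C" "k \<cdot> i1 \<in> hom E A C" using P f by auto
  have s: "s \<cdot> (k \<cdot> i0) = Id E A" "s \<cdot> (k \<cdot> i1) = Id E A"
    using assoc[OF P(2) f(1,2)] assoc[OF P(3) f(1,2)] d f(6) by auto
  have w: "k \<cdot> i0 \<in> Weq E" "k \<cdot> i1 \<in> Weq E"
    using weq_cancel_left[OF h(1) f(2,5)] weq_cancel_left[OF h(2) f(2,5)] s A by auto
  have "\<exists>H\<in>hom E C X. H \<cdot> (k \<cdot> i0) = a \<and> H \<cdot> (k \<cdot> i1) = b"
    if p: "p \<in> Fibr E" "p \<in> Weq E" "p \<in> hom E X Y" and a: "a \<in> hom E A X" "b \<in> hom E A X" "p \<cdot> a = p \<cdot> b"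
    for p X Y a b
  proof -
    have "a \<cdot> z = b \<cdot> z"
      using from_pt_eq[OF comp_hom[OF z(1) a(1)] comp_hom[OF z(1) a(2)]] .
    then obtain u where u: "u \<in> hom E P X" "u \<cdot> i0 = a" "u \<cdot> i1 = b"
      by (rule pushout_induce[OF P a(1,2)])
    have pas: "p \<cdot> a \<cdot> s \<in> hom E C Y" using comp_hom[OF f(2) comp_hom[OF a(1) p(3)]] .
    have "p \<cdot> u = p \<cdot> a \<cdot> s \<cdot> k"
    proof (rule pushout_eqI[OF P comp_hom[OF u(1) p(3)] comp_hom[OF f(1) pas]])
      have "p \<cdot> a \<cdot> s \<cdot> k \<cdot> i = p \<cdot> a" if "i \<in> hom E A P" "s \<cdot> (k \<cdot> i) = Id E A" for i
        using assoc[OF that(1) f(1) pas] assoc[OF comp_hom[OF that(1) f(1)] f(2) comp_hom[OF a(1) p(3)]]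
          that(2) comp_id[OF comp_hom[OF a(1) p(3)]] by simp
      then show "p \<cdot> u \<cdot> i0 = p \<cdot> a \<cdot> s \<cdot> k \<cdot> i0" "p \<cdot> u \<cdot> i1 = p \<cdot> a \<cdot> s \<cdot> k \<cdot> i1"
        using s P u a(3) assoc[OF P(2) u(1) p(3)] assoc[OF P(3) u(1) p(3)] by simp_all
    qed
    then obtain H where H: "H \<in> hom E C X" "H \<cdot> k = u"
      using lift[OF f(3) p(1) _ f(1) p(3) u(1) pas] p(2) by metis
    have "H \<cdot> (k \<cdot> i0) = a" "H \<cdot> (k \<cdot> i1) = b"
      using assoc[OF P(2) f(1) H(1)] assoc[OF P(3) f(1) H(1)] H(2) u by auto
    with H(1) show ?thesis by auto
  qed
  then have "cylinder A C (k \<cdot> i0) (k \<cdot> i1)"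
    unfolding cylinder_def using h w cofib_comp[OF P(2) f(1) c(1) f(3)] cofib_comp[OF P(3) f(1) c(2) f(3)]
    by blast
  then show thesis by (rule that)
qed

text \<open>Left homotopy. The cylinder may vary, and the transitive closure in \<open>htp\<close> takes the place of
  gluing cylinders.\<close>

definition htp1 :: "'o \<Rightarrow> 'o \<Rightarrow> 'm rel" where
  "htp1 A X = {(H \<cdot> i, H \<cdot> j) | H i j C. cylinder A C i j \<and> H \<in> hom E C X}"

definition htp :: "'o \<Rightarrow> 'o \<Rightarrow> 'm rel" where
  "htp A X = (htp1 A X)\<^sup>+"

lemma htp1_hom: "(a, b) \<in> htp1 A X \<Longrightarrow> a \<in> hom E A X \<and> b \<in> hom E A X"
  unfolding htp1_def cylinder_def by (auto intro: comp_hom)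

lemma htp_hom: "(a, b) \<in> htp A X \<Longrightarrow> a \<in> hom E A X \<and> b \<in> hom E A X"
  unfolding htp_def by (induction rule: trancl_induct) (auto dest: htp1_hom)

lemma sym_htp: "sym (htp A X)"
  unfolding htp_def 
proof (rule sym_trancl)
  show "sym (htp1 A X)" using cylinder_sym unfolding sym_def htp1_def by blast
qed

lemma trans_htp: "trans (htp A X)"
  unfolding htp_def by (rule trans_trancl)

lemmas htp_sym = symD[OF sym_htp] and htp_trans = transD[OF trans_htp]

lemma htp_of_equal_image:
  assumes A: "cofibrant A" and p: "p \<in> Fibr E" "p \<in> Weq E" "p \<in> hom E X Y"
    and a: "a \<in> hom E A X" "b \<in> hom E A X" "p \<cdot> a = p \<cdot> b"
  shows "(a, b) \<in> htp A X"
proof -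
  obtain C i j where c: "cylinder A C i j" by (rule cylinder_exists[OF A])
  then obtain H where "H \<in> hom E C X" "H \<cdot> i = a" "H \<cdot> j = b"
    using p a unfolding cylinder_def by blast
  then have "(a, b) \<in> htp1 A X" using c unfolding htp1_def by blast
  then show ?thesis unfolding htp_def by blast
qed

lemma htp_refl: "cofibrant A \<Longrightarrow> a \<in> hom E A X \<Longrightarrow> (a, a) \<in> htp A X"
  using htp_of_equal_image[of A "Id E X" X X a a] homD[of a A X] by simp

lemma htp_comp:
  assumes "(a, b) \<in> htp A X" "f \<in> hom E X Y"
  shows "(f \<cdot> a, f \<cdot> b) \<in> htp A Y"
proof -
  have "(f \<cdot> a, f \<cdot> b) \<in> htp1 A Y" if ab: "(a, b) \<in> htp1 A X" for a b
  proof -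
    obtain H i j C where H: "cylinder A C i j" "H \<in> hom E C X" "a = H \<cdot> i" "b = H \<cdot> j"
      using ab by (auto simp: htp1_def)
    have ij: "i \<in> hom E A C" "j \<in> hom E A C" using H(1) by (auto simp: cylinder_def)
    have "f \<cdot> a = f \<cdot> H \<cdot> i" "f \<cdot> b = f \<cdot> H \<cdot> j"
      using assoc[OF ij(1) H(2) assms(2)] assoc[OF ij(2) H(2) assms(2)] H by auto
    then show ?thesis using H(1) comp_hom[OF H(2) assms(2)] unfolding htp1_def by blast
  qed
  with assms(1) show ?thesis
    unfolding htp_def by (induction rule: trancl_induct) (auto intro: trancl_into_trancl)
qed

lemma htp_weq_iff:
  assumes "(a, b) \<in> htp A X"
  shows "a \<in> Weq E \<longleftrightarrow> b \<in> Weq E"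
proof -
  have "a \<in> Weq E \<longleftrightarrow> b \<in> Weq E" if ab: "(a, b) \<in> htp1 A X" for a b
  proof -
    obtain H i j C where H: "cylinder A C i j" "H \<in> hom E C X" "a = H \<cdot> i" "b = H \<cdot> j"
      using ab by (auto simp: htp1_def)
    then show ?thesis
      using weq_comp_iff_left[of i A C H X] weq_comp_iff_left[of j A C H X] unfolding cylinder_def by simp
  qed
  with assms show ?thesis
    unfolding htp_def by (induction rule: trancl_induct) auto
qed

text \<open>One end of a cylinder is an acyclic cofibration, so homotopies lift along fibrations, one
  elementary step after another.\<close>

lemma htp_lift:
  assumes p: "p \<in> Fibr E" "p \<in> hom E X Y" and "(p \<cdot> a, d) \<in> htp A Y" "a \<in> hom E A X"
  obtains b where "b \<in> hom E A X" "p \<cdot> b = d" "(a, b) \<in> htp A X"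
proof -
  have step: "\<exists>b\<in>hom E A X. p \<cdot> b = d \<and> (a, b) \<in> htp1 A X"
    if ad: "(p \<cdot> a, d) \<in> htp1 A Y" "a \<in> hom E A X" for a d
  proof -
    obtain H i j C where H: "cylinder A C i j" "H \<in> hom E C Y" "p \<cdot> a = H \<cdot> i" "d = H \<cdot> j"
      using ad by (auto simp: htp1_def)
    have ij: "i \<in> hom E A C" "j \<in> hom E A C" "i \<in> Cofib E" "i \<in> Weq E" using H(1) by (auto simp: cylinder_def)
    obtain G where G: "G \<in> hom E C X" "G \<cdot> i = a" "p \<cdot> G = H"
      using lift[OF ij(3) p(1) _ ij(1) p(2) ad(2) H(2,3)] ij(4) by blast
    have "p \<cdot> (G \<cdot> j) = d" using assoc[OF ij(2) G(1) p(2)] G(3) H(4) by simp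
    moreover have "(a, G \<cdot> j) \<in> htp1 A X" using G(1,2) H(1) unfolding htp1_def by blast
    ultimately show ?thesis using htp1_hom by blast
  qed
  have "\<exists>b\<in>hom E A X. p \<cdot> b = d \<and> (a, b) \<in> htp A X"
    using assms(3) unfolding htp_def
  proof (induction rule: trancl_induct)
    case (base d)
    then show ?case using step[OF base assms(4)] by blast
  next
    case (step d e)
    then obtain b where b: "b \<in> hom E A X" "p \<cdot> b = d" "(a, b) \<in> (htp1 A X)\<^sup>+" by blast
    obtain b' where "b' \<in> hom E A X" "p \<cdot> b' = e" "(b, b') \<in> htp1 A X"
      using \<open>\<And>a d. (p \<cdot> a, d) \<in> htp1 A Y \<Longrightarrow> a \<in> hom E A X \<Longrightarrow> \<exists>b\<in>hom E A X. p \<cdot> b = d \<and> (a, b) \<in> htp1 A X\<close>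
        step(2) b by blast
    with trancl_into_trancl[OF b(3)] show ?case by blast
  qed
  then show thesis using that by blast
qed

lemma acyclic_fibration_htp_inj:
  assumes A: "cofibrant A" and p: "p \<in> Fibr E" "p \<in> Weq E" "p \<in> hom E X Y"
    and a: "a \<in> hom E A X" "b \<in> hom E A X" "(p \<cdot> a, p \<cdot> b) \<in> htp A Y"
  shows "(a, b) \<in> htp A X"
proof -
  obtain b' where b': "b' \<in> hom E A X" "p \<cdot> b' = p \<cdot> b" "(a, b') \<in> htp A X"
    by (rule htp_lift[OF p(1,3) a(3,1)])
  then show ?thesis using htp_of_equal_image[OF A p b'(1) a(2) b'(2)] htp_trans by blast
qed

lemma acyclic_fibration_surj:
  assumes A: "cofibrant A" and p: "p \<in> Fibr E" "p \<in> Weq E" "p \<in> hom E X Y" and d: "d \<in> hom E A Y"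
  obtains a where "a \<in> hom E A X" "p \<cdot> a = d"
proof -
  obtain z where z: "z \<in> hom E pt A" "z \<in> Cofib E" using A by (auto simp: cofibrant_def)
  obtain x where x: "x \<in> hom E pt X" using from_pt homD[OF p(3)] by blast
  have "p \<cdot> x = d \<cdot> z" by (rule from_pt_eq[OF comp_hom[OF x p(3)] comp_hom[OF z(1) d]])
  then show thesis using lift[OF z(2) p(1) _ z(1) p(3) x d] p(2) that by metis
qed

lemma fibrant_extend:
  assumes "fibrant X" "i \<in> Cofib E" "i \<in> Weq E" "i \<in> hom E A B" "a \<in> hom E A X"
  obtains b where "b \<in> hom E B X" "b \<cdot> i = a"
proof -
  obtain e where e: "e \<in> hom E X pt" "e \<in> Fibr E" using assms(1) by (auto simp: fibrant_def)
  obtain t where t: "t \<in> hom E B pt" using to_pt homD[OF assms(4)] by blast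
  have "e \<cdot> a = t \<cdot> i" by (rule to_pt_eq[OF comp_hom[OF assms(5) e(1)] comp_hom[OF assms(4) t]])
  then show thesis using lift[OF assms(2) e(2) _ assms(4) e(1) assms(5) t] assms(3) that by metis
qed

text \<open>Factor the fold map of \<open>X' \<union>\<^sub>X X'\<close> as a cofibration \<open>k\<close> followed by an acyclic fibration \<open>s\<close>. Since
  \<open>r\<close> is an acyclic cofibration, so are its cobase changes and hence \<open>k\<close>; as \<open>Y\<close> is fibrant, the map
  given by \<open>u\<close> and \<open>v\<close> extends along \<open>k\<close> to a map \<open>H\<close>. Before applying \<open>H\<close>, the two maps on \<open>A\<close> are
  identified by \<open>s\<close>, hence homotopic.\<close>

lemma htp_of_equal_restriction:
  assumes A: "cofibrant A" and Y: "fibrant Y" and r: "r \<in> Cofib E" "r \<in> Weq E" "r \<in> hom E X X'"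
    and u: "u \<in> hom E X' Y" "v \<in> hom E X' Y" "u \<cdot> r = v \<cdot> r" and a: "a \<in> hom E A X'"
  shows "(u \<cdot> a, v \<cdot> a) \<in> htp A Y"
proof -
  have X': "X' \<in> Ob E" using homD[OF r(3)] by simp
  obtain i0 i1 P where P: "is_pushout E r r i0 i1" "i0 \<in> hom E X' P" "i1 \<in> hom E X' P"
    by (rule pushout_exists[OF r(3) r(3)])
  have i0w: "i0 \<in> Weq E" by (rule pushout_acyclic_cofib(2)[OF pushout_sym[OF P(1)] r(1,2)])
  obtain d where d: "d \<in> hom E P X'" "d \<cdot> i0 = Id E X'" "d \<cdot> i1 = Id E X'"
    by (rule pushout_induce[OF P id_hom[OF X'] id_hom[OF X'] HOL.refl])
  obtain C k s where f: "k \<in> hom E P C" "s \<in> hom E C X'" "k \<in> Cofib E" "s \<in> Fibr E" "s \<in> Weq E" "s \<cdot> k = d"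
    by (rule factor_acyclic_fibration[OF d(1)])
  have h: "k \<cdot> i0 \<in> hom E X' C" "k \<cdot> i1 \<in> hom E X' C" using P f by auto
  have s: "s \<cdot> (k \<cdot> i0) = Id E X'" "s \<cdot> (k \<cdot> i1) = Id E X'"
    using assoc[OF P(2) f(1,2)] assoc[OF P(3) f(1,2)] d f(6) by auto
  have "k \<cdot> i0 \<in> Weq E" using weq_cancel_left[OF h(1) f(2,5)] s X' by simp
  then have kw: "k \<in> Weq E" by (rule weq_cancel_right[OF P(2) f(1) i0w])
  obtain w where w: "w \<in> hom E P Y" "w \<cdot> i0 = u" "w \<cdot> i1 = v"
    by (rule pushout_induce[OF P u])
  obtain H where H: "H \<in> hom E C Y" "H \<cdot> k = w"
    by (rule fibrant_extend[OF Y f(3) kw f(1) w(1)])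
  have "s \<cdot> (k \<cdot> i0 \<cdot> a) = s \<cdot> (k \<cdot> i1 \<cdot> a)"
    using assoc[OF a h(1) f(2)] assoc[OF a h(2) f(2)] s by simp
  then have "(k \<cdot> i0 \<cdot> a, k \<cdot> i1 \<cdot> a) \<in> htp A C"
    by (rule htp_of_equal_image[OF A f(4,5,2) comp_hom[OF a h(1)] comp_hom[OF a h(2)]])
  then have "(H \<cdot> (k \<cdot> i0 \<cdot> a), H \<cdot> (k \<cdot> i1 \<cdot> a)) \<in> htp A Y" by (rule htp_comp[OF _ H(1)])
  moreover have "H \<cdot> (k \<cdot> i0 \<cdot> a) = u \<cdot> a" "H \<cdot> (k \<cdot> i1 \<cdot> a) = v \<cdot> a"
    using assoc[OF a h(1) H(1)] assoc[OF a h(2) H(1)] assoc[OF P(2) f(1) H(1)] assoc[OF P(3) f(1) H(1)] H w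
    by simp_all
  ultimately show ?thesis by simp
qed

text \<open>An acyclic fibration induces a bijection on homotopy classes by lifting. An acyclic cofibration \<open>j\<close>
  between fibrant objects has a retraction \<open>\<rho>\<close>, and \<open>j \<cdot> \<rho>\<close> agrees with the identity on the image of
  \<open>j\<close>, hence acts on homotopy classes as the identity. In general, factor \<open>w\<close>.\<close>

lemma weq_htp_bijective:
  assumes A: "cofibrant A" and XY: "fibrant X" "fibrant Y" and w: "w \<in> Weq E" "w \<in> hom E X Y"
  shows "a \<in> hom E A X \<Longrightarrow> b \<in> hom E A X \<Longrightarrow> (w \<cdot> a, w \<cdot> b) \<in> htp A Y \<Longrightarrow> (a, b) \<in> htp A X"
    and "d \<in> hom E A Y \<Longrightarrow> \<exists>a\<in>hom E A X. (w \<cdot> a, d) \<in> htp A Y"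
proof -
  have X: "X \<in> Ob E" using homD[OF w(2)] by simp
  obtain W j q where f: "j \<in> hom E X W" "q \<in> hom E W Y" "j \<in> Cofib E" "j \<in> Weq E" "q \<in> Fibr E" "q \<cdot> j = w"
    by (rule factor_acyclic_cofibration[OF w(2)])
  have W: "W \<in> Ob E" using homD[OF f(1)] by simp
  have qw: "q \<in> Weq E" using weq_cancel_right[OF f(1,2,4)] f(6) w(1) by simp
  have Wf: "fibrant W" using XY(2) fibr_comp[OF f(2) _ f(5)] comp_hom[OF f(2)] unfolding fibrant_def by blast
  obtain \<rho> where \<rho>: "\<rho> \<in> hom E W X" "\<rho> \<cdot> j = Id E X"
    by (rule fibrant_extend[OF XY(1) f(3,4,1) id_hom[OF X]])
  have j\<rho>: "j \<cdot> \<rho> \<in> hom E W W" using f \<rho> by auto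
  have "j \<cdot> \<rho> \<cdot> j = Id E W \<cdot> j"
    using assoc[OF f(1) \<rho>(1) f(1)] \<rho>(2) comp_id[OF f(1)] id_comp[OF f(1)] by simp
  then have r: "(j \<cdot> \<rho> \<cdot> a, Id E W \<cdot> a) \<in> htp A W" if "a \<in> hom E A W" for a
    using htp_of_equal_restriction[OF A Wf f(3,4,1) j\<rho> id_hom[OF W] _ that] by simp
  show "(a, b) \<in> htp A X" if a: "a \<in> hom E A X" "b \<in> hom E A X" "(w \<cdot> a, w \<cdot> b) \<in> htp A Y"
  proof -
    have "(q \<cdot> (j \<cdot> a), q \<cdot> (j \<cdot> b)) \<in> htp A Y"
      using a(3) f(6) assoc[OF a(1) f(1,2)] assoc[OF a(2) f(1,2)] by simp
    then have "(j \<cdot> a, j \<cdot> b) \<in> htp A W"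
      by (rule acyclic_fibration_htp_inj[OF A f(5) qw f(2) comp_hom[OF a(1) f(1)] comp_hom[OF a(2) f(1)]])
    then have "(\<rho> \<cdot> (j \<cdot> a), \<rho> \<cdot> (j \<cdot> b)) \<in> htp A X" by (rule htp_comp[OF _ \<rho>(1)])
    then show ?thesis
      using assoc[OF a(1) f(1) \<rho>(1)] assoc[OF a(2) f(1) \<rho>(1)] \<rho>(2) id_comp[OF a(1)] id_comp[OF a(2)] by simp
  qed
  show "\<exists>a\<in>hom E A X. (w \<cdot> a, d) \<in> htp A Y" if d: "d \<in> hom E A Y"
  proof -
    obtain e where e: "e \<in> hom E A W" "q \<cdot> e = d"
      by (rule acyclic_fibration_surj[OF A f(5) qw f(2) d])
    have "(q \<cdot> (j \<cdot> \<rho> \<cdot> e), q \<cdot> (Id E W \<cdot> e)) \<in> htp A Y" by (rule htp_comp[OF r[OF e(1)] f(2)])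
    moreover have "q \<cdot> (j \<cdot> \<rho> \<cdot> e) = w \<cdot> (\<rho> \<cdot> e)"
      using e(1) f(1,2,6) \<rho>(1) by (simp add: hom_def comp_assoc comp_reassoc[OF f(6)])
    ultimately show ?thesis using e comp_hom[OF e(1) \<rho>(1)] id_comp[OF e(1)] by auto
  qed
qed

lemma fibrant_replacement:
  assumes "X \<in> Ob E"
  obtains r X' where "r \<in> hom E X X'" "r \<in> Cofib E" "r \<in> Weq E" "fibrant X'"
proof -
  obtain t where t: "t \<in> hom E X pt" using to_pt[OF assms] by blast
  show thesis by (rule factor_acyclic_cofibration[OF t]) (use that in \<open>auto simp: fibrant_def\<close>)
qed

lemma cofibrant_replacement:
  assumes "X \<in> Ob E"
  obtains p A where "p \<in> hom E A X" "p \<in> Fibr E" "p \<in> Weq E" "cofibrant A"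
proof -
  obtain z where z: "z \<in> hom E pt X" using from_pt[OF assms] by blast
  show thesis by (rule factor_acyclic_fibration[OF z]) (use that in \<open>auto simp: cofibrant_def\<close>)
qed

end

section \<open>Weak equivalences are the maps inverted by the localisation\<close>

context pointed_model
begin

text \<open>Let \<open>R\<close> be a fibrant replacement. Homotopy classes of maps \<open>A \<rightarrow> RX\<close> form a functor of \<open>X\<close>, although
  \<open>R\<close> itself is functorial only up to homotopy. This functor inverts the weak equivalences and
  therefore extends to the homotopy category, so it turns \<open>f\<close> into a bijection. For fibrant \<open>X\<close> the
  replacement does not change the homotopy classes.\<close>

lemma loc_iso_htp_bijective:
  assumes A: "cofibrant A" and XY: "fibrant X" "fibrant Y" and f: "f \<in> hom E X Y" "is_iso (Ho E) (loc E f)"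
  shows "a \<in> hom E A X \<Longrightarrow> b \<in> hom E A X \<Longrightarrow> (f \<cdot> a, f \<cdot> b) \<in> htp A Y \<Longrightarrow> (a, b) \<in> htp A X"
    and "d \<in> hom E A Y \<Longrightarrow> \<exists>a\<in>hom E A X. (f \<cdot> a, d) \<in> htp A Y"
proof -
  have "\<forall>x\<in>Ob E. \<exists>Q. fst Q \<in> hom E x (snd Q) \<and> fst Q \<in> Cofib E \<and> fst Q \<in> Weq E \<and> fibrant (snd Q)"
    using fibrant_replacement by (metis fst_conv snd_conv)
  then obtain Q where Q: "\<forall>x\<in>Ob E. fst (Q x) \<in> hom E x (snd (Q x)) \<and> fst (Q x) \<in> Cofib E \<and>
    fst (Q x) \<in> Weq E \<and> fibrant (snd (Q x))" by metis
  define r R where "r = (\<lambda>x. fst (Q x))" and "R = (\<lambda>x. snd (Q x))"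
  have r: "r x \<in> hom E x (R x)" "r x \<in> Cofib E" "r x \<in> Weq E" "fibrant (R x)" if "x \<in> Ob E" for x
    using Q that by (auto simp: r_def R_def)
  have "\<exists>k. k \<in> hom E (R (Dom E f)) (R (Cod E f)) \<and> k \<cdot> r (Dom E f) = r (Cod E f) \<cdot> f" if f: "f \<in> Ar E" for f
    using fibrant_extend[OF r(4) r(2,3,1) comp_hom[OF arr_hom[OF f] r(1)]] f by (metis Cod_Ob Dom_Ob)
  then obtain Rm where Rm': "\<forall>f\<in>Ar E. Rm f \<in> hom E (R (Dom E f)) (R (Cod E f)) \<and>
    Rm f \<cdot> r (Dom E f) = r (Cod E f) \<cdot> f" by metis
  have Rm: "Rm f \<in> hom E (R x) (R y)" "Rm f \<cdot> r x = r y \<cdot> f" if "f \<in> hom E x y" for f x y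
    using Rm' that by (auto simp: hom_def)
  have Rw: "Rm f \<in> Weq E" if f: "f \<in> hom E x y" "f \<in> Weq E" for f x y
    using weq_cancel_right[OF r(1) Rm(1)[OF f(1)] r(3)] weq_comp[OF f(1) r(1) f(2) r(3)] Rm(2)[OF f(1)]
      homD[OF f(1)] by simp
  define \<Phi> where "\<Phi> = (\<lambda>f. {(a, b). a \<in> hom E A (R (Dom E f)) \<and> (Rm f \<cdot> a, b) \<in> htp A (R (Cod E f))})"
  have \<Phi>: "(a, b) \<in> \<Phi> f \<longleftrightarrow> a \<in> hom E A (R x) \<and> (Rm f \<cdot> a, b) \<in> htp A (R y)" if "f \<in> hom E x y" for f x y a b
    using homD[OF that] by (simp add: \<Phi>_def)
  have sat: "htp A (R x) O \<Phi> f = \<Phi> f" "\<Phi> f O htp A (R y) = \<Phi> f" if f: "f \<in> hom E x y" for f x y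
  proof -
    show "htp A (R x) O \<Phi> f = \<Phi> f"
    proof (intro equalityI subrelI)
      fix a d assume "(a, d) \<in> htp A (R x) O \<Phi> f"
      then obtain b where "(a, b) \<in> htp A (R x)" "(b, d) \<in> \<Phi> f" by blast
      then show "(a, d) \<in> \<Phi> f"
        using htp_hom htp_trans[OF htp_comp[OF _ Rm(1)[OF f]]] unfolding \<Phi>[OF f] by blast
    next
      fix a d assume d: "(a, d) \<in> \<Phi> f"
      then have "(a, a) \<in> htp A (R x)" using htp_refl[OF A] by (simp add: \<Phi>[OF f])
      with d show "(a, d) \<in> htp A (R x) O \<Phi> f" by blast
    qed
    show "\<Phi> f O htp A (R y) = \<Phi> f"
    proof (intro equalityI subrelI)
      fix a d assume "(a, d) \<in> \<Phi> f O htp A (R y)"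
      then obtain b where "(a, b) \<in> \<Phi> f" "(b, d) \<in> htp A (R y)" by blast
      then show "(a, d) \<in> \<Phi> f" using htp_trans unfolding \<Phi>[OF f] by blast
    next
      fix a d assume d: "(a, d) \<in> \<Phi> f"
      then have "(d, d) \<in> htp A (R y)" using htp_refl[OF A] htp_hom unfolding \<Phi>[OF f] by blast
      with d show "(a, d) \<in> \<Phi> f O htp A (R y)" by blast
    qed
  qed
  define Fo where "Fo = (\<lambda>x. htp A (R x))"
  define Fm where "Fm = (\<lambda>f. (Fo (Dom E f), \<Phi> f, Fo (Cod E f)))"
  have func: "is_functor E per_category Fo Fm"
    unfolding is_functor_def
  proof (intro conjI ballI impI)
    fix x assume x: "x \<in> Ob E"
    show "Fo x \<in> Ob per_category" by (simp add: per_category_def Fo_def sym_htp trans_htp)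
    have "Rm (Id E x) \<cdot> r x = Id E (R x) \<cdot> r x" using Rm(2)[OF id_hom[OF x]] r(1)[OF x] by simp
    then have e: "(Rm (Id E x) \<cdot> a, a) \<in> htp A (R x)" if "a \<in> hom E A (R x)" for a
      using htp_of_equal_restriction[OF A r(4,2,3,1)[OF x] Rm(1)[OF id_hom[OF x]] id_hom _ that]
        homD[OF r(1)[OF x]] id_comp[OF that] by simp
    have "(a, b) \<in> \<Phi> (Id E x) \<longleftrightarrow> (a, b) \<in> htp A (R x)" for a b
      unfolding \<Phi>[OF id_hom[OF x]] using e[of a] htp_hom[of a b] htp_trans htp_sym by blast
    then have "\<Phi> (Id E x) = htp A (R x)" by auto
    then show "Fm (Id E x) = Id per_category (Fo x)" using x by (simp add: Fm_def per_category_def Fo_def)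
  next
    fix f assume f: "f \<in> Ar E"
    note fh = arr_hom[OF f]
    show "Fm f \<in> hom per_category (Fo (Dom E f)) (Fo (Cod E f))"
      using sat[OF fh] by (simp add: hom_def per_category_def Fm_def Fo_def sym_htp trans_htp)
    fix g assume g: "g \<in> Ar E" "Cod E f = Dom E g"
    have gh: "g \<in> hom E (Cod E f) (Cod E g)" using g by (simp add: hom_def)
    note gf = comp_hom[OF fh gh]
    have ob: "Dom E f \<in> Ob E" "Cod E f \<in> Ob E" "Cod E g \<in> Ob E" using f g by auto
    have RR: "Rm g \<cdot> Rm f \<in> hom E (R (Dom E f)) (R (Cod E g))" using comp_hom[OF Rm(1)[OF fh] Rm(1)[OF gh]] .
    have "Rm (g \<cdot> f) \<cdot> r (Dom E f) = Rm g \<cdot> Rm f \<cdot> r (Dom E f)"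
      using Rm[OF gf] Rm[OF fh] Rm[OF gh] r(1)[OF ob(1)] r(1)[OF ob(2)] r(1)[OF ob(3)]
        assoc[OF r(1)[OF ob(1)] Rm(1)[OF fh] Rm(1)[OF gh]] assoc[OF fh r(1)[OF ob(2)] Rm(1)[OF gh]]
        assoc[OF fh gh r(1)[OF ob(3)]] by simp
    then have e: "(Rm (g \<cdot> f) \<cdot> a, Rm g \<cdot> (Rm f \<cdot> a)) \<in> htp A (R (Cod E g))" if "a \<in> hom E A (R (Dom E f))" for a
      using htp_of_equal_restriction[OF A r(4)[OF ob(3)] r(2,3,1)[OF ob(1)] Rm(1)[OF gf] RR _ that]
        assoc[OF that Rm(1)[OF fh] Rm(1)[OF gh]] by simp
    have "\<Phi> f O \<Phi> g = \<Phi> (g \<cdot> f)"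
    proof (intro equalityI subrelI)
      fix a d assume "(a, d) \<in> \<Phi> f O \<Phi> g"
      then obtain b where "(a, b) \<in> \<Phi> f" "(b, d) \<in> \<Phi> g" by blast
      then have ab: "a \<in> hom E A (R (Dom E f))" "(Rm f \<cdot> a, b) \<in> htp A (R (Cod E f))"
        "(Rm g \<cdot> b, d) \<in> htp A (R (Cod E g))" by (simp_all add: \<Phi>[OF fh] \<Phi>[OF gh])
      have "(Rm (g \<cdot> f) \<cdot> a, d) \<in> htp A (R (Cod E g))"
        using htp_trans[OF htp_trans[OF e[OF ab(1)] htp_comp[OF ab(2) Rm(1)[OF gh]]] ab(3)] .
      then show "(a, d) \<in> \<Phi> (g \<cdot> f)" using ab(1) by (simp add: \<Phi>[OF gf])
    next
      fix a d assume "(a, d) \<in> \<Phi> (g \<cdot> f)"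
      then have ad: "a \<in> hom E A (R (Dom E f))" "(Rm (g \<cdot> f) \<cdot> a, d) \<in> htp A (R (Cod E g))"
        by (simp_all add: \<Phi>[OF gf])
      have "(a, Rm f \<cdot> a) \<in> \<Phi> f"
        using ad(1) htp_refl[OF A comp_hom[OF ad(1) Rm(1)[OF fh]]] by (simp add: \<Phi>[OF fh])
      moreover have "(Rm f \<cdot> a, d) \<in> \<Phi> g"
        using comp_hom[OF ad(1) Rm(1)[OF fh]] htp_trans[OF htp_sym[OF e[OF ad(1)]] ad(2)] by (simp add: \<Phi>[OF gh])
      ultimately show "(a, d) \<in> \<Phi> f O \<Phi> g" by blast
    qed
    then show "Fm (g \<cdot> f) = Fm g \<cdot>\<^bsub>per_category\<^esub> Fm f"
      using f g by (simp add: Fm_def per_category_def)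
  qed
  \<comment> \<open>\<open>R\<close> preserves weak equivalences, and those between fibrant objects are bijective on
    homotopy classes.\<close>
  have "is_iso per_category (Fm w)" if w: "w \<in> Weq E" for w
  proof -
    note wh = arr_hom[OF weq_arr[OF w]]
    have ob: "Dom E w \<in> Ob E" "Cod E w \<in> Ob E" using homD[OF wh] by auto
    note bij = weq_htp_bijective[OF A r(4)[OF ob(1)] r(4)[OF ob(2)] Rw[OF wh w] Rm(1)[OF wh]]
    show ?thesis
      unfolding Fm_def
    proof (rule per_isoI)
      show "(Fo (Dom E w), \<Phi> w, Fo (Cod E w)) \<in> Ar per_category"
        using sat[OF wh] by (simp add: per_category_def Fo_def sym_htp trans_htp)
    next
      fix a assume "(a, a) \<in> Fo (Dom E w)"
      then have "a \<in> hom E A (R (Dom E w))" using htp_hom by (auto simp: Fo_def)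
      then show "\<exists>b. (a, b) \<in> \<Phi> w"
        using htp_refl[OF A comp_hom[OF _ Rm(1)[OF wh]]] by (auto simp: \<Phi>[OF wh])
    next
      fix b assume "(b, b) \<in> Fo (Cod E w)"
      then have "b \<in> hom E A (R (Cod E w))" using htp_hom by (auto simp: Fo_def)
      then show "\<exists>a. (a, b) \<in> \<Phi> w" using bij(2) by (auto simp: \<Phi>[OF wh])
    next
      fix a b b' assume "(a, b) \<in> \<Phi> w" "(a, b') \<in> \<Phi> w"
      then show "(b, b') \<in> Fo (Cod E w)" using htp_sym htp_trans unfolding \<Phi>[OF wh] Fo_def by blast
    next
      fix a a' b assume "(a, b) \<in> \<Phi> w" "(a', b) \<in> \<Phi> w"
      then show "(a, a') \<in> Fo (Dom E w)" using htp_sym htp_trans bij(1) unfolding \<Phi>[OF wh] Fo_def by blast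
    qed
  qed
  then interpret inverting_functor E pt per_category Fo Fm
    using func per_category by unfold_locales
  have "is_iso per_category (Fm f)" by (rule iso_of_loc_iso[OF homD(1)[OF f(1)] f(2)])
  then have "is_iso per_category (htp A (R X), \<Phi> f, htp A (R Y))"
    using homD[OF f(1)] by (simp add: Fm_def Fo_def)
  note iso = per_isoD[OF this, unfolded \<Phi>[OF f(1)]]
  have ob: "X \<in> Ob E" "Y \<in> Ob E" using homD[OF f(1)] by auto
  note rX = weq_htp_bijective[OF A XY(1) r(4)[OF ob(1)] r(3,1)[OF ob(1)]]
    and rY = weq_htp_bijective[OF A XY(2) r(4)[OF ob(2)] r(3,1)[OF ob(2)]]
  have sq: "Rm f \<cdot> (r X \<cdot> a) = r Y \<cdot> (f \<cdot> a)" if "a \<in> hom E A X" for a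
    using assoc[OF that r(1)[OF ob(1)] Rm(1)[OF f(1)]] assoc[OF that f(1) r(1)[OF ob(2)]] Rm(2)[OF f(1)] by simp
  show "(a, b) \<in> htp A X" if a: "a \<in> hom E A X" "b \<in> hom E A X" "(f \<cdot> a, f \<cdot> b) \<in> htp A Y"
  proof -
    have "(r Y \<cdot> (f \<cdot> a), r Y \<cdot> (f \<cdot> b)) \<in> htp A (R Y)" by (rule htp_comp[OF a(3) r(1)[OF ob(2)]])
    then have "(Rm f \<cdot> (r X \<cdot> a), r Y \<cdot> (f \<cdot> b)) \<in> htp A (R Y)" "(Rm f \<cdot> (r X \<cdot> b), r Y \<cdot> (f \<cdot> b)) \<in> htp A (R Y)"
      using sq[OF a(1)] sq[OF a(2)] htp_refl[OF A comp_hom[OF comp_hom[OF a(2) f(1)] r(1)[OF ob(2)]]] by simp_all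
    then have "(r X \<cdot> a, r X \<cdot> b) \<in> htp A (R X)"
      using iso(2) comp_hom[OF a(1) r(1)[OF ob(1)]] comp_hom[OF a(2) r(1)[OF ob(1)]] by blast
    then show ?thesis by (rule rX(1)[OF a(1,2)])
  qed
  show "\<exists>a\<in>hom E A X. (f \<cdot> a, d) \<in> htp A Y" if d: "d \<in> hom E A Y"
  proof -
    obtain e where e: "e \<in> hom E A (R X)" "(Rm f \<cdot> e, r Y \<cdot> d) \<in> htp A (R Y)"
      using iso(1)[OF htp_refl[OF A comp_hom[OF d r(1)[OF ob(2)]]]] by blast
    obtain a where a: "a \<in> hom E A X" "(r X \<cdot> a, e) \<in> htp A (R X)" using rX(2)[OF e(1)] by blast
    have "(r Y \<cdot> (f \<cdot> a), r Y \<cdot> d) \<in> htp A (R Y)"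
      using htp_trans[OF htp_comp[OF a(2) Rm(1)[OF f(1)]] e(2)] sq[OF a(1)] by simp
    then show ?thesis using rY(1)[OF comp_hom[OF a(1) f(1)] d] a(1) by blast
  qed
qed

text \<open>By bijectivity on homotopy classes \<open>p\<close> has a right inverse up to homotopy, and the homotopy can be
  lifted to make it a right inverse \<open>g'\<close>. Injectivity makes \<open>g' \<cdot> p\<close> homotopic to the identity, thus
  a weak equivalence, and \<open>p\<close> is a retract of it.\<close>

lemma loc_iso_fibration_weq:
  assumes X: "fibrant X" "cofibrant X" and Y: "fibrant Y" "cofibrant Y"
    and p: "p \<in> Fibr E" "p \<in> hom E X Y" "is_iso (Ho E) (loc E p)"
  shows "p \<in> Weq E"
proof -
  have ob: "X \<in> Ob E" "Y \<in> Ob E" using homD[OF p(2)] by auto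
  obtain g where g: "g \<in> hom E Y X" "(p \<cdot> g, Id E Y) \<in> htp Y Y"
    using loc_iso_htp_bijective(2)[OF Y(2) X(1) Y(1) p(2,3) id_hom[OF ob(2)]] by blast
  obtain g' where g': "g' \<in> hom E Y X" "p \<cdot> g' = Id E Y"
    by (rule htp_lift[OF p(1,2) g(2,1)])
  have g'p: "g' \<cdot> p \<in> hom E X X" using g' p by auto
  have e: "p \<cdot> (g' \<cdot> p) = p" using assoc[OF p(2) g'(1) p(2)] g'(2) id_comp[OF p(2)] by simp
  then have "(p \<cdot> (g' \<cdot> p), p \<cdot> Id E X) \<in> htp X Y" using htp_refl[OF X(2) p(2)] comp_id[OF p(2)] by simp
  then have "(g' \<cdot> p, Id E X) \<in> htp X X"
    by (rule loc_iso_htp_bijective(1)[OF X(2) X(1) Y(1) p(2,3) g'p id_hom[OF ob(1)]])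
  then have w: "g' \<cdot> p \<in> Weq E" using htp_weq_iff ob(1) by blast
  have "is_retract E p (g' \<cdot> p)"
    unfolding is_retract_def
  proof (intro conjI bexI)
    show "Id E X \<cdot> Id E X = Id E (Dom E p)" "p \<cdot> g' = Id E (Cod E p)"
      using homD[OF p(2)] comp_id[OF id_hom[OF ob(1)]] g'(2) by simp_all
    show "g' \<cdot> p \<cdot> Id E X = g' \<cdot> p" "p \<cdot> Id E X = p \<cdot> (g' \<cdot> p)"
      using comp_id[OF g'p] comp_id[OF p(2)] e by simp_all
  qed (use homD[OF p(2)] homD[OF g'p] p(2) g'(1) ob in auto)
  then show ?thesis using retract_closed(1) w by blast
qed

lemma square_of_weqs:
  assumes h: "f \<in> hom E X Y" "f' \<in> hom E X' Y'" "a \<in> hom E X X'" "b \<in> hom E Y Y'"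
    and w: "a \<in> Weq E" "b \<in> Weq E" and eq: "b \<cdot> f = f' \<cdot> a"
  shows "f \<in> Weq E \<longleftrightarrow> f' \<in> Weq E" and "is_iso (Ho E) (loc E f) \<longleftrightarrow> is_iso (Ho E) (loc E f')"
proof -
  show "f \<in> Weq E \<longleftrightarrow> f' \<in> Weq E"
    using weq_comp_iff_right[OF h(1,4) w(2)] weq_comp_iff_left[OF h(3,2) w(1)] eq by simp
  note l = h[THEN loc_hom] and i = w[THEN loc_weq_iso]
  have "is_iso (Ho E) (loc E b \<cdot>\<^bsub>Ho E\<^esub> loc E f) \<longleftrightarrow> is_iso (Ho E) (loc E f)"
    using Ho.iso_comp[OF _ l(1) i(2) l(4)] Ho.iso_cancel(2)[OF l(1,4) _ i(2)] by blast
  moreover have "is_iso (Ho E) (loc E f' \<cdot>\<^bsub>Ho E\<^esub> loc E a) \<longleftrightarrow> is_iso (Ho E) (loc E f')"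
    using Ho.iso_comp[OF i(1) l(3) _ l(2)] Ho.iso_cancel(1)[OF l(3,2) _ i(1)] by blast
  ultimately show "is_iso (Ho E) (loc E f) \<longleftrightarrow> is_iso (Ho E) (loc E f')"
    using functor_comp[OF loc_functor h(1,4)] functor_comp[OF loc_functor h(3,2)] eq by simp
qed

text \<open>Up to weak equivalence, every map is a fibration between objects that are fibrant and cofibrant.\<close>

theorem weq_of_loc_iso:
  assumes f: "f \<in> hom E X Y" "is_iso (Ho E) (loc E f)"
  shows "f \<in> Weq E"
proof -
  have ob: "X \<in> Ob E" "Y \<in> Ob E" using homD[OF f(1)] by auto
  obtain r X1 where r: "r \<in> hom E X X1" "r \<in> Cofib E" "r \<in> Weq E" "fibrant X1"
    by (rule fibrant_replacement[OF ob(1)])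
  obtain r' Y1 where r': "r' \<in> hom E Y Y1" "r' \<in> Cofib E" "r' \<in> Weq E" "fibrant Y1"
    by (rule fibrant_replacement[OF ob(2)])
  obtain f1 where f1: "f1 \<in> hom E X1 Y1" "f1 \<cdot> r = r' \<cdot> f"
    by (rule fibrant_extend[OF r'(4) r(2,3,1) comp_hom[OF f(1) r'(1)]])
  obtain s A where s: "s \<in> hom E A X1" "s \<in> Fibr E" "s \<in> Weq E" "cofibrant A"
    using cofibrant_replacement homD(4)[OF f1(1)] by blast
  obtain s' B where s': "s' \<in> hom E B Y1" "s' \<in> Fibr E" "s' \<in> Weq E" "cofibrant B"
    using cofibrant_replacement homD(5)[OF f1(1)] by blast
  obtain g where g: "g \<in> hom E A B" "s' \<cdot> g = f1 \<cdot> s"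
    by (rule acyclic_fibration_surj[OF s(4) s'(2,3,1) comp_hom[OF s(1) f1(1)]])
  obtain W j p where p: "j \<in> hom E A W" "p \<in> hom E W B" "j \<in> Cofib E" "j \<in> Weq E" "p \<in> Fibr E" "p \<cdot> j = g"
    by (rule factor_acyclic_cofibration[OF g(1)])
  have B: "B \<in> Ob E" using homD[OF p(2)] by simp
  have Bf: "fibrant B"
    using r'(4) fibr_comp[OF s'(1) _ s'(2)] comp_hom[OF s'(1)] unfolding fibrant_def by blast
  have Wf: "fibrant W" "cofibrant W"
    using Bf fibr_comp[OF p(2) _ p(5)] comp_hom[OF p(2)] s(4) cofib_comp[OF _ p(1) _ p(3)] comp_hom[OF _ p(1)]
    unfolding fibrant_def cofibrant_def by blast+
  have e: "Id E B \<cdot> g = p \<cdot> j" using id_comp[OF g(1)] p(6) by simp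
  note s1 = square_of_weqs[OF f(1) f1(1) r(1) r'(1) r(3) r'(3) f1(2)[symmetric]]
    and s2 = square_of_weqs[OF g(1) f1(1) s(1) s'(1) s(3) s'(3) g(2)]
    and s3 = square_of_weqs[OF g(1) p(2,1) id_hom[OF B] p(4) id_weq[OF B] e]
  have "is_iso (Ho E) (loc E p)" using s1(2) s2(2) s3(2) f(2) by simp
  then have "p \<in> Weq E" by (rule loc_iso_fibration_weq[OF Wf Bf s'(4) p(5,2)])
  then show ?thesis using s1(1) s2(1) s3(1) by simp
qed

end

section \<open>Excisive model categories\<close>

context cone_model
begin

text \<open>The suspension preserves weak equivalences, so it extends to the homotopy category. The universal
  property of a total left derived functor \<open>(L, t)\<close>, applied to this extension and to \<open>L\<close> itself,
  shows that \<open>t\<close> is invertible. Hence \<open>L\<close> inverts the class of \<open>h\<close> as soon as the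
  suspension of \<open>h\<close> is a weak equivalence.\<close>

theorem excisive_imp_quotients_detect_weq:
  assumes "excisive E pt Cm c"
  shows "quotients_detect_weq E pt"
proof -
  obtain So Sm Lo Lm t where susp: "suspension_functor E pt Cm c So Sm"
    and tld: "total_left_derived E So Sm Lo Lm t" and cons: "conservative (Ho E) (Ho E) Lm"
    using assms by (auto simp: excisive_def)
  obtain q where S: "is_functor E E So Sm"
    and q: "\<forall>x\<in>Ob E. Cod E (q x) = So x \<and> is_quotient E pt (c x) (q x)"
    and Sq: "\<forall>f\<in>Ar E. Sm f \<cdot> q (Dom E f) = q (Cod E f) \<cdot> Cm f"
    using susp by (auto simp: suspension_functor_def)
  have Sm: "Sm f \<in> hom E (Cod E (q x)) (Cod E (q y))" "Sm f \<cdot> q x = q y \<cdot> Cm f"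
    "is_quotient E pt (c x) (q x)" "is_quotient E pt (c y) (q y)" if "f \<in> hom E x y" for f x y
    using functor_hom[OF S that] q Sq homD[OF that] by auto
  have Sw: "Sm w \<in> Weq E" if "w \<in> Weq E" for w
    using suspension_weq[OF arr_hom that Sm(3,4)] Sm(1,2) arr_hom weq_arr[OF that] by blast
  note LS = functor_compose[OF S loc_functor]
  interpret inverting_functor E pt "Ho E" So "\<lambda>f. loc E (Sm f)"
    using LS loc_weq_iso[OF Sw] by unfold_locales
  obtain Gm where G: "is_functor (Ho E) (Ho E) So Gm" "\<forall>f\<in>Ar E. Gm (loc E f) = loc E (Sm f)"
    by (rule extends_to_Ho)
  have L: "is_functor (Ho E) (Ho E) Lo Lm"
    and t: "nat_trans E (Ho E) Lo (\<lambda>f. Lm (loc E f)) So (\<lambda>f. loc E (Sm f)) t"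
    and univ: "\<And>Go Gm s. is_functor (Ho E) (Ho E) Go Gm \<Longrightarrow>
        nat_trans E (Ho E) Go (\<lambda>f. Gm (loc E f)) So (\<lambda>f. loc E (Sm f)) s \<Longrightarrow>
        \<exists>r. nat_trans (Ho E) (Ho E) Go Gm Lo Lm r \<and> (\<forall>x\<in>Ob E. t x \<cdot>\<^bsub>Ho E\<^esub> r x = s x) \<and>
           (\<forall>r'. nat_trans (Ho E) (Ho E) Go Gm Lo Lm r' \<longrightarrow>
              (\<forall>x\<in>Ob E. t x \<cdot>\<^bsub>Ho E\<^esub> r' x = s x) \<longrightarrow> (\<forall>x\<in>Ob E. r' x = r x))"
    using tld by (simp_all add: total_left_derived_def)
  have ob: "So x \<in> Ob E" "Lo x \<in> Ob E" if "x \<in> Ob E" for x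
    using S L that by (auto simp: is_functor_def)
  have "nat_trans E (Ho E) So (\<lambda>f. Gm (loc E f)) So (\<lambda>f. loc E (Sm f)) (\<lambda>x. Id (Ho E) (So x))"
    unfolding nat_trans_def
  proof (intro conjI ballI)
    show "Id (Ho E) (So x) \<in> hom (Ho E) (So x) (So x)" if "x \<in> Ob E" for x using ob that by simp
    fix f assume f: "f \<in> Ar E"
    have "loc E (Sm f) \<in> hom (Ho E) (So (Dom E f)) (So (Cod E f))"
      by (rule functor_hom[OF LS arr_hom[OF f]])
    then show "loc E (Sm f) \<cdot>\<^bsub>Ho E\<^esub> Id (Ho E) (So (Dom E f)) = Id (Ho E) (So (Cod E f)) \<cdot>\<^bsub>Ho E\<^esub> Gm (loc E f)"
      using G(2) f by simp
  qed
  from univ[OF G(1) this] obtain r where r: "nat_trans (Ho E) (Ho E) So Gm Lo Lm r"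
    "\<forall>x\<in>Ob E. t x \<cdot>\<^bsub>Ho E\<^esub> r x = Id (Ho E) (So x)" by blast
  have th: "t x \<in> hom (Ho E) (Lo x) (So x)" and rh: "r x \<in> hom (Ho E) (So x) (Lo x)" if "x \<in> Ob E" for x
    using t r(1) that by (auto simp: nat_trans_def)
  have "nat_trans E (Ho E) Lo (\<lambda>f. Lm (loc E f)) So (\<lambda>f. Gm (loc E f)) t"
    using t G(2) by (simp add: nat_trans_def)
  then have t': "nat_trans (Ho E) (Ho E) Lo Lm So Gm t"
    by (rule natural_on_Ho[OF category_Ho L G(1)])
  have rt: "nat_trans (Ho E) (Ho E) Lo Lm Lo Lm (\<lambda>x. r x \<cdot>\<^bsub>Ho E\<^esub> t x)"
    by (rule nat_trans_vcomp[OF category_Ho category_Ho L G(1) L t' r(1)])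
  have id: "nat_trans (Ho E) (Ho E) Lo Lm Lo Lm (\<lambda>x. Id (Ho E) (Lo x))"
    unfolding nat_trans_def
  proof (intro conjI ballI)
    show "Id (Ho E) (Lo x) \<in> hom (Ho E) (Lo x) (Lo x)" if "x \<in> Ob (Ho E)" for x using ob that by simp
    fix f assume f: "f \<in> Ar (Ho E)"
    show "Lm f \<cdot>\<^bsub>Ho E\<^esub> Id (Ho E) (Lo (Dom (Ho E) f)) = Id (Ho E) (Lo (Cod (Ho E) f)) \<cdot>\<^bsub>Ho E\<^esub> Lm f"
      using functor_hom[OF L Ho.arr_hom[OF f]] by simp
  qed
  have tt: "t x \<cdot>\<^bsub>Ho E\<^esub> (r x \<cdot>\<^bsub>Ho E\<^esub> t x) = t x" "t x \<cdot>\<^bsub>Ho E\<^esub> Id (Ho E) (Lo x) = t x" if "x \<in> Ob E" for x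
    using Ho.assoc[OF th[OF that] rh[OF that] th[OF that]] r(2) that Ho.id_comp[OF th[OF that]]
      Ho.comp_id[OF th[OF that]] by simp_all
  \<comment> \<open>Both \<open>r x \<cdot> t x\<close> and the identity factor \<open>t\<close> through itself.\<close>
  from univ[OF L t] obtain r0 where uniq: "\<And>r'. nat_trans (Ho E) (Ho E) Lo Lm Lo Lm r' \<Longrightarrow>
      \<forall>x\<in>Ob E. t x \<cdot>\<^bsub>Ho E\<^esub> r' x = t x \<Longrightarrow> \<forall>x\<in>Ob E. r' x = r0 x" by blast
  have "r x \<cdot>\<^bsub>Ho E\<^esub> t x = Id (Ho E) (Lo x)" if "x \<in> Ob E" for x
    using uniq[OF rt] uniq[OF id] tt that by simp
  then have t_iso: "is_iso (Ho E) (t x)" if "x \<in> Ob E" for x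
    using is_isoI[OF th[OF that] rh[OF that]] r(2) that by simp
  have refl: "h \<in> Weq E" if h: "h \<in> hom E x y" and w: "Sm h \<in> Weq E" for h x y
  proof -
    have xy: "x \<in> Ob E" "y \<in> Ob E" using homD[OF h] by auto
    note Lh = functor_hom[OF L loc_hom[OF h]] and Sh = functor_hom[OF LS h]
    have "is_iso (Ho E) (loc E (Sm h) \<cdot>\<^bsub>Ho E\<^esub> t x)"
      by (rule Ho.iso_comp[OF t_iso[OF xy(1)] th[OF xy(1)] loc_weq_iso[OF w] Sh])
    moreover have "loc E (Sm h) \<cdot>\<^bsub>Ho E\<^esub> t x = t y \<cdot>\<^bsub>Ho E\<^esub> Lm (loc E h)"
      using t h by (auto simp: nat_trans_def hom_def)
    ultimately have "is_iso (Ho E) (Lm (loc E h))"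
      using Ho.iso_cancel(2)[OF Lh th[OF xy(2)] _ t_iso[OF xy(2)]] by simp
    then have "is_iso (Ho E) (loc E h)"
      using cons Ho.homD(1)[OF loc_hom[OF h]] by (simp add: conservative_def)
    then show ?thesis by (rule weq_of_loc_iso[OF h])
  qed
  show ?thesis
    unfolding quotients_detect_weq_def
  proof (intro allI impI)
    fix i i' h p p' k
    assume a: "i \<in> Cofib E" "i' \<in> Cofib E" "Dom E i = Dom E i'" "h \<in> hom E (Cod E i) (Cod E i')" "h \<cdot> i = i'"
      "is_quotient E pt i p" "is_quotient E pt i' p'" "k \<in> hom E (Cod E p) (Cod E p')" "k \<cdot> p = p' \<cdot> h" "k \<in> Weq E"
    have i: "i \<in> hom E (Dom E i) (Cod E i)" "i' \<in> hom E (Dom E i) (Cod E i')"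
      using arr_hom[OF cofib_arr[OF a(1)]] arr_hom[OF cofib_arr[OF a(2)]] a(3) by simp_all
    have "Sm h \<in> Weq E"
      by (rule quotient_weq_imp_suspension_weq[OF a(1) i(1) a(2) i(2) a(4-10) Sm(3,4,1,2)[OF a(4)]])
    then show "h \<in> Weq E" by (rule refl[OF a(4)])
  qed
qed

end

theorem proposition2p6:
  fixes E :: "('o, 'm) model_cat"
    and pt :: 'o and Co :: "'o \<Rightarrow> 'o" and Cm :: "'m \<Rightarrow> 'm" and c :: "'o \<Rightarrow> 'm"
  assumes "model_category E" and "left_proper E" and "zero_object E pt"
    and "functorial_cone E pt Co Cm c"
  shows "(quotients_detect_weq E pt \<longrightarrow>
           (\<forall>f g \<alpha> \<beta> b k b' k' u.
              comm_square E f \<alpha> \<beta> g \<longrightarrow>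
              mapping_cone E c f b k \<longrightarrow> mapping_cone E c g b' k' \<longrightarrow>
              u \<in> hom E (Cod E b) (Cod E b') \<longrightarrow>
              u \<cdot>\<^bsub>E\<^esub> b = b' \<cdot>\<^bsub>E\<^esub> \<beta> \<longrightarrow> u \<cdot>\<^bsub>E\<^esub> k = k' \<cdot>\<^bsub>E\<^esub> Cm \<alpha> \<longrightarrow>
              (homotopy_pushout E f g \<alpha> \<beta> \<longleftrightarrow> u \<in> Weq E)))
         \<and> (excisive E pt Cm c \<longrightarrow> quotients_detect_weq E pt)"
proof -
  interpret cone_model E pt Co Cm c
    using assms by unfold_locales
  show ?thesis
    using homotopy_pushout_iff_cone_weq excisive_imp_quotients_detect_weq by blast
qed

end
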